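(* Consider the Cauchy problem $$\frac{d}{dt}u(t)-N(t,u(t))\,u(t)=\phi(t),\qquad u(t_0)=u_0\in\mathbb R^m,\qquad t\in[t_0,+\infty),$$ and assume: 1. $N(t,u)=\sum_{p=0}^{\infty}\sum_{i_1+\dots+i_m=p}u_1^{i_1}\cdots u_m^{i_m}N_{i_1\dots i_m}(t)$ for all $(t,u)\in[t_0,+\infty)\times\mathbb R^m$, where each $N_{i_1\dots i_m}:[t_0,+\infty)\to\mathbb R^{m\times m}$ is continuous, and there is a sequence of nonnegative reals $(B_p)_{p\ge0}$ with $\sum_{i_1+\dots+i_m=p}\sup_{t\ge t_0}\|N_{i_1\dots i_m}(t)\|\le B_p$ for all $p\ge0$ and such that $\sum_{p\ge0}B_pu^p$ converges for every $u\in\mathbb R$; 2. $\phi:[t_0,+\infty)\to\mathbb R^m$ is continuous and $\sup_{t\ge t_0}\|\phi(t)\|\le\kappa<+\infty$; 3. there is $\alpha>0$ such that $\langle v,J(t,u)v\rangle\le-\alpha\langle v,v\rangle$ for all $v,u\in\mathbb R^m$ and all $t\ge t_0$. Then for every $u_0\in\mathbb R^m$ the Cauchy problem has a unique solution $u(t)$ on $[t_0,+\infty)$, the FD-method for this problem converges to $u$ (in the sense defined in the context), and there exist positive constants $C,R,\varepsilon$, depending only on the data $N,\phi,u_0$ of the problem (not on the grid), such that for every grid $\hat\omega$ with maximal step $h$ and every integer $p\ge0$: $$\sup_{t\ge t_0}\Big\|u(t)-\overset{p}{u}(t)\Big\|\le\frac{C}{(p+1)^{1+\varepsilon}}\,\frac{(h/R)^{p+1}}{1-h/R}\quad\text{if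 } h<R,$$ $$\sup_{t\ge t_0}\Big\|u(t)-\overset{p}{u}(t)\Big\|\le C\sum_{j=p+1}^{\infty}\frac{1}{(j+1)^{1+\varepsilon}}\quad\text{if } h=R.$$
   Context: $\|\cdot\|$ is the Euclidean norm on $\mathbb R^m$ (and the induced operator norm on $\mathbb R^{m\times m}$), $\langle\cdot,\cdot\rangle$ the Euclidean inner product. $J(t,u)$ is the Jacobian in $u$ of $u\mapsto N(t,u)u$: $J(t,u)=N(t,u)+\big[\tfrac{\partial N}{\partial u_1}(t,u)u,\dots,\tfrac{\partial N}{\partial u_m}(t,u)u\big]$ (the matrix whose $p$-th column is $\tfrac{\partial N}{\partial u_p}(t,u)u$). Adomian polynomials: for a smooth matrix-valued function $M$ of $u\in\mathbb R^m$ and $v_0,\dots,v_k\in\mathbb R^m$, $A_k(M;v_0,\dots,v_k)=\frac1{k!}\frac{d^k}{d\tau^k}M\big(\sum_{i=0}^k\tau^iv_i\big)\big|_{\tau=0}$ (so $A_0(M;v_0)=M(v_0)$); $A_k(N(t,\cdot);\dots)$ means this applied to $u\mapsto N(t,u)$ with $t$ fixed. Grid: $\hat\omega=\{t_0<t_1<t_2<\dots\}$, $t_n\to+\infty$, $h_i=t_i-t_{i-1}$, $h=\sup_i h_i$. FD-method: $u^{(0)}$ is the continuous function on $[t_0,\infty)$, $C^1$ on each $[t_{i-1},t_i]$, solving the base problem $\frac{d}{dt}u^{(0)}(t)-N(t,u^{(0)}(t_{i-1}))u^{(0)}(t)=\phi(t)$ for $t\in[t_{i-1},t_i)$, $i\ge1$,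 $u^{(0)}(t_0)=u_0$. For $j\ge1$, $u^{(j)}$ is the continuous function, $C^1$ on each $[t_{i-1},t_i]$, with $u^{(j)}(t_0)=0$ and, for $t\in[t_{i-1},t_i)$, $$\tfrac{d}{dt}u^{(j)}(t)-N(t,u^{(0)}(t_{i-1}))u^{(j)}(t)=\Big[\sum_{p=1}^m\tfrac{\partial N}{\partial u_p}(t,u^{(0)}(t_{i-1}))\,u^{(j)}_p(t_{i-1})\Big]u^{(0)}(t)+F^{(j)}(t),$$ where, for $t\in[t_{i-1},t_i)$, $F^{(j)}(t)=\sum_{p=1}^{j-1}A_{j-p}\big(N(t,\cdot);u^{(0)}(t_{i-1}),\dots,u^{(j-p)}(t_{i-1})\big)u^{(p)}(t)+\sum_{p=0}^{j-1}\big[A_{j-1-p}\big(N(t,\cdot);u^{(0)}(t),\dots,u^{(j-1-p)}(t)\big)-A_{j-1-p}\big(N(t,\cdot);u^{(0)}(t_{i-1}),\dots,u^{(j-1-p)}(t_{i-1})\big)\big]u^{(p)}(t)+A_j\big(N(t,\cdot);u^{(0)}(t_{i-1}),\dots,u^{(j-1)}(t_{i-1}),0\big)u^{(0)}(t)$. The $p$-th approximation is $\overset{p}{u}=\sum_{i=0}^pu^{(i)}$. The FD-method converges (to the exact solution) on $[t_0,t_0+H)$ if there is $\bar h>0$ such that for every grid with $h\le\bar h$ the series $\sum_{i\ge0}u^{(i)}(t)$ converges absolutely and uniformly on $[t_0,t_0+H)$ (to the exact solution). *)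

theory Defs
  imports "HOL-Analysis.Analysis"
begin

definition matnorm :: "real^'m^'m \<Rightarrow> real" where
  "matnorm A = onorm (\<lambda>x. A *v x)"

fun vderiv_n :: "nat \<Rightarrow> (real \<Rightarrow> 'a::real_normed_vector) \<Rightarrow> real \<Rightarrow> 'a" where
  "vderiv_n 0 f = f"
| "vderiv_n (Suc k) f = (\<lambda>x. vector_derivative (vderiv_n k f) (at x))"

definition pderiv_mat :: "(real^'m \<Rightarrow> real^'m^'m) \<Rightarrow> real^'m \<Rightarrow> 'm \<Rightarrow> real^'m^'m" where
  "pderiv_mat M u q = vector_derivative (\<lambda>s. M (u + s *\<^sub>R axis q 1)) (at 0)"

definition adomian :: "(real^'m \<Rightarrow> real^'m^'m) \<Rightarrow> nat \<Rightarrow> (nat \<Rightarrow> real^'m) \<Rightarrow> real^'m^'m" where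
  "adomian M k vs = (1 / fact k) *\<^sub>R
     vderiv_n k (\<lambda>\<tau>. M (\<Sum>i\<le>k. \<tau> ^ i *\<^sub>R vs i)) 0"

definition jac :: "(real \<Rightarrow> real^'m \<Rightarrow> real^'m^'m) \<Rightarrow> real \<Rightarrow> real^'m \<Rightarrow> real^'m^'m" where
  "jac N t u = N t u + (\<chi> i q. (pderiv_mat (N t) u q *v u) $ i)"

definition is_solution ::
  "(real \<Rightarrow> real^'m \<Rightarrow> real^'m^'m) \<Rightarrow> (real \<Rightarrow> real^'m) \<Rightarrow> real \<Rightarrow> real^'m
   \<Rightarrow> (real \<Rightarrow> real^'m) \<Rightarrow> bool" where
  "is_solution N \<phi> t0 u0 u \<longleftrightarrow> u t0 = u0 \<and>
     (\<forall>t\<ge>t0. (u has_vector_derivative (N t (u t) *v u t + \<phi> t)) (at t within {t0..}))"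

definition is_grid :: "(nat \<Rightarrow> real) \<Rightarrow> real \<Rightarrow> bool" where
  "is_grid g t0 \<longleftrightarrow> g 0 = t0 \<and> strict_mono g \<and> filterlim g at_top sequentially"

definition grid_bdd :: "(nat \<Rightarrow> real) \<Rightarrow> bool" where
  "grid_bdd g \<longleftrightarrow> bdd_above (range (\<lambda>i. g (Suc i) - g i))"

definition grid_step :: "(nat \<Rightarrow> real) \<Rightarrow> real" where
  "grid_step g = (SUP i. g (Suc i) - g i)"

definition FD_F ::
  "(real \<Rightarrow> real^'m \<Rightarrow> real^'m^'m) \<Rightarrow> (nat \<Rightarrow> real) \<Rightarrow> (nat \<Rightarrow> real \<Rightarrow> real^'m)
   \<Rightarrow> nat \<Rightarrow> nat \<Rightarrow> real \<Rightarrow> real^'m" where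
  "FD_F N g U j i t =
     (\<Sum>p\<in>{1..j-1}. adomian (N t) (j - p) (\<lambda>k. U k (g i)) *v U p t)
   + (\<Sum>p<j. (adomian (N t) (j - 1 - p) (\<lambda>k. U k t)
               - adomian (N t) (j - 1 - p) (\<lambda>k. U k (g i))) *v U p t)
   + adomian (N t) j (\<lambda>k. if k < j then U k (g i) else 0) *v U 0 t"

definition FD_iterates ::
  "(real \<Rightarrow> real^'m \<Rightarrow> real^'m^'m) \<Rightarrow> (real \<Rightarrow> real^'m) \<Rightarrow> real^'m
   \<Rightarrow> (nat \<Rightarrow> real) \<Rightarrow> (nat \<Rightarrow> real \<Rightarrow> real^'m) \<Rightarrow> bool" where
  "FD_iterates N \<phi> u0 g U \<longleftrightarrow>
     U 0 (g 0) = u0 \<and> (\<forall>j\<ge>1. U j (g 0) = 0) \<and>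
     (\<forall>j. continuous_on {g 0..} (U j)) \<and>
     (\<forall>j i. \<exists>D. continuous_on {g i..g (Suc i)} D \<and>
        (\<forall>s\<in>{g i..g (Suc i)}. (U j has_vector_derivative D s) (at s within {g i..g (Suc i)})) \<and>
        (\<forall>s\<in>{g i..<g (Suc i)}.
           D s - N s (U 0 (g i)) *v U j s =
             (if j = 0 then \<phi> s
              else (\<Sum>q\<in>UNIV. U j (g i) $ q *\<^sub>R pderiv_mat (N s) (U 0 (g i)) q) *v U 0 s
                   + FD_F N g U j i s)))"

end

theory Submission
  imports Defs
begin

text \<open>
  Read the FD-iterates as coefficients of \<open>z(t; \<tau>) = \<Sum>j. \<tau>\<^sup>j u\<^bsup>(j)\<^esup>(t)\<close>. On the grid cell starting at \<open>t\<^sub>i\<close> they solve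
  \<open>z' = N(t, z(t\<^sub>i)) z + \<tau> [N(t, z) - N(t, z(t\<^sub>i))] z + \<phi>\<close>, which at \<open>\<tau> = 1\<close> is the original equation.
  Up to errors of order \<open>h\<close> the linear part of the equation for \<open>u\<^bsup>(j)\<^esup>\<close> is the Jacobian \<open>J\<close>, so
  dissipativity gives \<open>sup |u\<^bsup>(j)\<^esup>| \<le> c sup |F\<^bsup>(j)\<^esup>|\<close> with \<open>c\<close> independent of the grid. Majorising
  \<open>F\<^bsup>(j)\<^esup>\<close> coefficientwise by the entire function \<open>\<Sum>p. B\<^sub>p x\<^sup>p\<close> leaves a scalar recursion whose
  right-hand side is quadratic in the previous terms plus \<open>O(h)\<close>. In the submultiplicative weighted norm
  \<open>\<Sum>j. a\<^sub>j (K h)\<^sup>-\<^sup>j\<close> a small ball is invariant for large \<open>K\<close>, whence \<open>|u\<^bsup>(j)\<^esup>| \<le> E (K h)\<^sup>j\<close>.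
\<close>

section \<open>Majorants of formal power series\<close>

text \<open>The obstacle is uniformity: the grid has infinitely many cells, so no estimate may lose
  a factor from one cell to the next. Crude bounds on a cell, which cost a factor 2, therefore serve
  only the error terms. The size itself is controlled by showing that a ball is invariant, with an
  O(h) error paid for by slack in its radius; the same radius then works on the next cell. The
  recursion has no linear term because the part of the j-th Adomian polynomial that is linear in the
  j-th iterate belongs to the Jacobian, and what remains is evaluated on sequences cut off at j. The
  zeroth iterate is not small, so smallness is available only in positive degree: powers of the
  majorant are expanded about the constant term and only the quadratic remainder is estimated. The
  polynomial factor in the error bound is bought by shrinking R: a fourfold smaller radius yields
  \<open>(1/4)^j \<le> 1/(j+1)^2\<close>, whence \<epsilon> = 1.\<close>

definition fmaj :: "real fps \<Rightarrow> real fps \<Rightarrow> bool" where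
  "fmaj F V \<longleftrightarrow> (\<forall>n. \<bar>fps_nth F n\<bar> \<le> fps_nth V n)"

lemma fmajD: "fmaj F V \<Longrightarrow> \<bar>fps_nth F n\<bar> \<le> fps_nth V n"
  by (simp add: fmaj_def)

lemma fmaj_nonneg: "fmaj F V \<Longrightarrow> 0 \<le> fps_nth V n"
  using fmajD[of F V n] by linarith

text \<open>\<open>fmaj V V\<close> says exactly that all coefficients of \<open>V\<close> are
  nonnegative; it is the form in which nonnegativity is passed around below.\<close>

lemma fmaj_refl: "fmaj F V \<Longrightarrow> fmaj V V"
  by (simp add: fmaj_def) (metis abs_ge_zero abs_of_nonneg order_trans)

lemma fmaj_one: "fmaj 1 1"
  by (simp add: fmaj_def)

lemma fmaj_add: "fmaj F V \<Longrightarrow> fmaj G W \<Longrightarrow> fmaj (F + G) (V + W)"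
  unfolding fmaj_def fps_add_nth by (meson abs_triangle_ineq add_mono order_trans)

lemma fmaj_mult: "fmaj F V \<Longrightarrow> fmaj G W \<Longrightarrow> fmaj (F * G) (V * W)"
proof -
  assume F: "fmaj F V" and G: "fmaj G W"
  show ?thesis unfolding fmaj_def
  proof
    fix n
    have "\<bar>fps_nth (F * G) n\<bar> \<le> (\<Sum>i=0..n. \<bar>fps_nth F i * fps_nth G (n - i)\<bar>)"
      unfolding fps_mult_nth by (rule sum_abs)
    also have "\<dots> \<le> (\<Sum>i=0..n. fps_nth V i * fps_nth W (n - i))"
      unfolding abs_mult by (intro sum_mono mult_mono fmajD F G fmaj_nonneg[OF F]) auto
    finally show "\<bar>fps_nth (F * G) n\<bar> \<le> fps_nth (V * W) n"
      unfolding fps_mult_nth .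
  qed
qed

lemma fmaj_power: "fmaj F V \<Longrightarrow> fmaj (F ^ p) (V ^ p)"
  by (induction p) (auto intro: fmaj_mult fmaj_one)

text \<open>Under these hypotheses \<open>V\<close> majorises 1, so a majorant may be padded with a
  further factor \<open>V\<close>. This brings terms to a common power of \<open>V\<close>.\<close>

lemma fmaj_mult_right: "fmaj F X \<Longrightarrow> fmaj V V \<Longrightarrow> 1 \<le> fps_nth V 0 \<Longrightarrow> fmaj F (X * V)"
proof -
  assume X: "fmaj F X" and V: "fmaj V V" and V0: "1 \<le> fps_nth V 0"
  have "fmaj 1 V" unfolding fmaj_def
  proof
    fix n show "\<bar>fps_nth 1 n\<bar> \<le> fps_nth V n"
      using V0 fmaj_nonneg[OF V, of n] by (cases n) auto
  qed
  from fmaj_mult[OF X this] show ?thesis by simp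
qed

section \<open>Monomials in several power series\<close>

definition mpow :: "('m::finite \<Rightarrow> 'a::comm_monoid_mult) \<Rightarrow> ('m \<Rightarrow> nat) \<Rightarrow> 'a" where
  "mpow x a = (\<Prod>k\<in>UNIV. x k ^ a k)"

text \<open>A monomial is built one factor at a time, with \<open>n\<close> counting its degree.
  Three families run in parallel over the same exponent, so that relations between their monomials
  follow from this single induction.\<close>

lemma mpow_induct3:
  assumes one: "Q 0 1 1 1"
    and mult: "\<And>n k F G H. Q n F G H \<Longrightarrow> Q (Suc n) (F * x k) (G * y k) (H * z k)"
  shows "Q (sum a UNIV) (mpow x a) (mpow y a) (mpow z a)"
proof -
  have pw: "Q (n + e) (F * x k ^ e) (G * y k ^ e) (H * z k ^ e)"
    if "Q n F G H" for n e k F G H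
    using that
  proof (induction e)
    case (Suc e)
    from mult[OF Suc.IH[OF Suc.prems], of k] show ?case
      by (simp add: mult.assoc power_commutes)
  qed auto
  have "Q (sum a S) (\<Prod>k\<in>S. x k ^ a k) (\<Prod>k\<in>S. y k ^ a k) (\<Prod>k\<in>S. z k ^ a k)" if "finite S" for S
    using that
  proof (induction S rule: finite_induct)
    case (insert k S)
    from pw[OF insert.IH, of "a k" k] insert.hyps show ?case
      by (simp add: mult.commute add.commute)
  qed (simp add: one)
  then show ?thesis unfolding mpow_def by simp
qed

lemma mpow_fmaj:
  assumes "\<And>k. fmaj (x k) V"
  shows "fmaj (mpow x a) (V ^ sum a UNIV)"
  by (rule mpow_induct3[where Q="\<lambda>n F G H. fmaj F (V ^ n)" and y=x and z=x])
    (auto intro!: fmaj_one fmaj_mult[OF _ assms] simp: mult.commute[of V])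

text \<open>Telescoping: \<open>F x - G y = (F - G) x + G (x - y)\<close>. The sharp count would
  give \<open>n * D * V ^ (n - 1)\<close>; the form \<open>2 ^ n * D * V ^ n\<close> is used because
  a geometric factor is absorbed by evaluating the entire majorant at twice the argument. Raising
  the power of \<open>V\<close> by one is where \<open>1 \<le> fps_nth V 0\<close> enters.\<close>

lemma mpow_diff_fmaj:
  assumes x: "\<And>k. fmaj (x k) V" and y: "\<And>k. fmaj (y k) V"
    and d: "\<And>k. fmaj (x k - y k) D" and V0: "1 \<le> fps_nth V 0"
  shows "fmaj (mpow x a - mpow y a) (2 ^ sum a UNIV * (D * V ^ sum a UNIV))"
proof -
  have VV: "fmaj V V" and DD: "fmaj D D" using x d fmaj_refl by blast+
  let ?Q = "\<lambda>n F G (H::real fps). fmaj F (V ^ n) \<and> fmaj G (V ^ n) \<and> fmaj (F - G) (2 ^ n * (D * V ^ n))"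
  have "?Q (sum a UNIV) (mpow x a) (mpow y a) (mpow x a)"
  proof (rule mpow_induct3[where Q="?Q"])
    show "?Q 0 1 1 1" using fmaj_nonneg[OF DD] by (auto simp: fmaj_one) (simp add: fmaj_def)
  next
    fix n k F G H assume Q: "?Q n F G H"
    have e: "F * x k - G * y k = (F - G) * x k + G * (x k - y k)" by (simp add: algebra_simps)
    have 1: "fmaj ((F - G) * x k) (2 ^ n * (D * V ^ n) * V)"
      using Q x by (intro fmaj_mult) auto
    have two: "fmaj (1::real fps) (2 ^ n)"
    proof -
      have "fmaj (1::real fps) 2" unfolding fmaj_def by (auto simp: fps_numeral_nth)
      from fmaj_power[OF this, of n] show ?thesis by simp
    qed
    have 2: "fmaj (1 * (G * (x k - y k))) (2 ^ n * ((V ^ n * D) * V))"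
      by (intro fmaj_mult two fmaj_mult_right) (use Q d VV V0 in auto)
    have "fmaj (F * x k - G * y k) (2 ^ n * (D * V ^ n) * V + 2 ^ n * ((V ^ n * D) * V))"
      unfolding e using fmaj_add[OF 1 2] by simp
    moreover have "2 ^ n * (D * V ^ n) * V + 2 ^ n * ((V ^ n * D) * V) = 2 ^ Suc n * (D * V ^ Suc n)"
      by (simp add: algebra_simps)
    ultimately show "?Q (Suc n) (F * x k) (G * y k) (H * x k)"
      using fmaj_mult[of F "V ^ n" "x k" V] fmaj_mult[of G "V ^ n" "y k" V] x y Q
      by (simp add: mult_ac)
  qed
  then show ?thesis by blast
qed

lemma mpow_nth_0: "fps_nth (mpow x a) 0 = mpow (\<lambda>k. fps_nth (x k) 0 :: real) a"
  by (rule mpow_induct3[where Q="\<lambda>n F (G::real) (H::real). fps_nth F 0 = G" and z="\<lambda>_. 1"]) auto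

text \<open>Substituting \<open>c * \<tau>\<close> for \<tau> in every factor substitutes it in the
  product.\<close>

lemma mpow_nth_scale:
  assumes "\<And>k n. fps_nth (y k) n = c ^ n * fps_nth (x k) n"
  shows "fps_nth (mpow y a) n = c ^ n * fps_nth (mpow x a :: real fps) n"
proof -
  let ?Q = "\<lambda>_ (F::real fps) (G::real fps) (H::real fps). \<forall>n. fps_nth G n = c ^ n * fps_nth F n"
  have "?Q (sum a UNIV) (mpow x a) (mpow y a) (mpow x a)"
  proof (rule mpow_induct3[where Q="?Q"])
    show "?Q 0 1 1 1" by simp
  next
    fix m k F G H assume Q: "?Q m F G H"
    have "fps_nth (G * y k) n = c ^ n * fps_nth (F * x k) n" for n
      unfolding fps_mult_nth sum_distrib_left
    proof (rule sum.cong)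
      fix i assume "i \<in> {0..n}"
      then have "c ^ n = c ^ i * c ^ (n - i)" by (simp flip: power_add)
      then show "fps_nth G i * fps_nth (y k) (n - i) = c ^ n * (fps_nth F i * fps_nth (x k) (n - i))"
        using Q assms by simp
    qed simp
    then show "?Q (Suc m) (F * x k) (G * y k) (H * x k)" by blast
  qed
  then show ?thesis by blast
qed

lemma mpow_nth_cong:
  assumes "\<And>k i. i \<le> n \<Longrightarrow> fps_nth (x k) i = fps_nth (y k) i"
  shows "fps_nth (mpow x a :: real fps) n = fps_nth (mpow y a) n"
proof -
  let ?Q = "\<lambda>_ (F::real fps) (G::real fps) (H::real fps). \<forall>i\<le>n. fps_nth G i = fps_nth F i"
  have "?Q (sum a UNIV) (mpow x a) (mpow y a) (mpow x a)"
  proof (rule mpow_induct3[where Q="?Q"])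
    fix m k F G H assume Q: "?Q m F G H"
    then show "?Q (Suc m) (F * x k) (G * y k) (H * x k)"
      unfolding fps_mult_nth using assms by (auto intro!: sum.cong)
  qed simp
  then show ?thesis by simp
qed

text \<open>Extracting the \<open>n\<close>-th coefficient is affine in the \<open>n\<close>-th coefficients of the factors, with
  the same linear part as for \<open>n = 1\<close>.\<close>

lemma fps_mult_nth_split:
  assumes "0 < n"
  shows "fps_nth (F * G :: real fps) n = fps_nth F 0 * fps_nth G n + fps_nth F n * fps_nth G 0
    + (\<Sum>i\<in>{1..<n}. fps_nth F i * fps_nth G (n - i))"
proof -
  have "{0..n} = insert 0 (insert n {1..<n})" using assms by auto
  then show ?thesis unfolding fps_mult_nth using assms by simp
qed

text \<open>\<open>z\<close> is the linearised path: the constant terms of \<open>x\<close>, with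
  the change of the \<open>n\<close>-th coefficients moved to degree 1. In degree \<open>n\<close> a
  changed coefficient can meet only constant terms of the other factors, exactly as in degree
  1.\<close>

lemma mpow_nth_last:
  fixes x y z :: "'m::finite \<Rightarrow> real fps"
  assumes n: "0 < n" and lt: "\<And>k i. i < n \<Longrightarrow> fps_nth (x k) i = fps_nth (y k) i"
    and z0: "\<And>k. fps_nth (z k) 0 = fps_nth (x k) 0"
    and z1: "\<And>k. fps_nth (x k) n = fps_nth (y k) n + fps_nth (z k) 1"
  shows "fps_nth (mpow x a) n = fps_nth (mpow y a) n + fps_nth (mpow z a) 1"
proof -
  let ?Q = "\<lambda>(_::nat) (F::real fps) (G::real fps) (H::real fps). (\<forall>i<n. fps_nth F i = fps_nth G i) \<and> fps_nth H 0 = fps_nth F 0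
    \<and> fps_nth F n = fps_nth G n + fps_nth H 1"
  have "?Q (sum a UNIV) (mpow x a) (mpow y a) (mpow z a)"
  proof (rule mpow_induct3[where Q="?Q"])
    show "?Q 0 1 1 1" by simp
  next
    fix m k F G H assume Q: "?Q m F G H"
    have 1: "fps_nth (F * x k) i = fps_nth (G * y k) i" if "i < n" for i
      unfolding fps_mult_nth using that Q lt by (auto intro!: sum.cong)
    have s: "(\<Sum>i\<in>{Suc 0..<n}. fps_nth G i * fps_nth (x k) (n - i)) =
        (\<Sum>i\<in>{Suc 0..<n}. fps_nth G i * fps_nth (y k) (n - i))"
      using Q lt by (auto intro!: sum.cong)
    have "fps_nth G 0 = fps_nth F 0" "fps_nth (y k) 0 = fps_nth (x k) 0" using Q lt n by auto
    then have 2: "fps_nth (F * x k) n = fps_nth (G * y k) n + fps_nth (H * z k) 1"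
      using Q z0 z1[of k] s
      by (simp add: fps_mult_nth_split[OF n] fps_mult_nth_split[of 1] algebra_simps)
    show "?Q (Suc m) (F * x k) (G * y k) (H * z k)"
      using 1 2 Q z0 by simp
  qed
  then show ?thesis by simp
qed

text \<open>A term of degree 1 takes its degree from one factor and constant terms from all others.
  This is the source of the linearity of \<open>DN\<close>.\<close>

lemma mpow_nth_1_linear:
  fixes x y z :: "'m::finite \<Rightarrow> real fps"
  assumes x0: "\<And>k. fps_nth (x k) 0 = fps_nth (z k) 0"
    and y0: "\<And>k. fps_nth (y k) 0 = fps_nth (z k) 0"
    and z1: "\<And>k. fps_nth (z k) 1 = c * fps_nth (x k) 1 + fps_nth (y k) 1"
  shows "fps_nth (mpow z a) 1 = c * fps_nth (mpow x a) 1 + fps_nth (mpow y a) 1"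
proof -
  let ?Q = "\<lambda>(_::nat) (F::real fps) (G::real fps) (H::real fps). fps_nth F 0 = fps_nth H 0 \<and> fps_nth G 0 = fps_nth H 0
    \<and> fps_nth H 1 = c * fps_nth F 1 + fps_nth G 1"
  have "?Q (sum a UNIV) (mpow x a) (mpow y a) (mpow z a)"
  proof (rule mpow_induct3[where Q="?Q"])
    fix m k F G H assume Q: "?Q m F G H"
    then show "?Q (Suc m) (F * x k) (G * y k) (H * z k)"
      using x0[of k] y0[of k] z1[of k] by (simp add: fps_mult_nth_split[of 1] algebra_simps)
  qed simp
  then show ?thesis by simp
qed

text \<open>Evaluation at \<tau> = 1. Absolute summability is carried through the induction because
  the Cauchy product with the next factor uses it.\<close>

lemma mpow_sums:
  fixes x :: "'m::finite \<Rightarrow> real fps"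
  assumes "\<And>k. summable (\<lambda>n. \<bar>fps_nth (x k) n\<bar>)" "\<And>k. fps_nth (x k) sums s k"
  shows "fps_nth (mpow x a) sums mpow s a"
proof -
  let ?Q = "\<lambda>(_::nat) F (r::real) (H::real). summable (\<lambda>n. norm (fps_nth F n)) \<and> fps_nth F sums r"
  have "?Q (sum a UNIV) (mpow x a) (mpow s a) (mpow s a)"
  proof (rule mpow_induct3[where Q="?Q"])
    have "fps_nth (1::real fps) sums (\<Sum>n\<in>{0}. fps_nth (1::real fps) n)"
      by (intro sums_finite) auto
    then have "fps_nth (1::real fps) sums 1" by (simp only: sum.insert sum.empty finite.emptyI empty_iff fps_one_nth simp_thms if_True add_0_right not_False_eq_True)
    moreover have "summable (\<lambda>n. norm (fps_nth (1::real fps) n))"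
      by (rule summable_finite[of "{0}"]) auto
    ultimately show "?Q 0 1 1 1" by simp
  next
    fix m k F r H assume Q: "?Q m F r H"
    have xk: "summable (\<lambda>n. norm (fps_nth (x k) n))" using assms by simp
    have e: "fps_nth (F * x k) = (\<lambda>n. \<Sum>i\<le>n. fps_nth F i * fps_nth (x k) (n - i))"
      by (auto simp: fps_mult_nth atLeast0AtMost)
    have "fps_nth (F * x k) sums (r * s k)"
      unfolding e using Cauchy_product_sums[of "fps_nth F" "fps_nth (x k)"] Q xk assms(2)[of k]
      by (auto simp: sums_iff)
    moreover have "summable (\<lambda>n. norm (fps_nth (F * x k) n))"
    proof (rule summable_comparison_test')
      show "summable (\<lambda>n. \<Sum>i\<le>n. norm (fps_nth F i) * norm (fps_nth (x k) (n - i)))"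
        by (rule summable_Cauchy_product) (use Q xk in auto)
      show "norm (norm (fps_nth (F * x k) n)) \<le> (\<Sum>i\<le>n. norm (fps_nth F i) * norm (fps_nth (x k) (n - i)))"
        if "0 \<le> n" for n
        unfolding e using norm_sum[of "\<lambda>i. fps_nth F i * fps_nth (x k) (n - i)" "{..n}"]
        by (simp add: abs_mult)
    qed
    ultimately show "?Q (Suc m) (F * x k) (r * s k) (H * s k)" by simp
  qed
  then show ?thesis by simp
qed

text \<open>A weighted l1 norm, cut off at degree \<open>n\<close> so that finite sums suffice.
  Absolute values are absent since the estimates with it concern series with nonnegative
  coefficients.\<close>

definition wnorm :: "real \<Rightarrow> nat \<Rightarrow> real fps \<Rightarrow> real" where
  "wnorm x n F = (\<Sum>i\<le>n. fps_nth F i * x ^ i)"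

lemma wnorm_nonneg: "fmaj V V \<Longrightarrow> 0 \<le> x \<Longrightarrow> 0 \<le> wnorm x n V"
  unfolding wnorm_def by (intro sum_nonneg mult_nonneg_nonneg fmaj_nonneg) auto

text \<open>The product collects the terms over the triangle \<open>i + j \<le> n\<close>, which
  lies in the square; the additional terms of the square are nonnegative.\<close>

lemma wnorm_mult:
  assumes "fmaj V V" "fmaj W W" "0 \<le> x"
  shows "wnorm x n (V * W) \<le> wnorm x n V * wnorm x n W"
proof -
  let ?g = "\<lambda>i j. (fps_nth V i * x ^ i) * (fps_nth W j * x ^ j)"
  have "wnorm x n (V * W) = (\<Sum>k\<le>n. \<Sum>i\<le>k. ?g i (k - i))"
    unfolding wnorm_def fps_mult_nth sum_distrib_right atLeast0AtMost
  proof (intro sum.cong refl)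
    fix k i :: nat assume "i \<in> {..k}"
    then have "x ^ k = x ^ i * x ^ (k - i)" by (simp flip: power_add)
    then show "fps_nth V i * fps_nth W (k - i) * x ^ k = ?g i (k - i)" by simp
  qed
  also have "\<dots> = (\<Sum>(i,j)\<in>{(i,j). i + j \<le> n}. ?g i j)"
    by (rule sum.triangle_reindex_eq[symmetric])
  also have "\<dots> \<le> (\<Sum>(i,j)\<in>{..n} \<times> {..n}. ?g i j)"
    using assms by (intro sum_mono2) (auto intro!: mult_nonneg_nonneg fmaj_nonneg)
  also have "\<dots> = wnorm x n V * wnorm x n W"
    unfolding wnorm_def sum_product sum.cartesian_product ..
  finally show ?thesis .
qed

lemma wnorm_power:
  assumes "fmaj V V" "0 \<le> x"
  shows "wnorm x n (V ^ p) \<le> wnorm x n V ^ p"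
proof (induction p)
  case 0
  have "wnorm x n 1 = (\<Sum>i\<in>{0}. fps_nth 1 i * x ^ i)"
    unfolding wnorm_def by (rule sum.mono_neutral_right) auto
  then show ?case by simp
next
  case (Suc p)
  have "wnorm x n (V ^ Suc p) \<le> wnorm x n V * wnorm x n (V ^ p)"
    using wnorm_mult[OF assms(1) fmaj_power[OF assms(1)] assms(2)] by simp
  also have "\<dots> \<le> wnorm x n V * wnorm x n V ^ p"
    by (intro mult_left_mono Suc.IH wnorm_nonneg assms)
  finally show ?case by simp
qed

lemma nth_le_wnorm: "fmaj V V \<Longrightarrow> 0 \<le> x \<Longrightarrow> i \<le> n \<Longrightarrow> fps_nth V i * x ^ i \<le> wnorm x n V"
  unfolding wnorm_def by (rule member_le_sum) (auto intro!: mult_nonneg_nonneg fmaj_nonneg)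

section \<open>Fields given by entire power series\<close>

text \<open>The type-class norm of a matrix is the Frobenius norm; Cauchy-Schwarz is applied row by
  row.\<close>

lemma norm_matrix_vector_mult_le: "norm (A *v x) \<le> norm A * norm (x :: real^'n)"
  for A :: "real^'n^'m"
proof -
  have "norm (A *v x) = L2_set (\<lambda>i. norm ((A *v x) $ i)) UNIV" by (simp add: norm_vec_def)
  also have "\<dots> \<le> L2_set (\<lambda>i. norm (A $ i) * norm x) UNIV"
    by (rule L2_set_mono) (auto simp: matrix_vector_mul_component Cauchy_Schwarz_ineq2)
  also have "\<dots> = norm A * norm x" by (simp add: norm_vec_def L2_set_left_distrib)
  finally show ?thesis .
qed

lemma bounded_bilinear_matrix_vector_mult:
  "bounded_bilinear (\<lambda>(A :: real^'n^'m) (x :: real^'n). A *v x)"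
proof
  fix A A' :: "real^'n^'m" and x x' :: "real^'n" and r :: real
  show "(A + A') *v x = A *v x + A' *v x" by (rule matrix_vector_mult_add_rdistrib)
  show "A *v (x + x') = A *v x + A *v x'" by (rule matrix_vector_right_distrib)
  show "(r *\<^sub>R A) *v x = r *\<^sub>R (A *v x)" by (rule scaleR_matrix_vector_assoc[symmetric])
  show "A *v (r *\<^sub>R x) = r *\<^sub>R (A *v x)" by (rule matrix_vector_mult_scaleR)
  show "\<exists>K. \<forall>(A :: real^'n^'m) (x :: real^'n). norm (A *v x) \<le> norm A * norm x * K"
    using norm_matrix_vector_mult_le by (metis mult.right_neutral)
qed

interpretation mv: bounded_bilinear "\<lambda>(A :: real^'n^'m) (x :: real^'n). A *v x"
  by (rule bounded_bilinear_matrix_vector_mult)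

text \<open>The theorem bounds the coefficients in the operator norm, the estimates use the
  Frobenius norm. Bounding each of the m^2 entries by the operator norm is good enough, since the
  factor is absorbed into \<open>B\<close>.\<close>

lemma norm_le_matnorm: "norm A \<le> real CARD('m) ^ 2 * matnorm (A :: real^'m^'m)"
proof -
  have "norm A \<le> (\<Sum>i\<in>UNIV. norm (A $ i))"
    unfolding norm_vec_def by (rule L2_set_le_sum) auto
  also have "\<dots> \<le> (\<Sum>i\<in>(UNIV::'m set). \<Sum>j\<in>(UNIV::'m set). \<bar>A $ i $ j\<bar>)"
    by (intro sum_mono norm_le_l1_cart)
  also have "\<dots> \<le> (\<Sum>i\<in>(UNIV::'m set). \<Sum>j\<in>(UNIV::'m set). matnorm A)"
    unfolding matnorm_def by (intro sum_mono matrix_component_le_onorm)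
  finally show ?thesis by (simp add: power2_eq_square)
qed

text \<open>The partial sums of row \<open>p\<close> are dominated by \<open>H p\<close> uniformly
  in their length, so the sum over \<open>p\<close> converges uniformly in that length and the two
  limits may be exchanged.\<close>

lemma double_series:
  fixes g :: "nat \<Rightarrow> nat \<Rightarrow> 'a::banach"
  assumes h: "\<And>p. g p sums h p" and c: "\<And>n. (\<lambda>p. g p n) sums c n"
    and bd: "\<And>p m. norm (\<Sum>n<m. g p n) \<le> H p" and H: "summable H" and s: "h sums s"
  shows "c sums s"
proof -
  have ul: "uniform_limit UNIV (\<lambda>k m. \<Sum>p<k. \<Sum>n<m. g p n) (\<lambda>m. \<Sum>p. \<Sum>n<m. g p n) sequentially"
    by (rule Weierstrass_m_test[OF bd H])
  have "(\<lambda>p. \<Sum>n<m. g p n) sums (\<Sum>n<m. c n)" for m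
    by (rule sums_sum[OF c])
  then have e: "(\<lambda>m. \<Sum>p. \<Sum>n<m. g p n) = (\<lambda>m. \<Sum>n<m. c n)"
    by (simp add: sums_iff fun_eq_iff)
  have "((\<lambda>m. \<Sum>n<m. c n) \<longlongrightarrow> s) sequentially"
  proof (rule swap_uniform_limit'[OF _ _ ul[unfolded e]])
    show "\<forall>\<^sub>F k in sequentially. (\<lambda>m. \<Sum>p<k. \<Sum>n<m. g p n) \<longlonglongrightarrow> (\<Sum>p<k. h p)"
      using h unfolding sums_def by (intro always_eventually allI tendsto_sum) auto
    show "(\<lambda>k. \<Sum>p<k. h p) \<longlonglongrightarrow> s" using s unfolding sums_def .
  qed auto
  then show ?thesis by (simp add: sums_def)
qed

text \<open>Scalar termwise differentiation is applied to each coordinate. The derivative is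
  returned together with its series so that the step can be iterated.\<close>

lemma has_vector_derivative_power_series:
  fixes c :: "nat \<Rightarrow> 'a::euclidean_space"
  assumes f: "\<And>x::real. (\<lambda>n. x ^ n *\<^sub>R c n) sums f x"
  shows "\<exists>f'. \<forall>x. (f has_vector_derivative f' x) (at x) \<and>
    (\<lambda>n. x ^ n *\<^sub>R (real (Suc n) *\<^sub>R c (Suc n))) sums f' x"
proof (intro exI allI conjI)
  define d where "d n = real (Suc n) *\<^sub>R c (Suc n)" for n
  define f' where "f' x = (\<Sum>n. x ^ n *\<^sub>R d n)" for x :: real
  have s: "(\<lambda>n. (c n \<bullet> b) * x ^ n) sums (f x \<bullet> b)" for b x
    using bounded_linear.sums[OF bounded_linear_inner_left f[of x], of b] by (simp add: mult.commute)
  have di: "diffs (\<lambda>n. c n \<bullet> b) n = d n \<bullet> b" for b n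
    by (simp add: diffs_def d_def)
  have sd: "summable (\<lambda>n. (d n \<bullet> b) * x ^ n)" for b x
    unfolding di[symmetric] by (rule termdiff_converges_all) (use s sums_summable in blast)
  have "summable (\<lambda>n. x ^ n *\<^sub>R d n)" for x
  proof -
    have "summable (\<lambda>n. \<Sum>b\<in>Basis. ((d n \<bullet> b) * x ^ n) *\<^sub>R b)"
      by (intro summable_sum summable_scaleR_left sd)
    moreover have "(\<Sum>b\<in>Basis. ((d n \<bullet> b) * x ^ n) *\<^sub>R b) = x ^ n *\<^sub>R d n" for n
      using euclidean_representation[of "x ^ n *\<^sub>R d n"] by (simp add: mult.commute)
    ultimately show ?thesis by simp
  qed
  then have f': "(\<lambda>n. x ^ n *\<^sub>R d n) sums f' x" for x
    unfolding f'_def by (rule summable_sums)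
  then show "(\<lambda>n. x ^ n *\<^sub>R (real (Suc n) *\<^sub>R c (Suc n))) sums f' x" for x
    unfolding d_def .
  show "(f has_vector_derivative f' x) (at x)" for x
    unfolding has_vector_derivative_def
  proof (subst has_derivative_componentwise_within, intro ballI)
    fix b :: 'a assume "b \<in> Basis"
    have "((\<lambda>x. \<Sum>n. (c n \<bullet> b) * x ^ n) has_field_derivative (\<Sum>n. diffs (\<lambda>n. c n \<bullet> b) n * x ^ n)) (at x)"
      by (rule termdiffs_strong_converges_everywhere) (use s sums_summable in blast)
    moreover have "(\<lambda>x. \<Sum>n. (c n \<bullet> b) * x ^ n) = (\<lambda>x. f x \<bullet> b)"
      using s by (simp add: sums_iff fun_eq_iff)
    moreover have "(\<Sum>n. diffs (\<lambda>n. c n \<bullet> b) n * x ^ n) = f' x \<bullet> b"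
      using bounded_linear.sums[OF bounded_linear_inner_left f'[of x], of b]
      by (simp add: di mult.commute sums_iff)
    ultimately have "((\<lambda>x. f x \<bullet> b) has_field_derivative (f' x \<bullet> b)) (at x)" by simp
    then show "((\<lambda>x. f x \<bullet> b) has_derivative (\<lambda>y. (y *\<^sub>R f' x) \<bullet> b)) (at x)"
      by (simp add: has_field_derivative_def mult_commute_abs)
  qed
qed

lemma vderiv_n_power_series:
  fixes c :: "nat \<Rightarrow> 'a::euclidean_space"
  assumes f: "\<And>x::real. (\<lambda>n. x ^ n *\<^sub>R c n) sums f x"
  shows "vderiv_n k f 0 = fact k *\<^sub>R c k"
proof -
  have "(\<lambda>n. x ^ n *\<^sub>R ((fact (n + k) / fact n) *\<^sub>R c (n + k))) sums vderiv_n k f x" for x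
  proof (induction k arbitrary: x)
    case 0 then show ?case using f by simp
  next
    case (Suc k)
    obtain f' where f': "\<And>x. (vderiv_n k f has_vector_derivative f' x) (at x)"
      "\<And>x. (\<lambda>n. x ^ n *\<^sub>R (real (Suc n) *\<^sub>R ((fact (Suc n + k) / fact (Suc n)) *\<^sub>R c (Suc n + k)))) sums f' x"
      using has_vector_derivative_power_series[OF Suc.IH] by blast
    have e: "real (Suc n) *\<^sub>R ((fact (Suc n + k) / fact (Suc n)) *\<^sub>R c (Suc n + k))
        = (fact (n + Suc k) / fact n) *\<^sub>R c (n + Suc k)" for n
      by (simp add: field_simps del: of_nat_Suc)
    have "vderiv_n (Suc k) f x = f' x"
      using vector_derivative_at[OF f'(1)] by simp
    then show ?case using f'(2)[of x] unfolding e by simp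
  qed
  from sums_unique[OF this[of 0]]
  have "vderiv_n k f 0 = (\<Sum>n. 0 ^ n *\<^sub>R ((fact (n + k) / fact n) *\<^sub>R c (n + k)))" by simp
  also have "\<dots> = (\<Sum>n\<in>{0}. 0 ^ n *\<^sub>R ((fact (n + k) / fact n) *\<^sub>R c (n + k)))"
    by (rule suminf_finite) auto
  finally show ?thesis by simp
qed

section \<open>Taylor coefficients of the field along a path\<close>

definition comps :: "(nat \<Rightarrow> real^'m) \<Rightarrow> 'm \<Rightarrow> real fps" where
  "comps v k = Abs_fps (\<lambda>i. v i $ k)"

definition vmaj :: "(nat \<Rightarrow> 'a::real_normed_vector) \<Rightarrow> real fps \<Rightarrow> bool" where
  "vmaj v V \<longleftrightarrow> (\<forall>i. norm (v i) \<le> fps_nth V i)"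

lemma vmaj_fmaj: "vmaj v V \<Longrightarrow> fmaj V V"
  unfolding vmaj_def fmaj_def by (metis abs_of_nonneg norm_ge_zero order_refl order_trans)

lemma comps_fmaj: "vmaj v V \<Longrightarrow> fmaj (comps v k) V"
  unfolding vmaj_def fmaj_def comps_def by (auto intro: component_le_norm_cart[THEN order_trans])

lemma comps_diff_fmaj: "vmaj (\<lambda>i. v i - w i) D \<Longrightarrow> fmaj (comps v k - comps w k) D"
  using comps_fmaj[of "\<lambda>i. v i - w i" D k] by (simp add: comps_def fmaj_def)

locale entire_field =
  fixes N :: "real \<Rightarrow> real^'m \<Rightarrow> real^'m^'m"
    and Nc :: "('m \<Rightarrow> nat) \<Rightarrow> real \<Rightarrow> real^'m^'m"
    and B :: "nat \<Rightarrow> real" and t0 :: real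
  assumes N_sums: "t0 \<le> t \<Longrightarrow>
      (\<lambda>p. \<Sum>a\<in>{a. sum a UNIV = p}. mpow (\<lambda>k. u $ k) a *\<^sub>R Nc a t) sums N t u"
    and Nc_cont: "continuous_on {t0..} (Nc a)"
    and B_nonneg: "0 \<le> B p"
    and Nc_le: "t0 \<le> t \<Longrightarrow> (\<Sum>a\<in>{a. sum a UNIV = p}. norm (Nc a t)) \<le> B p"
    and B_conv: "summable (\<lambda>p. B p * x ^ p)"
begin

text \<open>\<open>cf t v n\<close> is the \<open>n\<close>-th Taylor coefficient at \<open>\<tau> = 0\<close> of \<open>\<tau> \<mapsto> N t (\<Sum>i. \<tau> ^ i *\<^sub>R v i)\<close>,
  that is, the Adomian polynomial; \<open>cterm\<close> collects the contribution of the monomials of degree \<open>p\<close>.\<close>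

definition cterm :: "real \<Rightarrow> (nat \<Rightarrow> real^'m) \<Rightarrow> nat \<Rightarrow> nat \<Rightarrow> real^'m^'m" where
  "cterm t v n p = (\<Sum>a\<in>{a. sum a UNIV = p}. fps_nth (mpow (comps v) a) n *\<^sub>R Nc a t)"

definition cf :: "real \<Rightarrow> (nat \<Rightarrow> real^'m) \<Rightarrow> nat \<Rightarrow> real^'m^'m" where
  "cf t v n = (\<Sum>p. cterm t v n p)"

lemma norm_weighted_le:
  assumes "t0 \<le> t" "\<And>a. sum a UNIV = p \<Longrightarrow> \<bar>w a\<bar> \<le> b" "0 \<le> b"
  shows "norm (\<Sum>a\<in>{a. sum a UNIV = p}. w a *\<^sub>R Nc a t) \<le> B p * b"
proof -
  have "norm (\<Sum>a\<in>{a. sum a UNIV = p}. w a *\<^sub>R Nc a t) \<le> (\<Sum>a\<in>{a. sum a UNIV = p}. b * norm (Nc a t))"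
    by (rule sum_norm_le) (use assms in \<open>auto intro!: mult_right_mono\<close>)
  also have "\<dots> \<le> b * B p"
    unfolding sum_distrib_left[symmetric] using assms Nc_le by (intro mult_left_mono) auto
  finally show ?thesis by (simp add: mult.commute)
qed

lemma norm_cterm_le:
  assumes "t0 \<le> t" "vmaj v V"
  shows "norm (cterm t v n p) \<le> B p * fps_nth (V ^ p) n"
  unfolding cterm_def
proof (rule norm_weighted_le)
  note fm = mpow_fmaj[of "comps v" V, OF comps_fmaj[OF assms(2)]]
  show "\<bar>fps_nth (mpow (comps v) a) n\<bar> \<le> fps_nth (V ^ p) n" if "sum a UNIV = p" for a
    using fmajD[OF fm[of a], of n] that by simp
  show "0 \<le> fps_nth (V ^ p) n"
    by (rule fmaj_nonneg[OF fmaj_power[OF vmaj_fmaj[OF assms(2)]]])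
qed fact

lemma norm_cterm_diff_le:
  assumes "t0 \<le> t" "vmaj v V" "vmaj w V" "vmaj (\<lambda>i. v i - w i) D" "1 \<le> fps_nth V 0"
  shows "norm (cterm t v n p - cterm t w n p) \<le> B p * (2 ^ p * fps_nth (D * V ^ p) n)"
proof -
  note fm = mpow_diff_fmaj[of "comps v" V "comps w" D, OF comps_fmaj[OF assms(2)] comps_fmaj[OF assms(3)]
    comps_diff_fmaj[OF assms(4)] assms(5)]
  have e: "fps_nth (2 ^ p * F) n = 2 ^ p * fps_nth F n" for F :: "real fps"
  proof -
    have e2: "(2::real fps) ^ p = fps_const (2 ^ p)" unfolding numeral_fps_const fps_const_power ..
    show ?thesis unfolding e2 by simp
  qed
  have "norm (\<Sum>a\<in>{a. sum a UNIV = p}. fps_nth (mpow (comps v) a - mpow (comps w) a) n *\<^sub>R Nc a t)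
    \<le> B p * (2 ^ p * fps_nth (D * V ^ p) n)"
  proof (rule norm_weighted_le)
    show "\<bar>fps_nth (mpow (comps v) a - mpow (comps w) a) n\<bar> \<le> 2 ^ p * fps_nth (D * V ^ p) n"
      if "sum a UNIV = p" for a
      using fmajD[OF fm[of a], of n] that by (simp add: e)
    show "0 \<le> 2 ^ p * fps_nth (D * V ^ p) n"
      by (intro mult_nonneg_nonneg fmaj_nonneg[OF fmaj_mult[OF vmaj_fmaj[OF assms(4)] fmaj_power[OF vmaj_fmaj[OF assms(2)]]]]) auto
  qed fact
  then show ?thesis
    by (simp add: cterm_def scaleR_left_diff_distrib sum_subtractf)
qed

text \<open>The \<open>n\<close>-th coefficient is at most \<open>wnorm 1 n\<close>, which is
  submultiplicative. For fixed \<open>n\<close> the coefficients of \<open>V ^ p\<close> therefore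
  grow at most geometrically in \<open>p\<close>, and \<open>B\<close> beats every geometric
  sequence.\<close>

lemma summable_B_nth:
  assumes "fmaj V V" "fmaj W W" "0 \<le> c"
  shows "summable (\<lambda>p. B p * (c ^ p * fps_nth (W * V ^ p) n))"
proof (rule summable_comparison_test')
  show "summable (\<lambda>p. wnorm 1 n W * (B p * (c * wnorm 1 n V) ^ p))"
    by (intro summable_mult B_conv)
  fix p :: nat
  have nn: "0 \<le> fps_nth (W * V ^ p) n"
    using fmaj_nonneg[OF fmaj_mult[OF assms(2) fmaj_power[OF assms(1)]]] .
  have "fps_nth (W * V ^ p) n \<le> wnorm 1 n (W * V ^ p)"
    using nth_le_wnorm[OF fmaj_mult[OF assms(2) fmaj_power[OF assms(1)]], of 1 n n] by simp
  also have "\<dots> \<le> wnorm 1 n W * wnorm 1 n (V ^ p)"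
    by (intro wnorm_mult assms fmaj_power) auto
  also have "\<dots> \<le> wnorm 1 n W * wnorm 1 n V ^ p"
    by (intro mult_left_mono wnorm_power wnorm_nonneg assms) auto
  finally have "B p * (c ^ p * fps_nth (W * V ^ p) n) \<le> B p * (c ^ p * (wnorm 1 n W * wnorm 1 n V ^ p))"
    by (intro mult_left_mono) (use B_nonneg assms in auto)
  then show "norm (B p * (c ^ p * fps_nth (W * V ^ p) n)) \<le> wnorm 1 n W * (B p * (c * wnorm 1 n V) ^ p)"
    using nn B_nonneg[of p] assms(3) by (simp add: power_mult_distrib mult_ac)
qed

lemma summable_B_power: "fmaj V V \<Longrightarrow> summable (\<lambda>p. B p * fps_nth (V ^ p) n)"
  using summable_B_nth[of V 1 1 n] fmaj_one by simp

lemma cterm_summable: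
  assumes "t0 \<le> t" shows "summable (\<lambda>p. cterm t v n p)"
proof (rule summable_comparison_test')
  let ?V = "Abs_fps (\<lambda>i. norm (v i))"
  have V: "vmaj v ?V" by (simp add: vmaj_def)
  show "summable (\<lambda>p. B p * fps_nth (?V ^ p) n)"
    by (rule summable_B_power[OF vmaj_fmaj[OF V]])
  show "norm (cterm t v n p) \<le> B p * fps_nth (?V ^ p) n" for p
    by (rule norm_cterm_le[OF assms V])
qed

lemma cterm_sums: "t0 \<le> t \<Longrightarrow> (\<lambda>p. cterm t v n p) sums cf t v n"
  unfolding cf_def by (rule summable_sums[OF cterm_summable])

lemma norm_cf_le:
  assumes "t0 \<le> t" "vmaj v V"
  shows "norm (cf t v n) \<le> (\<Sum>p. B p * fps_nth (V ^ p) n)"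
  unfolding cf_def using assms
  by (intro norm_suminf_le norm_cterm_le summable_B_power vmaj_fmaj)

lemma norm_cf_diff_le:
  assumes "t0 \<le> t" "vmaj v V" "vmaj w V" "vmaj (\<lambda>i. v i - w i) D" "1 \<le> fps_nth V 0"
  shows "norm (cf t v n - cf t w n) \<le> (\<Sum>p. B p * (2 ^ p * fps_nth (D * V ^ p) n))"
  unfolding cf_def suminf_diff[OF cterm_summable[OF assms(1)] cterm_summable[OF assms(1)]]
  by (intro norm_suminf_le norm_cterm_diff_le summable_B_nth vmaj_fmaj[OF assms(2)] vmaj_fmaj[OF assms(4)] assms) auto

lemma cf_0: "t0 \<le> t \<Longrightarrow> cf t v 0 = N t (v 0)"
  using N_sums[of t "v 0"] unfolding cf_def cterm_def mpow_nth_0 comps_def by (simp add: sums_iff)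

lemma cf_scale: "t0 \<le> t \<Longrightarrow> cf t (\<lambda>i. c ^ i *\<^sub>R v i) n = c ^ n *\<^sub>R cf t v n"
proof -
  assume t: "t0 \<le> t"
  have m: "fps_nth (mpow (comps (\<lambda>i. c ^ i *\<^sub>R v i)) a) n = c ^ n * fps_nth (mpow (comps v) a) n" for a
    by (rule mpow_nth_scale) (simp add: comps_def)
  have "cterm t (\<lambda>i. c ^ i *\<^sub>R v i) n p = c ^ n *\<^sub>R cterm t v n p" for p
    by (simp add: cterm_def m scaleR_sum_right)
  then have "cterm t (\<lambda>i. c ^ i *\<^sub>R v i) n = (\<lambda>p. c ^ n *\<^sub>R cterm t v n p)" by (rule ext)
  then show ?thesis unfolding cf_def using suminf_scaleR_right[OF cterm_summable[OF t]] by simp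
qed

lemma cf_cong: "(\<And>i. i \<le> n \<Longrightarrow> v i = w i) \<Longrightarrow> cf t v n = cf t w n"
proof -
  assume vw: "\<And>i. i \<le> n \<Longrightarrow> v i = w i"
  have "fps_nth (mpow (comps v) a) n = fps_nth (mpow (comps w) a) n" for a
    by (rule mpow_nth_cong) (simp add: comps_def vw)
  then show ?thesis unfolding cf_def cterm_def by simp
qed

text \<open>The coefficient sequence of the line \<open>u + \<tau> w\<close>.\<close>

definition pt :: "real^'m \<Rightarrow> real^'m \<Rightarrow> nat \<Rightarrow> real^'m" where
  "pt u w i = (if i = 0 then u else if i = 1 then w else 0)"

text \<open>The derivative of \<open>N t\<close> at \<open>u\<close> in direction \<open>w\<close>,
  introduced as a Taylor coefficient so that the majorant bounds apply to it;
  \<open>has_vector_derivative_line\<close> justifies this reading.\<close>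

definition DN :: "real \<Rightarrow> real^'m \<Rightarrow> real^'m \<Rightarrow> real^'m^'m" where
  "DN t u w = cf t (pt u w) 1"

text \<open>The newest coefficient enters the Adomian polynomial of its own order only through the
  derivative at the constant term. This is the split built into the FD-method: the derivative term
  stands in the linear part, the polynomial with last argument 0 goes into
  \<open>FD_F\<close>.\<close>

lemma cf_last:
  assumes t: "t0 \<le> t" and n: "0 < n"
  shows "cf t v n = cf t (\<lambda>i. if i < n then v i else 0) n + DN t (v 0) (v n)"
proof -
  have "fps_nth (mpow (comps v) a) n = fps_nth (mpow (comps (\<lambda>i. if i < n then v i else 0)) a) n
      + fps_nth (mpow (comps (pt (v 0) (v n))) a) 1" for a
    by (rule mpow_nth_last[OF n]) (use n in \<open>auto simp: comps_def pt_def\<close>)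
  then have "cterm t v n = (\<lambda>p. cterm t (\<lambda>i. if i < n then v i else 0) n p + cterm t (pt (v 0) (v n)) 1 p)"
    by (simp add: cterm_def scaleR_add_left sum.distrib fun_eq_iff)
  then show ?thesis
    unfolding DN_def cf_def using suminf_add[OF cterm_summable[OF t] cterm_summable[OF t]] by simp
qed

lemma DN_linear: "t0 \<le> t \<Longrightarrow> DN t u (c *\<^sub>R x + y) = c *\<^sub>R DN t u x + DN t u y"
proof -
  assume t: "t0 \<le> t"
  have "fps_nth (mpow (comps (pt u (c *\<^sub>R x + y))) a) 1 = c * fps_nth (mpow (comps (pt u x)) a) 1
      + fps_nth (mpow (comps (pt u y)) a) 1" for a
    by (rule mpow_nth_1_linear) (auto simp: comps_def pt_def)
  then have "cterm t (pt u (c *\<^sub>R x + y)) 1 = (\<lambda>p. c *\<^sub>R cterm t (pt u x) 1 p + cterm t (pt u y) 1 p)"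
    by (simp add: cterm_def scaleR_add_left sum.distrib scaleR_sum_right fun_eq_iff)
  then show ?thesis
    unfolding DN_def cf_def
    using suminf_add[OF summable_scaleR_right[OF cterm_summable[OF t]] cterm_summable[OF t]]
      suminf_scaleR_right[OF cterm_summable[OF t]] by simp
qed

lemma linear_DN: "t0 \<le> t \<Longrightarrow> linear (DN t u)"
proof (rule linearI)
  assume t: "t0 \<le> t"
  show a: "DN t u (x + y) = DN t u x + DN t u y" for x y using DN_linear[OF t, of u 1 x y] by simp
  from a[of 0 0] have "DN t u 0 = 0" by simp
  then show "DN t u (c *\<^sub>R x) = c *\<^sub>R DN t u x" for c x using DN_linear[OF t, of u c x 0] by simp
qed

text \<open>The sum over the degree \<open>p\<close> of the monomials is exchanged with the sum over
  powers of \<tau>. Row \<open>p\<close> is dominated by \<open>B p * S ^ p\<close>, where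
  \<open>S\<close> is the sum of the norms of \<open>v\<close>.\<close>

lemma cf_sums:
  assumes t: "t0 \<le> t" and v: "summable (\<lambda>i. norm (v i))"
  shows "cf t v sums N t (\<Sum>i. v i)"
proof (rule double_series[where g="\<lambda>p n. cterm t v n p"])
  let ?V = "Abs_fps (\<lambda>i. norm (v i))" and ?S = "\<Sum>i. norm (v i)"
  have V: "vmaj v ?V" by (simp add: vmaj_def)
  have VV: "fmaj ?V ?V" by (rule vmaj_fmaj[OF V])
  have sk: "fps_nth (comps v k) sums ((\<Sum>i. v i) $ k)" for k
    using bounded_linear.sums[OF bounded_linear_vec_nth summable_sums[OF summable_norm_cancel[OF v]], of k]
    by (simp add: comps_def Abs_fps_inverse)
  have ak: "summable (\<lambda>n. \<bar>fps_nth (comps v k) n\<bar>)" for k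
    by (rule summable_comparison_test'[OF v, of 0]) (simp add: comps_def component_le_norm_cart)
  show "(\<lambda>n. cterm t v n p) sums (\<Sum>a\<in>{a. sum a UNIV = p}. mpow (\<lambda>k. (\<Sum>i. v i) $ k) a *\<^sub>R Nc a t)" for p
    unfolding cterm_def by (intro sums_sum sums_scaleR_left mpow_sums ak sk)
  show "(\<lambda>p. cterm t v n p) sums cf t v n" for n by (rule cterm_sums[OF t])
  show "(\<lambda>p. \<Sum>a\<in>{a. sum a UNIV = p}. mpow (\<lambda>k. (\<Sum>i. v i) $ k) a *\<^sub>R Nc a t) sums N t (\<Sum>i. v i)"
    by (rule N_sums[OF t])
  show "summable (\<lambda>p. B p * ?S ^ p)" by (rule B_conv)
  show "norm (\<Sum>n<m. cterm t v n p) \<le> B p * ?S ^ p" for p m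
  proof -
    have "norm (\<Sum>n<m. cterm t v n p) \<le> (\<Sum>n<m. B p * fps_nth (?V ^ p) n)"
      by (rule sum_norm_le) (rule norm_cterm_le[OF t V])
    also have "\<dots> \<le> B p * wnorm 1 m (?V ^ p)"
    proof -
      have "(\<Sum>n<m. fps_nth (?V ^ p) n) \<le> (\<Sum>n\<le>m. fps_nth (?V ^ p) n)"
        using fmaj_nonneg[OF fmaj_power[OF VV]] by (intro sum_mono2) auto
      then show ?thesis
        unfolding wnorm_def sum_distrib_left[symmetric] by (simp add: mult_left_mono B_nonneg)
    qed
    also have "\<dots> \<le> B p * wnorm 1 m ?V ^ p"
      by (intro mult_left_mono wnorm_power B_nonneg VV) auto
    also have "\<dots> \<le> B p * ?S ^ p"
    proof (intro mult_left_mono power_mono B_nonneg)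
      show "wnorm 1 m ?V \<le> ?S" unfolding wnorm_def using v by (auto intro!: sum_le_suminf)
      show "0 \<le> wnorm 1 m ?V" by (rule wnorm_nonneg[OF VV]) simp
    qed
    finally show ?thesis .
  qed
qed

text \<open>A finite path is summable at every parameter value, so \<open>cf_sums\<close> for the
  scaled sequence, together with \<open>cf_scale\<close>, gives an expansion valid for all real
  \<open>x\<close>, the form in which power series are differentiated above.\<close>

lemma polynomial_path_sums:
  assumes t: "t0 \<le> t"
  shows "(\<lambda>n. x ^ n *\<^sub>R cf t (\<lambda>i. if i \<le> k then v i else 0) n) sums N t (\<Sum>i\<le>k. x ^ i *\<^sub>R v i)"
proof -
  let ?v = "\<lambda>i. if i \<le> k then v i else 0"
  have s: "(\<lambda>i. x ^ i *\<^sub>R ?v i) sums (\<Sum>i\<le>k. x ^ i *\<^sub>R ?v i)"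
    by (rule sums_finite) auto
  have "summable (\<lambda>i. norm (x ^ i *\<^sub>R ?v i))"
    by (rule summable_finite[of "{..k}"]) auto
  note c = cf_sums[OF t this]
  have "cf t (\<lambda>i. x ^ i *\<^sub>R ?v i) = (\<lambda>n. x ^ n *\<^sub>R cf t ?v n)"
    using cf_scale[OF t] by (rule ext)
  then show ?thesis using c sums_unique[OF s] by simp
qed

lemma adomian_eq_cf:
  assumes t: "t0 \<le> t"
  shows "adomian (N t) n v = cf t v n"
proof -
  have "vderiv_n n (\<lambda>x. N t (\<Sum>i\<le>n. x ^ i *\<^sub>R v i)) 0 = fact n *\<^sub>R cf t (\<lambda>i. if i \<le> n then v i else 0) n"
    by (rule vderiv_n_power_series[OF polynomial_path_sums[OF t]])
  moreover have "cf t (\<lambda>i. if i \<le> n then v i else 0) n = cf t v n"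
    by (rule cf_cong) simp
  ultimately show ?thesis by (simp add: adomian_def)
qed

lemma has_vector_derivative_line:
  assumes t: "t0 \<le> t"
  shows "((\<lambda>s. N t (u + s *\<^sub>R w)) has_vector_derivative DN t (u + s *\<^sub>R w) w) (at s)"
proof -
  have z: "((\<lambda>s. N t (u + s *\<^sub>R w)) has_vector_derivative DN t u w) (at 0)" for u
  proof -
    have p: "(\<lambda>n. x ^ n *\<^sub>R cf t (pt u w) n) sums N t (u + x *\<^sub>R w)" for x
    proof -
      have e: "(\<lambda>i. if i \<le> 1 then pt u w i else 0) = pt u w"
        by (auto simp: pt_def fun_eq_iff)
      have "(\<Sum>i\<le>1. x ^ i *\<^sub>R pt u w i) = u + x *\<^sub>R w"
        by (simp add: pt_def)
      then show ?thesis using polynomial_path_sums[OF t, of x 1 "pt u w"] unfolding e by simp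
    qed
    obtain f' where f': "\<And>x. ((\<lambda>x. N t (u + x *\<^sub>R w)) has_vector_derivative f' x) (at x)"
      "\<And>x. (\<lambda>n. x ^ n *\<^sub>R (real (Suc n) *\<^sub>R cf t (pt u w) (Suc n))) sums f' x"
      using has_vector_derivative_power_series[OF p] by blast
    have "(\<lambda>n. 0 ^ n *\<^sub>R (real (Suc n) *\<^sub>R cf t (pt u w) (Suc n))) sums
       (\<Sum>n\<in>{0}. 0 ^ n *\<^sub>R (real (Suc n) *\<^sub>R cf t (pt u w) (Suc n)))"
      by (rule sums_finite) auto
    then have "f' 0 = DN t u w" using sums_unique2[OF f'(2)[of 0]] by (simp add: DN_def)
    then show ?thesis using f'(1)[of 0] by simp
  qed
  \<comment> \<open>Moving the parameter by \<open>s\<close> turns the derivative at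
    \<open>s\<close> into one at 0 with base point \<open>u + s *\<^sub>R w\<close>.\<close>
  have "((\<lambda>r. N t (u + s *\<^sub>R w + r *\<^sub>R w)) \<circ> (\<lambda>r. r - s) has_vector_derivative
      1 *\<^sub>R DN t (u + s *\<^sub>R w) w) (at s)"
    by (rule vector_diff_chain_at) (auto intro!: derivative_eq_intros z)
  moreover have "(\<lambda>r. N t (u + s *\<^sub>R w + r *\<^sub>R w)) \<circ> (\<lambda>r. r - s) = (\<lambda>s. N t (u + s *\<^sub>R w))"
    by (auto simp: fun_eq_iff algebra_simps)
  ultimately show ?thesis by simp
qed

lemma pderiv_mat_eq: "t0 \<le> t \<Longrightarrow> pderiv_mat (N t) u q = DN t u (axis q 1)"
  unfolding pderiv_mat_def
  using has_vector_derivative_line[of t u "axis q 1" 0] by (simp add: vector_derivative_at)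

lemma sum_pderiv_mat:
  assumes t: "t0 \<le> t"
  shows "(\<Sum>q\<in>UNIV. (w $ q) *\<^sub>R pderiv_mat (N t) u q) = DN t u w"
proof -
  have "DN t u w = DN t u (\<Sum>q\<in>UNIV. (w $ q) *\<^sub>R axis q 1)"
    using basis_expansion[of w] by (simp add: scalar_mult_eq_scaleR)
  also have "\<dots> = (\<Sum>q\<in>UNIV. (w $ q) *\<^sub>R DN t u (axis q 1))"
    using linear_DN[OF t, of u] by (simp add: linear_sum linear_cmul)
  finally show ?thesis using t by (simp add: pderiv_mat_eq)
qed

text \<open>Column \<open>q\<close> of the second part of \<open>jac\<close> is the derivative in
  direction \<open>q\<close> applied to \<open>u\<close>; combining the columns with weights
  \<open>v\<close> gives the derivative in direction \<open>v\<close>. In this form the Jacobian can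
  be recognised in the equations for the corrections.\<close>

lemma jac_mult:
  assumes t: "t0 \<le> t"
  shows "jac N t u *v v = N t u *v v + DN t u v *v u"
proof -
  have "(\<chi> i q. (pderiv_mat (N t) u q *v u) $ i) *v v = (\<Sum>q\<in>UNIV. (v $ q) *\<^sub>R (pderiv_mat (N t) u q *v u))"
    by (simp add: vec_eq_iff matrix_vector_mult_def mult.commute)
  also have "\<dots> = DN t u v *v u"
    by (simp add: sum_pderiv_mat[OF t, symmetric] mv.sum_left mv.scaleR_left)
  finally show ?thesis by (simp add: jac_def matrix_vector_mult_add_rdistrib)
qed

section \<open>Bounds, Lipschitz estimates and continuity of the field\<close>

definition NB :: "real \<Rightarrow> real" where "NB r = (\<Sum>p. B p * r ^ p)"

lemma NB_nonneg: "0 \<le> r \<Longrightarrow> 0 \<le> NB r"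
  unfolding NB_def by (intro suminf_nonneg B_conv mult_nonneg_nonneg B_nonneg) auto

lemma norm_N_le: "t0 \<le> t \<Longrightarrow> norm u \<le> r \<Longrightarrow> norm (N t u) \<le> NB r"
proof -
  assume t: "t0 \<le> t" and u: "norm u \<le> r"
  have "vmaj (\<lambda>i. if i = 0 then u else 0) (fps_const r)" using u by (simp add: vmaj_def)
  from norm_cf_le[OF t this, of 0] show ?thesis
    by (simp add: cf_0[OF t] NB_def fps_const_power)
qed

text \<open>The difference bound for constant paths. The argument \<open>2 * r\<close> comes from
  the factor \<open>2 ^ p\<close> in it, and \<open>1 \<le> r\<close> from its condition on the
  constant term.\<close>

lemma norm_N_diff_le:
  assumes t: "t0 \<le> t" and u: "norm u \<le> r" and v: "norm v \<le> r" and r: "1 \<le> r"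
  shows "norm (N t u - N t v) \<le> NB (2 * r) * norm (u - v)"
proof -
  have "vmaj (\<lambda>i. if i = 0 then u else 0) (fps_const r)" "vmaj (\<lambda>i. if i = 0 then v else 0) (fps_const r)"
    "vmaj (\<lambda>i. (if i = 0 then u else 0) - (if i = 0 then v else 0)) (fps_const (norm (u - v)))"
    using u v by (auto simp: vmaj_def)
  from norm_cf_diff_le[OF t this, of 0] r
  have "norm (N t u - N t v) \<le> (\<Sum>p. B p * (2 ^ p * (norm (u - v) * r ^ p)))"
    by (simp add: cf_0[OF t] fps_const_power)
  also have "\<dots> = (\<Sum>p. (B p * (2 * r) ^ p) * norm (u - v))"
    by (simp add: power_mult_distrib mult_ac)
  also have "\<dots> = NB (2 * r) * norm (u - v)"
    unfolding NB_def by (rule suminf_mult2[OF B_conv, symmetric])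
  finally show ?thesis .
qed

text \<open>\<open>pt u w\<close> is compared with the constant path \<open>pt u 0\<close>. Their
  difference starts in degree 1, so in degree 1 it meets only the constant term of
  \<open>V ^ p\<close>, and the bound is linear in \<open>norm w\<close>.\<close>

lemma norm_DN_le:
  assumes t: "t0 \<le> t" and u: "norm u \<le> r" and r: "1 \<le> r"
  shows "norm (DN t u w) \<le> NB (2 * r) * norm w"
proof -
  let ?V = "Abs_fps (\<lambda>i. if i = 0 then r else if i = 1 then norm w else 0)"
  let ?D = "Abs_fps (\<lambda>i. if i = 1 then norm w else 0)"
  have V: "vmaj (pt u w) ?V" "vmaj (pt u 0) ?V" "vmaj (\<lambda>i. pt u w i - pt u 0 i) ?D"
    using u r by (auto simp: vmaj_def pt_def)
  have e: "fps_nth (?D * ?V ^ p) 1 = norm w * r ^ p" for p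
    by (simp add: fps_mult_nth_split[of 1] fps_power_zeroth)
  have z: "DN t u 0 = 0" using linear_DN[OF t] by (simp add: linear_0)
  from norm_cf_diff_le[OF t V, of 1] r
  have "norm (DN t u w - DN t u 0) \<le> (\<Sum>p. B p * (2 ^ p * (norm w * r ^ p)))"
    unfolding e DN_def by simp
  also have "\<dots> = (\<Sum>p. (B p * (2 * r) ^ p) * norm w)"
    by (simp add: power_mult_distrib mult_ac)
  also have "\<dots> = NB (2 * r) * norm w"
    unfolding NB_def by (rule suminf_mult2[OF B_conv, symmetric])
  finally show ?thesis by (simp add: z)
qed

lemma continuous_on_N:
  assumes S: "S \<subseteq> {t0..}" and y: "continuous_on S y" and r: "\<And>s. s \<in> S \<Longrightarrow> norm (y s) \<le> r"
  shows "continuous_on S (\<lambda>s. N s (y s))"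
proof -
  let ?f = "\<lambda>p s. \<Sum>a\<in>{a. sum a UNIV = p}. mpow (\<lambda>k. y s $ k) a *\<^sub>R Nc a s"
  have ul: "uniform_limit S (\<lambda>n s. \<Sum>p<n. ?f p s) (\<lambda>s. \<Sum>p. ?f p s) sequentially"
  proof (rule Weierstrass_m_test)
    fix p s assume s: "s \<in> S"
    then have "0 \<le> r" using r[OF s] norm_ge_zero order_trans by blast
    let ?v = "\<lambda>i::nat. if i = 0 then y s else 0"
    have "vmaj ?v (fps_const r)" using r[OF s] by (simp add: vmaj_def)
    from norm_cterm_le[OF _ this, of s 0 p] s S
    show "norm (?f p s) \<le> B p * r ^ p"
      by (auto simp: cterm_def mpow_nth_0 comps_def fps_const_power)
  qed (rule B_conv)
  have "continuous_on S (\<lambda>s. \<Sum>p<n. ?f p s)" for n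
    unfolding mpow_def
    by (intro continuous_intros y continuous_on_subset[OF Nc_cont S])
  then have "continuous_on S (\<lambda>s. \<Sum>p. ?f p s)"
    by (intro uniform_limit_theorem[OF always_eventually[OF allI] ul]) auto
  moreover have "(\<Sum>p. ?f p s) = N s (y s)" if "s \<in> S" for s
    using N_sums[of s "y s"] S that by (auto simp: sums_iff)
  ultimately show ?thesis by (simp cong: continuous_on_cong)
qed

end

section \<open>Dissipative fields\<close>

text \<open>After the last time \<open>s\<close> in the ball the curve stays outside, where its
  squared norm does not increase. Derivatives enter only in the open interval, so corners at grid
  nodes do no harm; \<open>r = 0\<close> is allowed and gives uniqueness.\<close>

lemma ball_invariant:
  fixes y :: "real \<Rightarrow> 'a::real_inner"
  assumes cont: "continuous_on {a..b} y"
    and der: "\<And>t. a < t \<Longrightarrow> t < b \<Longrightarrow> (y has_vector_derivative y' t) (at t)"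
    and inw: "\<And>t. a < t \<Longrightarrow> t < b \<Longrightarrow> r \<le> norm (y t) \<Longrightarrow> y t \<bullet> y' t \<le> 0"
    and a: "norm (y a) \<le> r" and t: "a \<le> t" "t \<le> b"
  shows "norm (y t) \<le> r"
proof (rule ccontr)
  assume "\<not> norm (y t) \<le> r"
  then have gt: "r < norm (y t)" by simp
  have r0: "0 \<le> r" using a norm_ge_zero order_trans by blast
  define S where "S = {s \<in> {a..t}. norm (y s) \<le> r}"
  have ct: "continuous_on {a..t} (\<lambda>s. norm (y s))"
    by (intro continuous_on_norm continuous_on_subset[OF cont]) (use t in auto)
  have "S = {a..t} \<inter> (\<lambda>s. norm (y s)) -` {..r}" by (auto simp: S_def)
  then have "closed S" using continuous_closed_preimage[OF ct] by simp
  moreover have "bounded S" by (rule bounded_subset[of "{a..t}"]) (auto simp: S_def)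
  ultimately have "compact S" by (simp add: compact_eq_bounded_closed)
  moreover have "S \<noteq> {}" using a t by (auto simp: S_def)
  ultimately obtain s where s: "s \<in> S" "\<And>x. x \<in> S \<Longrightarrow> x \<le> s" using compact_attains_sup by metis
  have sS: "a \<le> s" "s \<le> t" "norm (y s) \<le> r" using s by (auto simp: S_def)
  have out: "r < norm (y x)" if "s < x" "x \<le> t" for x
    using s(2)[of x] that sS by (force simp: S_def)
  have "y t \<bullet> y t \<le> y s \<bullet> y s"
  proof (rule DERIV_nonpos_imp_decreasing_open[where f="\<lambda>x. y x \<bullet> y x"])
    fix x assume x: "s < x" "x < t"
    have "((\<lambda>x. y x \<bullet> y x) has_field_derivative 2 * (y x \<bullet> y' x)) (at x)"
      using der[of x] x sS t unfolding has_vector_derivative_def has_field_derivative_def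
      by (auto intro!: derivative_eq_intros simp: fun_eq_iff inner_commute algebra_simps)
    moreover have "y x \<bullet> y' x \<le> 0" using inw[of x] out[of x] x sS t by auto
    ultimately show "\<exists>d. ((\<lambda>x. y x \<bullet> y x) has_field_derivative d) (at x) \<and> d \<le> 0"
      by (intro exI[of _ "2 * (y x \<bullet> y' x)"]) auto
  next
    show "continuous_on {s..t} (\<lambda>x. y x \<bullet> y x)"
      by (intro continuous_intros continuous_on_subset[OF cont]) (use sS t in auto)
  qed fact
  then have "norm (y t) \<le> norm (y s)" by (simp add: norm_le)
  then show False using gt sS by simp
qed

lemma norm_increment_le:
  fixes y :: "real \<Rightarrow> 'a::real_inner"
  assumes cont: "continuous_on {a..b} y"
    and der: "\<And>t. a < t \<Longrightarrow> t < b \<Longrightarrow> (y has_vector_derivative y' t) (at t)"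
    and bd: "\<And>t. a < t \<Longrightarrow> t < b \<Longrightarrow> norm (y' t) \<le> M"
    and t: "a \<le> t" "t \<le> b"
  shows "norm (y t - y a) \<le> M * (t - a)"
proof (cases "a = t")
  case False
  then have "a < t" using t by simp
  moreover have "continuous_on {a..t} y" by (rule continuous_on_subset[OF cont]) (use t in auto)
  ultimately obtain x where x: "x \<in> {a<..<t}" "norm (y t - y a) \<le> norm ((t - a) *\<^sub>R y' x)"
    using mvt_general[of a t y "\<lambda>x h. h *\<^sub>R y' x"] der t unfolding has_vector_derivative_def by auto
  have "norm ((t - a) *\<^sub>R y' x) \<le> M * (t - a)"
    using bd[of x] x(1) t by (simp add: mult.commute mult_left_mono)
  with x(2) show ?thesis by (rule order_trans)
qed simp

text \<open>A replacement for Gronwall on a short interval: the increment up to the maximum of the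
  norm is at most half that maximum plus the contribution of \<open>C\<close>, and the half is
  absorbed.\<close>

lemma norm_growth_le:
  fixes y :: "real \<Rightarrow> 'a::real_inner"
  assumes cont: "continuous_on {a..b} y"
    and der: "\<And>t. a < t \<Longrightarrow> t < b \<Longrightarrow> (y has_vector_derivative y' t) (at t)"
    and bd: "\<And>t. a < t \<Longrightarrow> t < b \<Longrightarrow> norm (y' t) \<le> A * norm (y t) + C"
    and A: "0 \<le> A" "(b - a) * A \<le> 1 / 2" and C: "0 \<le> C"
    and t: "a \<le> t" "t \<le> b"
  shows "norm (y t) \<le> 2 * norm (y a) + 2 * (b - a) * C"
proof -
  have "continuous_on {a..b} (\<lambda>s. norm (y s))" by (intro continuous_on_norm cont)
  then obtain s where s: "s \<in> {a..b}" "\<And>x. x \<in> {a..b} \<Longrightarrow> norm (y x) \<le> norm (y s)"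
    using continuous_attains_sup[of "{a..b}" "\<lambda>s. norm (y s)"] t by auto
  let ?m = "norm (y s)"
  have "norm (y s - y a) \<le> (A * ?m + C) * (s - a)"
  proof (rule norm_increment_le[OF cont der])
    fix x assume x: "a < x" "x < b"
    have "norm (y' x) \<le> A * norm (y x) + C" by (rule bd[OF x])
    also have "\<dots> \<le> A * ?m + C" using s(2)[of x] x A by (intro add_right_mono mult_left_mono) auto
    finally show "norm (y' x) \<le> A * ?m + C" .
  qed (use s in auto)
  also have "\<dots> \<le> (A * ?m + C) * (b - a)"
    using s A C by (intro mult_left_mono add_nonneg_nonneg mult_nonneg_nonneg) auto
  also have "\<dots> = ((b - a) * A) * ?m + (b - a) * C" by (simp add: algebra_simps)
  also have "\<dots> \<le> 1 / 2 * ?m + (b - a) * C" using A by (intro add_right_mono mult_right_mono) auto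
  finally have "?m \<le> norm (y a) + 1 / 2 * ?m + (b - a) * C"
    using norm_triangle_sub[of "y s" "y a"] by linarith
  moreover have "norm (y t) \<le> ?m" using s(2)[of t] t by auto
  ultimately show ?thesis by linarith
qed

section \<open>Global existence for bounded Lipschitz right-hand sides\<close>

lemma integral_has_vector_derivative_atLeast:
  fixes g :: "real \<Rightarrow> 'a::banach"
  assumes "continuous_on {t0..} g" "t0 \<le> t"
  shows "((\<lambda>t. integral {t0..t} g) has_vector_derivative g t) (at t within {t0..})"
proof -
  have "((\<lambda>t. integral {t0..t} g) has_vector_derivative g t) (at t within {t0..t+1})"
    by (rule integral_has_vector_derivative) (use assms in \<open>auto intro: continuous_on_subset[OF assms(1)]\<close>)
  moreover have "at t within {t0..t+1} = at t within {t0..}"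
    by (rule at_within_nhd[of t "{..<t+1}"]) auto
  ultimately show ?thesis by simp
qed

text \<open>The Picard operator is a contraction for the sup norm weighted by \<open>exp (- 2 L (t - t0))\<close>, so
  the whole half-line is covered at once.\<close>

lemma global_ode_solution:
  fixes f :: "real \<Rightarrow> 'a::euclidean_space \<Rightarrow> 'a"
  assumes cont: "\<And>y. continuous_on {t0..} y \<Longrightarrow> continuous_on {t0..} (\<lambda>s. f s (y s))"
    and bnd: "\<And>s x. t0 \<le> s \<Longrightarrow> norm (f s x) \<le> M"
    and lip: "\<And>s x y. t0 \<le> s \<Longrightarrow> norm (f s x - f s y) \<le> L * norm (x - y)"
    and L: "0 < L"
  shows "\<exists>u. u t0 = u0 \<and> (\<forall>t\<ge>t0. (u has_vector_derivative f t (u t)) (at t within {t0..}))"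
proof -
  define K where "K = 2 * L"
  have K: "0 < K" using L by (simp add: K_def)
  have M: "0 \<le> M" using bnd[of t0 0] norm_ge_zero order_trans by blast
  define e where "e t = exp (K * (t - t0))" for t
  have e: "0 < e t" for t by (simp add: e_def)
  have ce: "continuous_on X e" for X unfolding e_def by (intro continuous_intros)
  \<comment> \<open>The unknown is stored divided by the weight, which turns the weighted norm into
    the ordinary sup norm of bounded continuous functions; the solution is \<open>e\<close> times
    the fixed point.\<close>
  define G where "G y s = f s (e s *\<^sub>R apply_bcontfun y s)" for y s
  have G: "continuous_on {t0..} (G y)" for y
    unfolding G_def by (intro cont continuous_on_scaleR ce continuous_on_apply_bcontfun)
  have Gi: "G y integrable_on {t0..t}" for y t
    by (intro integrable_continuous_real continuous_on_subset[OF G]) auto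
  define I where "I y t = integral {t0..t} (G y)" for y t
  have dI: "(I y has_vector_derivative G y t) (at t within {t0..})" if "t0 \<le> t" for y t
    unfolding I_def by (rule integral_has_vector_derivative_atLeast[OF G that])
  have cI: "continuous_on {t0..} (I y)" for y
    using dI by (meson atLeast_iff continuous_on_eq_continuous_within has_vector_derivative_continuous)
  \<comment> \<open>Bounded continuous functions live on the whole line here;
    \<open>max t t0\<close> continues the operator constantly to the left of
    \<open>t0\<close>.\<close>
  define T where "T y t = (1 / e (max t t0)) *\<^sub>R (u0 + I y (max t t0))" for y t
  have nI: "norm (I y t) \<le> M * (t - t0)" if "t0 \<le> t" for y t
    unfolding I_def
  proof (rule integral_bound[OF that])
    show "continuous_on {t0..t} (G y)" by (rule continuous_on_subset[OF G]) auto
    show "norm (G y x) \<le> M" if "x \<in> {t0..t}" for x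
      unfolding G_def using that by (intro bnd) auto
  qed
  have Tb: "T y \<in> bcontfun" for y
  proof (rule bcontfun_normI)
    have "continuous_on UNIV (\<lambda>t. I y (max t t0))"
      by (rule continuous_on_compose2[OF cI]) (auto intro!: continuous_intros)
    moreover have "continuous_on UNIV (\<lambda>t. e (max t t0))"
      by (rule continuous_on_compose2[OF ce[of UNIV]]) (auto intro!: continuous_intros)
    ultimately show "continuous_on UNIV (T y)"
      unfolding T_def using e by (intro continuous_intros) (auto simp: less_imp_neq[symmetric])
    fix t
    define s where "s = max t t0"
    have s: "t0 \<le> s" by (simp add: s_def)
    have 1: "1 \<le> e s" using s K by (simp add: e_def)
    \<comment> \<open>The integral grows at most linearly because \<open>f\<close> is bounded, and
      the weight dominates linear growth; hence \<open>T y\<close> is bounded.\<close>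
    have 2: "K * (s - t0) \<le> e s" unfolding e_def using exp_ge_add_one_self[of "K * (s - t0)"] by linarith
    have "norm (T y t) = norm (u0 + I y s) / e s"
      unfolding T_def s_def[symmetric] using e[of s] by simp
    also have "\<dots> \<le> (norm u0 + M * (s - t0)) / e s"
      using nI[OF s, of y] e[of s] norm_triangle_ineq[of u0 "I y s"] by (intro divide_right_mono) auto
    also have "\<dots> = norm u0 / e s + M * (s - t0) / e s" by (simp add: add_divide_distrib)
    also have "\<dots> \<le> norm u0 + M / K"
    proof (rule add_mono)
      show "norm u0 / e s \<le> norm u0" using 1 by (simp add: divide_le_eq mult_left_mono mult_le_cancel_left1)
      have "M * (K * (s - t0)) \<le> M * e s" using 2 M by (rule mult_left_mono)
      then show "M * (s - t0) / e s \<le> M / K" using K e[of s] by (simp add: field_simps)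
    qed
    finally show "norm (T y t) \<le> norm u0 + M / K" .
  qed
  have lipT: "dist (Bcontfun (T y)) (Bcontfun (T z)) \<le> 1 / 2 * dist y z" for y z
  proof (rule dist_bound)
    fix t
    define s where "s = max t t0"
    have s: "t0 \<le> s" by (simp add: s_def)
    have "I y s - I z s = integral {t0..s} (\<lambda>x. G y x - G z x)"
      unfolding I_def by (rule integral_diff[symmetric]) (rule Gi)+
    also have "norm \<dots> \<le> integral {t0..s} (\<lambda>x. L * dist y z * e x)"
    proof (rule integral_norm_bound_integral)
      show "(\<lambda>x. G y x - G z x) integrable_on {t0..s}" by (intro integrable_diff Gi)
      show "(\<lambda>x. L * dist y z * e x) integrable_on {t0..s}"
        by (intro integrable_continuous_real continuous_intros ce)
      fix x assume x: "x \<in> {t0..s}"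
      have "norm (G y x - G z x) \<le> L * norm (e x *\<^sub>R apply_bcontfun y x - e x *\<^sub>R apply_bcontfun z x)"
        unfolding G_def using x by (intro lip) auto
      also have "\<dots> = L * (e x * dist (apply_bcontfun y x) (apply_bcontfun z x))"
        using e[of x] by (simp add: scaleR_diff_right[symmetric] dist_norm)
      also have "\<dots> \<le> L * (e x * dist y z)"
        using L e[of x] dist_bounded[of y x z] by (intro mult_left_mono) auto
      finally show "norm (G y x - G z x) \<le> L * dist y z * e x" by (simp add: mult_ac)
    qed
    also have "\<dots> = L * dist y z * e s / K - L * dist y z * e t0 / K"
    proof (rule integral_unique, rule fundamental_theorem_of_calculus[OF s])
      fix x assume "x \<in> {t0..s}"
      show "((\<lambda>s. L * dist y z * e s / K) has_vector_derivative L * dist y z * e x) (at x within {t0..s})"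
        unfolding has_real_derivative_iff_has_vector_derivative[symmetric] e_def
        using K by (auto intro!: derivative_eq_intros)
    qed
    also have "\<dots> \<le> L * dist y z * e s / K" using L K e[of t0] by simp
    \<comment> \<open>Integrating the weight produces \<open>1 / K\<close>, so
      \<open>K = 2 * L\<close> makes the contraction constant 1/2.\<close>
    also have "\<dots> = 1 / 2 * dist y z * e s" using L by (simp add: K_def)
    finally have d: "norm (I y s - I z s) \<le> 1 / 2 * dist y z * e s" .
    have "T y t - T z t = (1 / e s) *\<^sub>R (I y s - I z s)"
      unfolding T_def s_def[symmetric] by (simp add: algebra_simps)
    then have "norm (T y t - T z t) = norm (I y s - I z s) / e s" using e[of s] by simp
    also have "\<dots> \<le> 1 / 2 * dist y z" using d e[of s] by (simp add: divide_le_eq)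
    finally show "dist (apply_bcontfun (Bcontfun (T y)) t) (apply_bcontfun (Bcontfun (T z)) t) \<le> 1 / 2 * dist y z"
      by (simp add: Bcontfun_inverse[OF Tb] dist_norm)
  qed
  obtain y where y: "Bcontfun (T y) = y"
    using banach_fix_type[of "1/2" "\<lambda>y. Bcontfun (T y)"] lipT by auto
  have yT: "apply_bcontfun y t = T y t" for t
    using arg_cong[OF y, of apply_bcontfun] by (simp add: Bcontfun_inverse[OF Tb] fun_eq_iff)
  define u where "u t = e t *\<^sub>R apply_bcontfun y t" for t
  have u: "u t = u0 + I y t" if "t0 \<le> t" for t
    unfolding u_def yT T_def using that e[of t] by (simp add: max_absorb1)
  show ?thesis
  proof (intro exI[of _ u] conjI allI impI)
    show "u t0 = u0" using u[of t0] by (simp add: I_def)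
    fix t assume t: "t0 \<le> t"
    have "((\<lambda>t. u0 + I y t) has_vector_derivative G y t) (at t within {t0..})"
      using dI[OF t] by (auto intro!: derivative_eq_intros)
    then have "(u has_vector_derivative G y t) (at t within {t0..})"
      by (rule has_vector_derivative_transform[rotated 2]) (use u t in auto)
    then show "(u has_vector_derivative f t (u t)) (at t within {t0..})"
      by (simp add: G_def u_def)
  qed
qed

lemma closest_point_cball_outside:
  fixes x :: "'a::euclidean_space"
  assumes "0 < r" "r \<le> norm x"
  shows "closest_point (cball 0 r) x = (r / norm x) *\<^sub>R x"
proof (rule closest_point_unique[symmetric])
  show "(r / norm x) *\<^sub>R x \<in> cball 0 r" using assms by auto
  show "\<forall>z\<in>cball 0 r. dist x ((r / norm x) *\<^sub>R x) \<le> dist x z"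
  proof
    fix z :: 'a assume z: "z \<in> cball 0 r"
    have "x - (r / norm x) *\<^sub>R x = (1 - r / norm x) *\<^sub>R x" by (simp add: algebra_simps)
    then have "dist x ((r / norm x) *\<^sub>R x) = \<bar>1 - r / norm x\<bar> * norm x" by (simp add: dist_norm)
    also have "\<dots> = (1 - r / norm x) * norm x" using assms by (simp add: divide_le_eq)
    also have "\<dots> = norm x - r"
    proof -
      have "norm x \<noteq> 0" using assms by linarith
      then show ?thesis by (simp add: left_diff_distrib)
    qed
    also have "\<dots> \<le> dist x z" using z norm_triangle_sub[of x z] by (simp add: dist_norm)
    finally show "dist x ((r / norm x) *\<^sub>R x) \<le> dist x z" .
  qed
qed auto

locale dissipative_field = entire_field N Nc B t0
  for N :: "real \<Rightarrow> real^'m \<Rightarrow> real^'m^'m" and Nc B t0 +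
  fixes \<phi> :: "real \<Rightarrow> real^'m" and \<kappa> \<alpha> :: real and u0 :: "real^'m"
  assumes phi_cont: "continuous_on {t0..} \<phi>"
    and phi_bdd: "t0 \<le> t \<Longrightarrow> norm (\<phi> t) \<le> \<kappa>"
    and alpha_pos: "0 < \<alpha>"
    and dissip: "t0 \<le> t \<Longrightarrow> v \<bullet> (jac N t u *v v) \<le> - \<alpha> * (v \<bullet> v)"
begin

section \<open>Existence and uniqueness for the dissipative problem\<close>

lemma kappa_nonneg: "0 \<le> \<kappa>"
  using phi_bdd[of t0] norm_ge_zero order_trans by blast

text \<open>Mean value theorem along the segment from \<open>v\<close> to \<open>u\<close>: the
  derivative of the field in direction \<open>w\<close> is the Jacobian applied to \<open>w\<close>,
  and dissipativity is used at the intermediate point.\<close>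

lemma one_sided_Lipschitz:
  assumes t: "t0 \<le> t"
  shows "(u - v) \<bullet> (N t u *v u - N t v *v v) \<le> - \<alpha> * ((u - v) \<bullet> (u - v))"
proof -
  define w where "w = u - v"
  define f where "f s = w \<bullet> (N t (v + s *\<^sub>R w) *v (v + s *\<^sub>R w))" for s
  have "(f has_field_derivative w \<bullet> (jac N t (v + s *\<^sub>R w) *v w)) (at s)" for s
  proof -
    have "((\<lambda>s. N t (v + s *\<^sub>R w) *v (v + s *\<^sub>R w)) has_vector_derivative
        (N t (v + s *\<^sub>R w) *v w + DN t (v + s *\<^sub>R w) w *v (v + s *\<^sub>R w))) (at s)"
      by (rule mv.has_vector_derivative[OF has_vector_derivative_line[OF t]])
        (auto intro!: derivative_eq_intros)
    then have "((\<lambda>s. w \<bullet> (N t (v + s *\<^sub>R w) *v (v + s *\<^sub>R w))) has_vector_derivative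
        w \<bullet> (N t (v + s *\<^sub>R w) *v w + DN t (v + s *\<^sub>R w) w *v (v + s *\<^sub>R w))) (at s)"
      by (rule bounded_linear.has_vector_derivative[OF bounded_linear_inner_right])
    then show ?thesis
      unfolding f_def[abs_def] has_real_derivative_iff_has_vector_derivative jac_mult[OF t] .
  qed
  then obtain z where "f 1 - f 0 = (1 - 0) * (w \<bullet> (jac N t (v + z *\<^sub>R w) *v w))"
    using MVT2[of 0 1 f "\<lambda>s. w \<bullet> (jac N t (v + s *\<^sub>R w) *v w)"] by auto
  then have "f 1 - f 0 \<le> - \<alpha> * (w \<bullet> w)" using dissip[OF t] by simp
  then show ?thesis by (simp add: f_def w_def inner_diff_right)
qed

lemma inner_field_le: "t0 \<le> t \<Longrightarrow> u \<bullet> (N t u *v u) \<le> - \<alpha> * (u \<bullet> u)"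
  using one_sided_Lipschitz[of t u 0] by simp

text \<open>The ball of radius 0 is invariant for the difference. Stated on an interval with
  derivatives in its interior, the lemma applies to the half-line and to single grid cells
  alike.\<close>

lemma solutions_agree:
  assumes a: "t0 \<le> a" and u: "continuous_on {a..b} u" and v: "continuous_on {a..b} v"
    and du: "\<And>t. a < t \<Longrightarrow> t < b \<Longrightarrow> (u has_vector_derivative (N t (u t) *v u t + \<phi> t)) (at t)"
    and dv: "\<And>t. a < t \<Longrightarrow> t < b \<Longrightarrow> (v has_vector_derivative (N t (v t) *v v t + \<phi> t)) (at t)"
    and e: "u a = v a" and t: "a \<le> t" "t \<le> b"
  shows "u t = v t"
proof -
  have "norm (u t - v t) \<le> 0"
  proof (rule ball_invariant[of a b "\<lambda>t. u t - v t" "\<lambda>t. N t (u t) *v u t - N t (v t) *v v t" 0 t])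
    fix x assume x: "a < x" "x < b"
    show "((\<lambda>t. u t - v t) has_vector_derivative (N x (u x) *v u x - N x (v x) *v v x)) (at x)"
      using has_vector_derivative_diff[OF du[OF x] dv[OF x]] by simp
    show "(u x - v x) \<bullet> (N x (u x) *v u x - N x (v x) *v v x) \<le> 0"
      using one_sided_Lipschitz[of x "u x" "v x"] x a alpha_pos
      by (smt (verit) inner_ge_zero mult_nonneg_nonneg minus_mult_left)
  qed (use u v e t in \<open>auto intro!: continuous_intros\<close>)
  then show ?thesis by simp
qed

text \<open>Projecting the argument of the field onto a ball makes it bounded and globally
  Lipschitz. The ball is invariant for the projected equation, so the solution of that equation
  never meets the truncation.\<close>

lemma solution_exists: "\<exists>u. is_solution N \<phi> t0 u0 u"
proof -
  \<comment> \<open>At radius \<open>\<kappa> / \<alpha>\<close> the damping balances the forcing;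
    the added 1 secures \<open>1 \<le> r\<close> for the Lipschitz bound.\<close>
  define r where "r = norm u0 + \<kappa> / \<alpha> + 1"
  have r: "1 \<le> r" "norm u0 \<le> r" "\<kappa> \<le> \<alpha> * r"
    using alpha_pos kappa_nonneg by (auto simp: r_def field_simps)
  define P where "P = closest_point (cball (0::real^'m) r)"
  have Pr: "norm (P x) \<le> r" for x
    using closest_point_in_set[of "cball (0::real^'m) r" x] r by (auto simp: P_def)
  have Pl: "norm (P x - P y) \<le> norm (x - y)" for x y
    using closest_point_lipschitz[of "cball (0::real^'m) r" x y] r by (auto simp: P_def dist_norm)
  have Pc: "continuous_on X P" for X
    unfolding P_def by (rule continuous_on_closest_point) (use r in auto)
  define f where "f s x = N s (P x) *v P x + \<phi> s" for s x
  let ?L = "NB (2 * r) * r + NB r + 1"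
  have NBr: "0 \<le> NB r" "0 \<le> NB (2 * r)" using NB_nonneg r by auto
  have "\<exists>u. u t0 = u0 \<and> (\<forall>t\<ge>t0. (u has_vector_derivative f t (u t)) (at t within {t0..}))"
  proof (rule global_ode_solution[where M="NB r * r + \<kappa>" and L="?L"])
    fix y :: "real \<Rightarrow> real^'m" assume y: "continuous_on {t0..} y"
    have Py: "continuous_on {t0..} (\<lambda>s. P (y s))"
      by (rule continuous_on_compose2[OF Pc[of UNIV] y]) auto
    show "continuous_on {t0..} (\<lambda>s. f s (y s))"
      unfolding f_def
      by (intro continuous_intros mv.continuous_on continuous_on_N[where r=r] Py phi_cont Pr) auto
  next
    fix s x assume s: "t0 \<le> s"
    have "norm (N s (P x) *v P x) \<le> NB r * r"
      using norm_matrix_vector_mult_le[of "N s (P x)" "P x"] norm_N_le[OF s Pr] Pr NBr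
      by (meson mult_mono norm_ge_zero order_trans)
    then show "norm (f s x) \<le> NB r * r + \<kappa>"
      unfolding f_def using phi_bdd[OF s] norm_triangle_mono by blast
  next
    fix s x y assume s: "t0 \<le> s"
    have "f s x - f s y = (N s (P x) - N s (P y)) *v P x + N s (P y) *v (P x - P y)"
      by (simp add: f_def mv.diff_left mv.diff_right)
    also have "norm \<dots> \<le> norm (N s (P x) - N s (P y)) * norm (P x) + norm (N s (P y)) * norm (P x - P y)"
      by (intro norm_triangle_mono norm_matrix_vector_mult_le)
    also have "\<dots> \<le> (NB (2 * r) * norm (P x - P y)) * r + NB r * norm (P x - P y)"
      using NBr by (intro add_mono mult_mono norm_N_diff_le norm_N_le s Pr r mult_nonneg_nonneg order_refl) auto
    also have "\<dots> = (NB (2 * r) * r + NB r) * norm (P x - P y)" by (simp add: algebra_simps)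
    also have "\<dots> \<le> ?L * norm (x - y)"
      using NBr r Pl[of x y] by (intro mult_mono) auto
    finally show "norm (f s x - f s y) \<le> ?L * norm (x - y)" .
  qed (use NBr r in \<open>auto intro!: add_nonneg_pos\<close>)
  then obtain u where u: "u t0 = u0" "\<And>t. t0 \<le> t \<Longrightarrow> (u has_vector_derivative f t (u t)) (at t within {t0..})"
    by auto
  have cu: "continuous_on {t0..} u"
    using u(2) by (meson atLeast_iff continuous_on_eq_continuous_within has_vector_derivative_continuous)
  have "norm (u t) \<le> r" if t: "t0 \<le> t" for t
  proof (rule ball_invariant[of t0 t u "\<lambda>t. f t (u t)" r t])
    show "continuous_on {t0..t} u" by (rule continuous_on_subset[OF cu]) auto
    fix s assume s: "t0 < s" "s < t"
    have "at s within {t0..} = at s" by (rule at_within_interior) (use s in auto)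
    then show "(u has_vector_derivative f s (u s)) (at s)" using u(2)[of s] s by auto
    assume ur: "r \<le> norm (u s)"
    let ?x = "u s" and ?c = "norm (u s) / r"
    have Pu: "P ?x = (r / norm ?x) *\<^sub>R ?x"
      unfolding P_def by (rule closest_point_cball_outside) (use r ur in auto)
    \<comment> \<open>Outside the ball a point is a positive multiple of its projection, so
      dissipativity at the projection passes to the point itself.\<close>
    have x: "?x = ?c *\<^sub>R P ?x" unfolding Pu using r ur by auto
    have "norm (P ?x) = r" unfolding Pu using r ur by auto
    then have PP: "P ?x \<bullet> P ?x = r * r" by (simp add: power2_norm_eq_inner[symmetric] power2_eq_square)
    have "?x \<bullet> (N s (P ?x) *v P ?x) = ?c * (P ?x \<bullet> (N s (P ?x) *v P ?x))"
      by (subst x) simp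
    also have "\<dots> \<le> ?c * (- \<alpha> * (P ?x \<bullet> P ?x))"
      using r s inner_field_le[of s "P ?x"] by (intro mult_left_mono) auto
    also have "\<dots> = - (\<alpha> * r) * norm ?x" using r unfolding PP by simp
    finally have 1: "?x \<bullet> (N s (P ?x) *v P ?x) \<le> - (\<alpha> * r) * norm ?x" .
    have "?x \<bullet> \<phi> s \<le> norm ?x * \<kappa>"
      using norm_cauchy_schwarz[of ?x "\<phi> s"] phi_bdd[of s] s
      by (meson less_imp_le mult_left_mono norm_ge_zero order_trans)
    also have "\<dots> \<le> norm ?x * (\<alpha> * r)" using r by (intro mult_left_mono) auto
    finally show "?x \<bullet> f s ?x \<le> 0" using 1 by (simp add: f_def inner_add_right mult.commute)
  qed (use u r t in auto)
  then have "P (u t) = u t" if "t0 \<le> t" for t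
    using that unfolding P_def by (intro closest_point_self) auto
  then have "is_solution N \<phi> t0 u0 u"
    unfolding is_solution_def using u by (auto simp: f_def)
  then show ?thesis by blast
qed

lemma is_solutionD:
  assumes "is_solution N \<phi> t0 u0 u"
  shows "continuous_on {t0..} u" "t0 < t \<Longrightarrow> (u has_vector_derivative (N t (u t) *v u t + \<phi> t)) (at t)"
    "u t0 = u0"
proof -
  have d: "\<And>t. t0 \<le> t \<Longrightarrow> (u has_vector_derivative (N t (u t) *v u t + \<phi> t)) (at t within {t0..})"
    using assms by (simp add: is_solution_def)
  then show "continuous_on {t0..} u"
    by (meson atLeast_iff continuous_on_eq_continuous_within has_vector_derivative_continuous)
  show "u t0 = u0" using assms by (simp add: is_solution_def)
  assume t: "t0 < t"
  have "at t within {t0..} = at t" by (rule at_within_interior) (use t in auto)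
  then show "(u has_vector_derivative (N t (u t) *v u t + \<phi> t)) (at t)" using d[of t] t by auto
qed

lemma solution_unique:
  assumes u: "is_solution N \<phi> t0 u0 u" and v: "is_solution N \<phi> t0 u0 v" and t: "t0 \<le> t"
  shows "v t = u t"
  by (rule solutions_agree[of t0 t v u t])
    (use is_solutionD[OF u] is_solutionD[OF v] t in \<open>auto elim: continuous_on_subset\<close>)

lemma base_step:
  assumes a: "t0 \<le> a" and r: "1 \<le> r" "\<kappa> + 1 \<le> \<alpha> * r" and w: "norm w \<le> r"
    and r2: "r2 = 2 * r + 2 * \<kappa>" and c1: "c1 = NB r * r2 + \<kappa>"
    and h: "b - a \<le> h" "h * NB r \<le> 1 / 2" "h \<le> 1" "h * (NB (2 * r2) * c1 * r2) \<le> 1"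
    and y: "continuous_on {a..b} y" "y a = w"
    and dy: "\<And>t. a < t \<Longrightarrow> t < b \<Longrightarrow> (y has_vector_derivative (N t w *v y t + \<phi> t)) (at t)"
    and t: "a \<le> t" "t \<le> b"
  shows "norm (y t) \<le> r" "norm (y t - w) \<le> c1 * h"
proof -
  have NBr: "0 \<le> NB r" using NB_nonneg r by auto
  have r2r: "r \<le> r2" "1 \<le> r2" using r kappa_nonneg by (auto simp: r2)
  have NBr2: "0 \<le> NB (2 * r2)" using NB_nonneg r2r by auto
  have c10: "0 \<le> c1" using NBr r2r kappa_nonneg by (simp add: c1)
  have Ny: "norm (N t w *v y t + \<phi> t) \<le> NB r * norm (y t) + \<kappa>" if "a < t" "t < b" for t
  proof (rule norm_triangle_mono)
    show "norm (N t w *v y t) \<le> NB r * norm (y t)"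
      using norm_matrix_vector_mult_le[of "N t w" "y t"] norm_N_le[of t w r] w that a
      by (meson less_imp_le mult_right_mono norm_ge_zero order_trans)
    show "norm (\<phi> t) \<le> \<kappa>" using that a by (intro phi_bdd) auto
  qed
  have "(b - a) * NB r \<le> h * NB r" using h NBr by (intro mult_right_mono)
  then have bA: "(b - a) * NB r \<le> 1 / 2" using h by linarith
  have g: "norm (y t) \<le> r2" if "a \<le> t" "t \<le> b" for t
  proof -
    have "norm (y t) \<le> 2 * norm (y a) + 2 * (b - a) * \<kappa>"
      by (rule norm_growth_le[OF y(1) dy Ny NBr bA kappa_nonneg that])
    also have "\<dots> \<le> 2 * r + 2 * 1 * \<kappa>"
      using w y h kappa_nonneg by (intro add_mono mult_right_mono mult_left_mono) auto
    finally show ?thesis by (simp add: r2)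
  qed
  have inc: "norm (y t - w) \<le> c1 * h" if t: "a \<le> t" "t \<le> b" for t
  proof -
    have "norm (y t - y a) \<le> c1 * (t - a)"
    proof (rule norm_increment_le[OF y(1) dy _ t])
      fix x assume x: "a < x" "x < b"
      have "NB r * norm (y x) \<le> NB r * r2" using g[of x] x NBr by (intro mult_left_mono) auto
      then show "norm (N x w *v y x + \<phi> x) \<le> c1" using Ny[OF x] unfolding c1 by linarith
    qed
    also have "\<dots> \<le> c1 * h" using c10 h t by (intro mult_left_mono) auto
    finally show ?thesis using y by simp
  qed
  then show "norm (y t - w) \<le> c1 * h" using t by simp
  show "norm (y t) \<le> r"
  proof (rule ball_invariant[OF y(1) dy])
    fix x assume x: "a < x" "x < b" and ry: "r \<le> norm (y x)"
    have xt: "t0 \<le> x" using x a by simp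
    let ?d = "(N x w - N x (y x)) *v y x"
    have "norm ?d \<le> norm (N x w - N x (y x)) * norm (y x)" by (rule norm_matrix_vector_mult_le)
    also have "\<dots> \<le> (NB (2 * r2) * norm (w - y x)) * r2"
      using w r2r g[of x] x NBr2 by (intro mult_mono norm_N_diff_le xt) auto
    also have "\<dots> \<le> (NB (2 * r2) * (c1 * h)) * r2"
      using inc[of x] x NBr2 r2r by (intro mult_right_mono mult_left_mono) (auto simp: norm_minus_commute)
    also have "\<dots> \<le> 1" using h(4) by (simp add: mult_ac)
    finally have d: "norm (?d + \<phi> x) \<le> 1 + \<kappa>" using phi_bdd[OF xt] norm_triangle_mono by blast
    have "y x \<bullet> (N x w *v y x + \<phi> x) = y x \<bullet> (N x (y x) *v y x) + y x \<bullet> (?d + \<phi> x)"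
      by (simp add: mv.diff_left inner_add_right inner_diff_right)
    also have "\<dots> \<le> - \<alpha> * (y x \<bullet> y x) + norm (y x) * (1 + \<kappa>)"
      using inner_field_le[OF xt, of "y x"] norm_cauchy_schwarz[of "y x" "?d + \<phi> x"] d
      by (smt (verit) mult_left_mono norm_ge_zero)
    also have "\<dots> = norm (y x) * (1 + \<kappa> - \<alpha> * norm (y x))"
      by (simp add: power2_norm_eq_inner[symmetric] power2_eq_square algebra_simps)
    also have "\<dots> \<le> 0"
    proof -
      have "\<alpha> * r \<le> \<alpha> * norm (y x)" using ry alpha_pos by simp
      then show ?thesis using r by (intro mult_nonneg_nonpos) auto
    qed
    finally show "y x \<bullet> (N x w *v y x + \<phi> x) \<le> 0" .
  qed (use y w t in auto)
qed

text \<open>The right-hand side is the Jacobian at \<open>w\<close> applied to \<open>y t\<close>,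
  plus \<open>F t\<close>, plus the errors of having \<open>y a\<close> instead of
  \<open>y t\<close> in the derivative and \<open>z t\<close> instead of \<open>w\<close>. By the
  last condition on \<open>h\<close> the errors are at most \<open>f\<close> together, so the
  perturbation is at most \<open>2 * f\<close>: this is the 2 in \<open>c = 2 / \<alpha>\<close>.
  The derivative of \<open>y\<close> on the cell is bounded by \<open>c2 * f\<close>.\<close>

lemma correction_step:
  assumes a: "t0 \<le> a" and r: "1 \<le> r" and w: "norm w \<le> r" and z: "\<And>t. a < t \<Longrightarrow> t < b \<Longrightarrow> norm (z t) \<le> r"
    and zw: "\<And>t. a < t \<Longrightarrow> t < b \<Longrightarrow> norm (z t - w) \<le> c1 * h"
    and f: "0 \<le> f" and F: "\<And>t. a < t \<Longrightarrow> t < b \<Longrightarrow> norm (F t) \<le> f" and c1: "0 \<le> c1"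
    and c: "c = 2 / \<alpha>" and D: "D = NB (2 * r)"
    and c2: "c2 = NB r * (2 * c + 2 * (D * c * r + 1)) + D * c * r + 1"
    and h: "b - a \<le> h" "h * NB r \<le> 1 / 2" "h \<le> 1" "h * (D * c2 * r + D * c * c1) \<le> 1"
    and y: "continuous_on {a..b} y" "norm (y a) \<le> c * f"
    and dy: "\<And>t. a < t \<Longrightarrow> t < b \<Longrightarrow>
      (y has_vector_derivative (N t w *v y t + DN t w (y a) *v z t + F t)) (at t)"
    and t: "a \<le> t" "t \<le> b"
  shows "norm (y t) \<le> c * f" "norm (y t - y a) \<le> c2 * h * f"
proof -
  have NBr: "0 \<le> NB r" "0 \<le> D" using NB_nonneg r by (auto simp: D)
  have c0: "0 < c" using alpha_pos by (simp add: c)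
  have c20: "0 \<le> c2" using NBr c0 r by (simp add: c2)
  have h0: "0 \<le> h" using h t by linarith
  let ?C = "D * (c * f) * r + f"
  have C0: "0 \<le> ?C" using NBr c0 r f by simp
  have DN1: "norm (DN x w v *v q) \<le> D * norm v * norm q" if "a < x" for x v q
    using norm_matrix_vector_mult_le[of "DN x w v" q] norm_DN_le[of x w r v] w r a that
    unfolding D by (meson less_imp_le mult_right_mono norm_ge_zero order_trans)
  have Ny: "norm (N x w *v y x + DN x w (y a) *v z x + F x) \<le> NB r * norm (y x) + ?C" if x: "a < x" "x < b" for x
  proof -
    have "norm (N x w *v y x) \<le> NB r * norm (y x)"
      using norm_matrix_vector_mult_le[of "N x w" "y x"] norm_N_le[of x w r] w x a
      by (meson less_imp_le mult_right_mono norm_ge_zero order_trans)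
    moreover have "norm (DN x w (y a) *v z x) \<le> D * (c * f) * r"
      using DN1[OF x(1), of "y a" "z x"] z[OF x] y(2) NBr c0 f
      by (smt (verit) mult_mono mult_nonneg_nonneg norm_ge_zero)
    moreover have "norm (F x) \<le> f" by (rule F[OF x])
    ultimately show ?thesis
      using norm_triangle_ineq[of "N x w *v y x + DN x w (y a) *v z x" "F x"]
        norm_triangle_ineq[of "N x w *v y x" "DN x w (y a) *v z x"] by linarith
  qed
  have "(b - a) * NB r \<le> h * NB r" using h NBr by (intro mult_right_mono)
  then have bA: "(b - a) * NB r \<le> 1 / 2" using h by linarith
  have g: "norm (y x) \<le> (2 * c + 2 * (D * c * r + 1)) * f" if "a \<le> x" "x \<le> b" for x
  proof -
    have "norm (y x) \<le> 2 * norm (y a) + 2 * (b - a) * ?C"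
      by (rule norm_growth_le[OF y(1) dy Ny NBr(1) bA C0 that])
    also have "\<dots> \<le> 2 * (c * f) + 2 * 1 * ?C"
      using y h C0 by (intro add_mono mult_right_mono mult_left_mono) auto
    finally show ?thesis by (simp add: algebra_simps)
  qed
  have inc: "norm (y x - y a) \<le> c2 * h * f" if x: "a \<le> x" "x \<le> b" for x
  proof -
    have "norm (y x - y a) \<le> c2 * f * (x - a)"
    proof (rule norm_increment_le[OF y(1) dy _ x])
      fix s assume s: "a < s" "s < b"
      have "NB r * norm (y s) \<le> NB r * ((2 * c + 2 * (D * c * r + 1)) * f)"
        using g[of s] s NBr by (intro mult_left_mono) auto
      then show "norm (N s w *v y s + DN s w (y a) *v z s + F s) \<le> c2 * f"
        using Ny[OF s] unfolding c2 by (simp add: algebra_simps)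
    qed
    also have "\<dots> \<le> c2 * f * h" using c20 f h x by (intro mult_left_mono) auto
    finally show ?thesis by (simp add: mult_ac)
  qed
  then show "norm (y t - y a) \<le> c2 * h * f" using t by simp
  show "norm (y t) \<le> c * f"
  proof (rule ball_invariant[OF y(1) dy])
    fix x assume x: "a < x" "x < b" and ry: "c * f \<le> norm (y x)"
    have xt: "t0 \<le> x" using x a by simp
    let ?d = "DN x w (y a - y x) *v w + DN x w (y a) *v (z x - w) + F x"
    have 1: "norm (DN x w (y a - y x) *v w) \<le> D * (c2 * h * f) * r"
    proof -
      have "D * norm (y a - y x) * norm w \<le> D * (c2 * h * f) * r"
        using inc[of x] x NBr c20 h0 f w r
        by (intro mult_mono mult_left_mono mult_nonneg_nonneg) (auto simp: norm_minus_commute)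
      then show ?thesis using DN1[OF x(1), of "y a - y x" w] by linarith
    qed
    have 2: "norm (DN x w (y a) *v (z x - w)) \<le> D * (c * f) * (c1 * h)"
    proof -
      have "D * norm (y a) * norm (z x - w) \<le> D * (c * f) * (c1 * h)"
        using zw[OF x] NBr c0 h0 f y
        by (intro mult_mono mult_left_mono mult_nonneg_nonneg) auto
      then show ?thesis using DN1[OF x(1), of "y a" "z x - w"] by linarith
    qed
    have "norm ?d \<le> D * (c2 * h * f) * r + D * (c * f) * (c1 * h) + f"
      using 1 2 F[OF x] by (intro norm_triangle_mono)
    also have "\<dots> = (h * (D * c2 * r + D * c * c1)) * f + f" by (simp add: algebra_simps)
    also have "\<dots> \<le> 1 * f + f" using h(4) f by (intro add_right_mono mult_right_mono)
    finally have d: "norm ?d \<le> 2 * f" by simp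
    have e: "N x w *v y x + DN x w (y a) *v z x + F x = jac N x w *v y x + ?d"
      by (simp add: jac_mult[OF xt] linear_diff[OF linear_DN[OF xt]] mv.diff_left mv.diff_right)
    have "y x \<bullet> (N x w *v y x + DN x w (y a) *v z x + F x) = y x \<bullet> (jac N x w *v y x) + y x \<bullet> ?d"
      unfolding e by (simp add: inner_add_right)
    also have "\<dots> \<le> - \<alpha> * (y x \<bullet> y x) + norm (y x) * (2 * f)"
      using dissip[OF xt, of "y x" w] norm_cauchy_schwarz[of "y x" ?d] d
      by (smt (verit) mult_left_mono norm_ge_zero)
    also have "\<dots> = norm (y x) * (2 * f - \<alpha> * norm (y x))"
      by (simp add: power2_norm_eq_inner[symmetric] power2_eq_square algebra_simps)
    also have "\<dots> \<le> 0"
    proof -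
      have "\<alpha> * (c * f) \<le> \<alpha> * norm (y x)" using ry alpha_pos by simp
      then show ?thesis using alpha_pos by (intro mult_nonneg_nonpos) (auto simp: c)
    qed
    finally show "y x \<bullet> (N x w *v y x + DN x w (y a) *v z x + F x) \<le> 0" .
  qed (use y t in auto)
qed

end

section \<open>The scalar majorant recursion\<close>

lemma grid_ge: "is_grid g t0 \<Longrightarrow> t0 \<le> g i"
  unfolding is_grid_def using strict_mono_less_eq[of g 0 i] by auto

lemma grid_less: "is_grid g t0 \<Longrightarrow> g i < g (Suc i)"
  unfolding is_grid_def by (simp add: strict_mono_def)

lemma grid_step_ge: "grid_bdd g \<Longrightarrow> g (Suc i) - g i \<le> grid_step g"
  unfolding grid_bdd_def grid_step_def by (rule cSUP_upper) auto

lemma grid_step_pos: "is_grid g t0 \<Longrightarrow> grid_bdd g \<Longrightarrow> 0 < grid_step g"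
  using grid_less[of g t0 0] grid_step_ge[of g 0] by linarith

lemma grid_cover:
  assumes g: "is_grid g t0" and t: "t0 \<le> t"
  obtains i where "g i \<le> t" "t < g (Suc i)"
proof -
  have "\<exists>n. t < g n"
    using g unfolding is_grid_def filterlim_at_top_dense eventually_sequentially by blast
  then have L: "t < g (LEAST n. t < g n)" by (rule LeastI_ex)
  have "(LEAST n. t < g n) \<noteq> 0" using L g t by (metis is_grid_def not_le)
  then obtain i where i: "(LEAST n. t < g n) = Suc i" using not0_implies_Suc by blast
  have "\<not> t < g i" using not_less_Least[of i "\<lambda>n. t < g n"] i by simp
  then show ?thesis using that[of i] L i by simp
qed

text \<open>Turns the convolution of the bounds on matrices with those on vectors into one
  coefficient of a product of series.\<close>

lemma fps_conv_suminf:
  fixes b :: "nat \<Rightarrow> real"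
  assumes "\<And>n. summable (\<lambda>q. b q * fps_nth (X q) n)"
  shows "(\<Sum>p\<le>n. (\<Sum>q. b q * fps_nth (X q) (n - p)) * fps_nth W p) = (\<Sum>q. b q * fps_nth (W * X q) n)"
proof -
  have "(\<Sum>p\<le>n. (\<Sum>q. b q * fps_nth (X q) (n - p)) * fps_nth W p)
      = (\<Sum>p\<le>n. \<Sum>q. b q * fps_nth (X q) (n - p) * fps_nth W p)"
    by (intro sum.cong refl suminf_mult2 assms)
  also have "\<dots> = (\<Sum>q. \<Sum>p\<le>n. b q * fps_nth (X q) (n - p) * fps_nth W p)"
    by (rule suminf_sum[symmetric]) (intro summable_mult2 assms)
  also have "\<dots> = (\<Sum>q. b q * fps_nth (W * X q) n)"
    by (simp add: fps_mult_nth sum_distrib_left atLeast0AtMost mult_ac)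
  finally show ?thesis .
qed

text \<open>This is \<open>p * v ^ (p - 1)\<close>, the linear coefficient in the expansion of a
  \<open>p\<close>-th power about \<open>v\<close>; the recursive form matches the induction on the
  power.\<close>

fun lin_coeff :: "real \<Rightarrow> nat \<Rightarrow> real" where
  "lin_coeff v 0 = 0"
| "lin_coeff v (Suc p) = v ^ p + v * lin_coeff v p"

text \<open>\<open>quad_part V p\<close> is what remains of \<open>V ^ p\<close> after removing its part of degree at most one in the
  non-constant coefficients of \<open>V\<close>.\<close>

fun quad_part :: "real fps \<Rightarrow> nat \<Rightarrow> real fps" where
  "quad_part V 0 = 0"
| "quad_part V (Suc p) = V * quad_part V p + fps_const (lin_coeff (fps_nth V 0) p) *
     ((V - fps_const (fps_nth V 0)) * (V - fps_const (fps_nth V 0)))"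

lemma power_eq_quad_part:
  "V ^ p = fps_const (fps_nth V 0 ^ p) + fps_const (lin_coeff (fps_nth V 0) p) * (V - fps_const (fps_nth V 0))
    + quad_part V p"
proof (induction p)
  case (Suc p)
  define v where "v = fps_const (fps_nth V 0)"
  define l where "l = fps_const (lin_coeff (fps_nth V 0) p)"
  have e1: "fps_const (fps_nth V 0 ^ Suc p) = v * v ^ p" by (simp add: v_def)
  have e2: "fps_const (lin_coeff (fps_nth V 0) (Suc p)) = v ^ p + v * l"
    by (simp add: v_def l_def)
  have "V ^ Suc p = V * (v ^ p + l * (V - v) + quad_part V p)"
    using Suc by (simp add: v_def l_def)
  then show ?case unfolding e1 e2 quad_part.simps unfolding v_def[symmetric] l_def[symmetric]
    by (simp add: algebra_simps)
qed simp

text \<open>The linear part contributes a multiple of \<open>fps_nth V j\<close>, which vanishes.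
  Applied to series cut off at \<open>j\<close>, this is how the linear term drops out of the
  recursion.\<close>

lemma power_nth_eq_quad_part:
  "0 < j \<Longrightarrow> fps_nth V j = 0 \<Longrightarrow> fps_nth (V ^ p) j = fps_nth (quad_part V p) j"
  by (subst power_eq_quad_part) simp

lemma lin_coeff_nonneg: "0 \<le> v \<Longrightarrow> 0 \<le> lin_coeff v p"
  by (induction p) auto

lemma lin_coeff_le: "0 \<le> v \<Longrightarrow> v \<le> r \<Longrightarrow> 1 \<le> r \<Longrightarrow> lin_coeff v p \<le> (2 * r) ^ p"
proof (induction p)
  case (Suc p)
  have "lin_coeff v (Suc p) \<le> r ^ p + r * (2 * r) ^ p"
    unfolding lin_coeff.simps using Suc lin_coeff_nonneg[of v p]
    by (intro add_mono mult_mono power_mono) auto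
  also have "\<dots> \<le> r * (2 * r) ^ p + r * (2 * r) ^ p"
  proof -
    have "1 * r ^ p \<le> r * (2 * r) ^ p" using Suc by (intro mult_mono power_mono) auto
    then show ?thesis by (simp add: mult_ac)
  qed
  finally show ?case by (simp add: mult_ac)
qed simp

lemma fmaj_const: "0 \<le> c \<Longrightarrow> fmaj (fps_const c) (fps_const c)"
  by (simp add: fmaj_def)

text \<open>Only sums and products of the series, its non-constant part and nonnegative constants
  occur; equal constant terms ensure that those constants are the same on both sides.\<close>

lemma quad_part_mono:
  assumes "fmaj W V" "fps_nth W 0 = fps_nth V 0"
  shows "fmaj (quad_part W p) (quad_part V p)"
proof (induction p)
  case (Suc p)
  have y: "fmaj (W - fps_const (fps_nth W 0)) (V - fps_const (fps_nth V 0))"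
    using assms by (auto simp: fmaj_def)
  have "0 \<le> fps_nth V 0" using fmaj_nonneg[OF assms(1)] .
  then show ?case
    unfolding quad_part.simps assms(2) using y assms(2)
    by (intro fmaj_add fmaj_mult Suc assms fmaj_const lin_coeff_nonneg) auto
qed (simp add: fmaj_def)

lemma wnorm_const_mult: "wnorm x n (fps_const c * F) = c * wnorm x n F"
  by (simp add: wnorm_def sum_distrib_left mult_ac)

lemma wnorm_add: "wnorm x n (F + G) = wnorm x n F + wnorm x n G"
  by (simp add: wnorm_def sum.distrib algebra_simps)

text \<open>Every term of \<open>quad_part V p\<close> contains the non-constant part of
  \<open>V\<close> at least twice, which yields \<open>Y\<^sup>2\<close>; the number of terms and
  the remaining factors are absorbed in \<open>(4 * r) ^ p\<close>.\<close>

lemma wnorm_quad_part: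
  assumes V: "fmaj V V" and x: "0 \<le> x" and r: "1 \<le> r" "wnorm x n V \<le> r"
    and Y: "wnorm x n (V - fps_const (fps_nth V 0)) \<le> Y"
  shows "wnorm x n (quad_part V p) \<le> (4 * r) ^ p * Y\<^sup>2"
proof (induction p)
  case 0 show ?case by (simp add: wnorm_def)
next
  case (Suc p)
  let ?y = "V - fps_const (fps_nth V 0)"
  have yy: "fmaj ?y ?y" using V by (auto simp: fmaj_def)
  have v0: "0 \<le> fps_nth V 0" "fps_nth V 0 \<le> r"
    using fmaj_nonneg[OF V] nth_le_wnorm[OF V x, of 0 n] r by auto
  have Y0: "0 \<le> Y" using wnorm_nonneg[OF yy x] Y order_trans by blast
  have "wnorm x n (V * quad_part V p) \<le> wnorm x n V * wnorm x n (quad_part V p)"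
    by (intro wnorm_mult V x quad_part_mono refl)
  also have "\<dots> \<le> r * ((4 * r) ^ p * Y\<^sup>2)"
    using r by (intro mult_mono Suc wnorm_nonneg quad_part_mono V x refl) auto
  finally have 1: "wnorm x n (V * quad_part V p) \<le> r * ((4 * r) ^ p * Y\<^sup>2)" .
  have "wnorm x n (?y * ?y) \<le> wnorm x n ?y * wnorm x n ?y" by (intro wnorm_mult yy x)
  also have "\<dots> \<le> Y * Y" using Y Y0 by (intro mult_mono wnorm_nonneg yy x)
  finally have "wnorm x n (?y * ?y) \<le> Y\<^sup>2" by (simp add: power2_eq_square)
  then have "lin_coeff (fps_nth V 0) p * wnorm x n (?y * ?y) \<le> (4 * r) ^ p * Y\<^sup>2"
  proof (rule mult_mono[rotated])
    have "(2 * r) ^ p \<le> (4 * r) ^ p" using r by (intro power_mono) auto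
    then show "lin_coeff (fps_nth V 0) p \<le> (4 * r) ^ p" using lin_coeff_le[OF v0 r(1), of p] by linarith
  qed (use r in \<open>auto intro!: wnorm_nonneg fmaj_mult yy x\<close>)
  also have "\<dots> \<le> r * ((4 * r) ^ p * Y\<^sup>2)" using mult_right_mono[of 1 r "(4 * r) ^ p * Y\<^sup>2"] r by simp
  finally have "wnorm x n (quad_part V (Suc p)) \<le> r * ((4 * r) ^ p * Y\<^sup>2) + r * ((4 * r) ^ p * Y\<^sup>2)"
    unfolding quad_part.simps wnorm_add wnorm_const_mult using 1 by linarith
  also have "\<dots> \<le> 4 * (r * ((4 * r) ^ p * Y\<^sup>2))" using r by simp
  also have "\<dots> = (4 * r) ^ Suc p * Y\<^sup>2" by simp
  finally show ?case .
qed

text \<open>Scalar majorant of the iterates: the two series bound \<open>FD_F\<close> once \<open>W\<close> majorises the previous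
  iterates and \<open>h * W\<close> their increments over one grid cell, and \<open>c\<close> is the stability constant that
  turns a bound for \<open>FD_F\<close> into one for the next iterate.\<close>

fun majseq :: "(nat \<Rightarrow> real) \<Rightarrow> real \<Rightarrow> real \<Rightarrow> real \<Rightarrow> nat \<Rightarrow> real" where
  "majseq B c E h j = (if j = 0 then E else
     (let W = Abs_fps (\<lambda>k. if k < j then majseq B c E h k else 0) in
      c * ((\<Sum>q. B q * fps_nth (W * W ^ q) j)
         + h * (\<Sum>q. B q * (2 ^ q * fps_nth ((W * W) * W ^ q) (j - 1))))))"

declare majseq.simps [simp del]

lemma majseq_0: "majseq B c E h 0 = E"
  by (simp add: majseq.simps)

lemma majseq_Suc:
  assumes "0 < j"
  shows "majseq B c E h j = (let W = fps_cutoff j (Abs_fps (majseq B c E h)) in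
      c * ((\<Sum>q. B q * fps_nth (W * W ^ q) j)
         + h * (\<Sum>q. B q * (2 ^ q * fps_nth ((W * W) * W ^ q) (j - 1)))))"
proof -
  have "fps_cutoff j (Abs_fps (majseq B c E h)) = Abs_fps (\<lambda>k. if k < j then majseq B c E h k else 0)"
    by (simp add: fps_eq_iff)
  then show ?thesis using assms by (subst majseq.simps) simp
qed

lemma suminf_wsum_le:
  fixes T :: "nat \<Rightarrow> nat \<Rightarrow> real"
  assumes "\<And>j. j \<in> J \<Longrightarrow> summable (\<lambda>q. b q * T q j)"
    and "\<And>q. (\<Sum>j\<in>J. T q j * y j) \<le> H q" and "\<And>q. 0 \<le> b q" and "summable (\<lambda>q. b q * H q)"
  shows "(\<Sum>j\<in>J. (\<Sum>q. b q * T q j) * y j) \<le> (\<Sum>q. b q * H q)"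
proof -
  have s: "summable (\<lambda>q. b q * T q j * y j)" if "j \<in> J" for j
    using assms(1)[OF that] by (rule summable_mult2)
  have "(\<Sum>j\<in>J. (\<Sum>q. b q * T q j) * y j) = (\<Sum>j\<in>J. \<Sum>q. b q * T q j * y j)"
    by (intro sum.cong refl suminf_mult2 assms)
  also have "\<dots> = (\<Sum>q. \<Sum>j\<in>J. b q * T q j * y j)"
    by (rule suminf_sum[symmetric]) (rule s)
  also have "\<dots> \<le> (\<Sum>q. b q * H q)"
  proof (rule suminf_le[OF _ summable_sum assms(4)])
    show "(\<Sum>j\<in>J. b q * T q j * y j) \<le> b q * H q" for q
      using mult_left_mono[OF assms(2,3)] by (simp add: sum_distrib_left mult.assoc)
  qed (rule s)
  finally show ?thesis .
qed

section \<open>Geometric decay of the scalar majorant\<close>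

context entire_field
begin

lemma majseq_nonneg:
  assumes "1 \<le> E" "0 < c" "0 \<le> h"
  shows "0 \<le> majseq B c E h j"
proof (induction j rule: less_induct)
  case (less j)
  show ?case
  proof (cases "j = 0")
    case True then show ?thesis using assms by (simp add: majseq_0)
  next
    case False
    let ?W = "fps_cutoff j (Abs_fps (majseq B c E h))"
    have W: "fmaj ?W ?W" using less by (auto simp: fmaj_def)
    have "0 \<le> (\<Sum>q. B q * fps_nth (?W * ?W ^ q) j)"
      using summable_B_nth[OF W W, of 1 j]
      by (intro suminf_nonneg mult_nonneg_nonneg B_nonneg fmaj_nonneg[OF fmaj_mult[OF W fmaj_power[OF W]]]) simp
    moreover have "0 \<le> (\<Sum>q. B q * (2 ^ q * fps_nth ((?W * ?W) * ?W ^ q) (j - 1)))"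
      by (intro suminf_nonneg mult_nonneg_nonneg B_nonneg summable_B_nth W
          fmaj_mult[OF W W] fmaj_nonneg[OF fmaj_mult[OF fmaj_mult[OF W W] fmaj_power[OF W]]]) auto
    ultimately show ?thesis using False assms by (simp add: majseq_Suc Let_def)
  qed
qed

text \<open>Induction on the length of the partial sum. The recursion for the coefficients up to
  \<open>Suc n\<close> involves only those up to \<open>n\<close>, so the series entering it has
  norm at most \<open>E + d \<le> r\<close> and a non-constant part of norm at most
  \<open>d\<close>. Summing the recursion with the weights gives the left side of
  \<open>ineq\<close>.\<close>

lemma majseq_weighted_le:
  assumes E: "1 \<le> E" and c: "0 < c" and h: "0 \<le> h" and x: "0 \<le> x"
    and r: "r = E + 1" and d: "0 \<le> d" "d \<le> 1"
    and ineq: "c * (NB (4 * r) * (4 * r * d\<^sup>2) + (h * x) * (NB (2 * r) * r\<^sup>2)) \<le> d"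
  shows "(\<Sum>j=1..n. majseq B c E h j * x ^ j) \<le> d"
proof (induction n)
  case 0 then show ?case using d by simp
next
  case (Suc n)
  let ?a = "majseq B c E h"
  define A where "A = Abs_fps ?a"
  have A: "fmaj A A" using majseq_nonneg[OF E c h] by (simp add: A_def fmaj_def)
  \<comment> \<open>One \<open>V\<close> majorises all cut-off series with
    \<open>j \<le> Suc n\<close>, so that the weighted sum over \<open>j\<close> becomes a single
    weighted norm.\<close>
  define V where "V = fps_cutoff (Suc n) A"
  have V: "fmaj V V" using fmaj_nonneg[OF A] by (simp add: V_def fmaj_def)
  have V0: "fps_nth V 0 = E" by (simp add: V_def A_def majseq_0)
  have r1: "1 \<le> r" using E r by simp
  have wV: "wnorm x m V \<le> r" and wY: "wnorm x m (V - fps_const (fps_nth V 0)) \<le> d" for m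
  proof -
    let ?y = "V - fps_const (fps_nth V 0)"
    have "wnorm x m ?y = (\<Sum>j\<in>{..m} \<inter> {1..n}. ?a j * x ^ j)"
      unfolding wnorm_def by (rule sum.mono_neutral_cong_right) (auto simp: V_def A_def)
    also have "\<dots> \<le> (\<Sum>j=1..n. ?a j * x ^ j)"
      using majseq_nonneg[OF E c h] x by (intro sum_mono2) auto
    finally show y: "wnorm x m ?y \<le> d" using Suc by simp
    have "wnorm x m V = wnorm x m ?y + wnorm x m (fps_const E)"
      unfolding wnorm_add[symmetric] V0 by simp
    moreover have "wnorm x m (fps_const E) = (\<Sum>j\<in>{0}. fps_nth (fps_const E) j * x ^ j)"
      unfolding wnorm_def by (rule sum.mono_neutral_right) auto
    ultimately show "wnorm x m V \<le> r" using y d by (simp add: r)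
  qed
  have cut: "fmaj (fps_cutoff j A) V" "fps_nth (fps_cutoff j A) 0 = fps_nth V 0" if "j \<in> {1..Suc n}" for j
    using that fmaj_nonneg[OF A] by (auto simp: V_def fmaj_def)
  have step: "?a j \<le> c * ((\<Sum>q. B q * fps_nth (quad_part V (Suc q)) j)
         + h * (\<Sum>q. B q * (2 ^ q * fps_nth ((V * V) * V ^ q) (j - 1))))"
    and sQ: "summable (\<lambda>q. B q * fps_nth (quad_part V (Suc q)) j)" if j: "j \<in> {1..Suc n}" for j
  proof -
    let ?W = "fps_cutoff j A"
    have W: "fmaj ?W ?W" using fmaj_nonneg[OF A] by (simp add: fmaj_def)
    note WV = cut(1)[OF j]
    \<comment> \<open>The linear part has to go while the series is still cut off at
      \<open>j\<close>: the \<open>j\<close>-th coefficient of \<open>V\<close> need not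
      vanish.\<close>
    have e: "fps_nth (?W * ?W ^ q) j = fps_nth (quad_part ?W (Suc q)) j" for q
      using power_nth_eq_quad_part[of j ?W "Suc q"] j by simp
    have q_le: "fps_nth (quad_part ?W q) j \<le> fps_nth (quad_part V q) j" for q
      using fmajD[OF quad_part_mono[OF cut[OF j]], of q j] by linarith
    show sQ: "summable (\<lambda>q. B q * fps_nth (quad_part V (Suc q)) j)"
    proof (rule summable_comparison_test'[where g="\<lambda>q. B q * (1 ^ q * fps_nth (V * V ^ q) j)"])
      show "summable (\<lambda>q. B q * (1 ^ q * fps_nth (V * V ^ q) j))"
        by (rule summable_B_nth[OF V V]) simp
      fix q
      have "0 \<le> fps_nth (quad_part V (Suc q)) j" by (rule fmaj_nonneg[OF quad_part_mono[OF V refl]])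
      moreover have "fps_nth (quad_part V (Suc q)) j \<le> fps_nth (V * V ^ q) j"
      proof -
        have "0 \<le> lin_coeff (fps_nth V 0) (Suc q) * fps_nth V j"
          using fmaj_nonneg[OF V] by (intro mult_nonneg_nonneg lin_coeff_nonneg)
        then show ?thesis
          using arg_cong[OF power_eq_quad_part[of V "Suc q"], of "\<lambda>F. fps_nth F j"] j
          by (simp del: quad_part.simps lin_coeff.simps)
      qed
      ultimately show "norm (B q * fps_nth (quad_part V (Suc q)) j) \<le> B q * (1 ^ q * fps_nth (V * V ^ q) j)"
        using B_nonneg[of q] by (simp add: abs_mult mult_left_mono del: quad_part.simps)
    qed
    have 1: "(\<Sum>q. B q * fps_nth (?W * ?W ^ q) j) \<le> (\<Sum>q. B q * fps_nth (quad_part V (Suc q)) j)"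
    proof (rule suminf_le[OF _ _ sQ])
      show "B q * fps_nth (?W * ?W ^ q) j \<le> B q * fps_nth (quad_part V (Suc q)) j" for q
        unfolding e by (intro mult_left_mono q_le B_nonneg)
      show "summable (\<lambda>q. B q * fps_nth (?W * ?W ^ q) j)"
        using summable_B_nth[OF W W, of 1 j] by simp
    qed
    have 2: "(\<Sum>q. B q * (2 ^ q * fps_nth ((?W * ?W) * ?W ^ q) (j - 1)))
        \<le> (\<Sum>q. B q * (2 ^ q * fps_nth ((V * V) * V ^ q) (j - 1)))"
    proof (rule suminf_le)
      fix q
      have "fps_nth ((?W * ?W) * ?W ^ q) (j - 1) \<le> fps_nth ((V * V) * V ^ q) (j - 1)"
        using fmajD[OF fmaj_mult[OF fmaj_mult[OF WV WV] fmaj_power[OF WV]]] abs_le_D1 by blast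
      then show "B q * (2 ^ q * fps_nth ((?W * ?W) * ?W ^ q) (j - 1))
          \<le> B q * (2 ^ q * fps_nth ((V * V) * V ^ q) (j - 1))"
        by (intro mult_left_mono B_nonneg) auto
    qed (intro summable_B_nth fmaj_mult W V; simp)+
    have "?a j = c * ((\<Sum>q. B q * fps_nth (?W * ?W ^ q) j)
         + h * (\<Sum>q. B q * (2 ^ q * fps_nth ((?W * ?W) * ?W ^ q) (j - 1))))"
      using j by (simp add: majseq_Suc[of j] A_def Let_def)
    also have "\<dots> \<le> c * ((\<Sum>q. B q * fps_nth (quad_part V (Suc q)) j)
         + h * (\<Sum>q. B q * (2 ^ q * fps_nth ((V * V) * V ^ q) (j - 1))))"
      using 1 2 c h by (intro mult_left_mono add_mono) auto
    finally show "?a j \<le> \<dots>" .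
  qed
  have S1: "(\<Sum>j=1..Suc n. (\<Sum>q. B q * fps_nth (quad_part V (Suc q)) j) * x ^ j)
      \<le> (\<Sum>q. B q * ((4 * r) ^ Suc q * d\<^sup>2))"
  proof (rule suminf_wsum_le)
    fix q
    have "(\<Sum>j=1..Suc n. fps_nth (quad_part V (Suc q)) j * x ^ j) \<le> wnorm x (Suc n) (quad_part V (Suc q))"
      unfolding wnorm_def using fmaj_nonneg[OF quad_part_mono[OF V refl]] x
      by (intro sum_mono2) (auto simp del: quad_part.simps)
    also have "\<dots> \<le> (4 * r) ^ Suc q * d\<^sup>2" by (rule wnorm_quad_part[OF V x r1 wV wY])
    finally show "(\<Sum>j=1..Suc n. fps_nth (quad_part V (Suc q)) j * x ^ j) \<le> (4 * r) ^ Suc q * d\<^sup>2" .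
  next
    have e: "B q * ((4 * r) ^ Suc q * d\<^sup>2) = B q * (4 * r) ^ q * (4 * r * d\<^sup>2)" for q
      by (simp add: mult_ac)
    show "summable (\<lambda>q. B q * ((4 * r) ^ Suc q * d\<^sup>2))" unfolding e by (intro summable_mult2 B_conv)
  qed (use sQ B_nonneg in auto)
  have T1: "(\<Sum>q. B q * ((4 * r) ^ Suc q * d\<^sup>2)) = NB (4 * r) * (4 * r * d\<^sup>2)"
  proof -
    have "(\<Sum>q. B q * ((4 * r) ^ Suc q * d\<^sup>2)) = (\<Sum>q. (B q * (4 * r) ^ q) * (4 * r * d\<^sup>2))"
      by (simp add: mult_ac)
    then show ?thesis unfolding NB_def by (simp only: suminf_mult2[OF B_conv])
  qed
  have S2: "(\<Sum>j=1..Suc n. (\<Sum>q. B q * (2 ^ q * fps_nth ((V * V) * V ^ q) (j - 1))) * (x ^ (j - 1)))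
      \<le> (\<Sum>q. B q * (2 ^ q * r ^ (q + 2)))"
  proof (rule suminf_wsum_le)
    fix q
    have "(\<Sum>j=1..Suc n. 2 ^ q * fps_nth (V * V * V ^ q) (j - 1) * x ^ (j - 1)) = 2 ^ q * wnorm x n (V * V * V ^ q)"
      unfolding wnorm_def sum_distrib_left
      by (rule sum.reindex_bij_witness[of _ Suc "\<lambda>j. j - 1"]) auto
    also have "2 ^ q * wnorm x n (V * V * V ^ q) = 2 ^ q * wnorm x n (V ^ (q + 2))"
      by (simp add: power_add power2_eq_square mult_ac)
    also have "\<dots> \<le> 2 ^ q * r ^ (q + 2)"
      using wnorm_power[OF V x, of n "q + 2"] power_mono[OF wV wnorm_nonneg[OF V x], of n "q + 2"]
      by (intro mult_left_mono) auto
    finally show "(\<Sum>j=1..Suc n. 2 ^ q * fps_nth (V * V * V ^ q) (j - 1) * x ^ (j - 1)) \<le> 2 ^ q * r ^ (q + 2)" .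
  next
    have e: "B q * (2 ^ q * r ^ (q + 2)) = B q * (2 * r) ^ q * r\<^sup>2" for q
      by (simp add: mult_ac power_add power_mult_distrib power2_eq_square)
    show "summable (\<lambda>q. B q * (2 ^ q * r ^ (q + 2)))"
      unfolding e by (intro summable_mult2 B_conv)
  qed (use B_nonneg in \<open>auto intro!: summable_B_nth fmaj_mult V\<close>)
  have T2: "(\<Sum>q. B q * (2 ^ q * r ^ (q + 2))) = NB (2 * r) * r\<^sup>2"
  proof -
    have "(\<Sum>q. B q * (2 ^ q * r ^ (q + 2))) = (\<Sum>q. (B q * (2 * r) ^ q) * r\<^sup>2)"
      by (simp add: mult_ac power_add power_mult_distrib power2_eq_square)
    then show ?thesis unfolding NB_def by (simp only: suminf_mult2[OF B_conv])
  qed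
  let ?P = "\<lambda>j. \<Sum>q. B q * fps_nth (quad_part V (Suc q)) j"
  let ?R = "\<lambda>j. \<Sum>q. B q * (2 ^ q * fps_nth ((V * V) * V ^ q) (j - 1))"
  have "(\<Sum>j=1..Suc n. ?a j * x ^ j) \<le> (\<Sum>j=1..Suc n. c * (?P j + h * ?R j) * x ^ j)"
    using x by (intro sum_mono mult_right_mono step) auto
  \<comment> \<open>The index \<open>j - 1\<close> leaves one factor \<open>x\<close> over, which is
    paired with \<open>h\<close>. For the weight chosen below, \<open>h * x\<close> is independent
    of \<open>h\<close>.\<close>
  also have "\<dots> = (\<Sum>j=1..Suc n. c * (?P j * x ^ j + (h * x) * (?R j * x ^ (j - 1))))"
  proof (rule sum.cong[OF refl])
    fix j assume "j \<in> {1..Suc n}"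
    then have "x ^ j = x * x ^ (j - 1)" by (simp flip: power_Suc)
    then show "c * (?P j + h * ?R j) * x ^ j = c * (?P j * x ^ j + (h * x) * (?R j * x ^ (j - 1)))"
      by (simp add: distrib_left distrib_right mult_ac del: quad_part.simps)
  qed
  also have "\<dots> = c * ((\<Sum>j=1..Suc n. ?P j * x ^ j) + (h * x) * (\<Sum>j=1..Suc n. ?R j * x ^ (j - 1)))"
    by (simp only: sum_distrib_left sum.distrib distrib_left)
  also have "\<dots> \<le> c * (NB (4 * r) * (4 * r * d\<^sup>2) + (h * x) * (NB (2 * r) * r\<^sup>2))"
    using S1 S2 c h x unfolding T1 T2 by (intro mult_left_mono add_mono) auto
  finally show ?case using ineq by linarith
qed

text \<open>With \<open>x = 1 / (K * h)\<close> the product \<open>h * x\<close> is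
  \<open>1 / K\<close>, so \<open>K\<close> can be fixed independently of \<open>h\<close>.
  \<open>d\<close> is so small that the quadratic term takes at most half of \<open>d\<close>, and
  \<open>K\<close> so large that the other term takes at most the other half.\<close>

lemma majseq_geometric:
  assumes E: "1 \<le> E" and c: "0 < c"
  shows "\<exists>K>0. \<forall>h>0. \<forall>j. majseq B c E h j \<le> E * (K * h) ^ j"
proof -
  define r where "r = E + 1"
  define P where "P = c * NB (4 * r) * (4 * r)"
  define Q where "Q = c * (NB (2 * r) * r\<^sup>2)"
  have P: "0 \<le> P" and Q: "0 \<le> Q"
    using NB_nonneg[of "4 * r"] NB_nonneg[of "2 * r"] E c by (auto simp: P_def Q_def r_def)
  define d where "d = 1 / (1 + 2 * P)"
  have d: "0 < d" "d \<le> 1" "P * d \<le> 1 / 2" using P by (auto simp: d_def field_simps)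
  define K where "K = 2 * (Q + 1) / d"
  have K: "0 < K" using Q d by (simp add: K_def)
  show ?thesis
  proof (intro exI[of _ K] conjI allI impI K)
    fix h :: real and j :: nat assume h: "0 < h"
    define x where "x = 1 / (K * h)"
    have x: "0 < x" using K h by (simp add: x_def)
    have hx: "h * x = d / (2 * (Q + 1))" using h d by (simp add: x_def K_def)
    have "P * d\<^sup>2 \<le> d / 2" using mult_right_mono[OF d(3), of d] d by (simp add: power2_eq_square mult_ac)
    moreover have "(h * x) * Q \<le> d / 2"
      unfolding hx using Q d by (simp add: divide_le_eq mult_left_mono)
    ultimately have "c * (NB (4 * r) * (4 * r * d\<^sup>2) + (h * x) * (NB (2 * r) * r\<^sup>2)) \<le> d"
      by (simp add: P_def Q_def distrib_left mult_ac)
    from majseq_weighted_le[OF E c _ _ r_def _ _ this, of j] h x d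
    have s: "(\<Sum>i=1..j. majseq B c E h i * x ^ i) \<le> d" by simp
    show "majseq B c E h j \<le> E * (K * h) ^ j"
    proof (cases "j = 0")
      case True then show ?thesis by (simp add: majseq_0)
    next
      case False
      have "majseq B c E h j * x ^ j \<le> (\<Sum>i=1..j. majseq B c E h i * x ^ i)"
        using False majseq_nonneg[OF E c] h x by (intro member_le_sum) auto
      then have "majseq B c E h j * x ^ j \<le> E" using s d E by linarith
      moreover have "x ^ j = 1 / (K * h) ^ j" by (simp add: x_def power_one_over)
      moreover have "0 < (K * h) ^ j" using K h by simp
      ultimately show ?thesis by (simp add: divide_le_eq)
    qed
  qed
qed

end

section \<open>Convergence of the iterates\<close>

lemma sums_delay:
  fixes f :: "nat \<Rightarrow> 'a::real_normed_vector"
  assumes "f sums s"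
  shows "(\<lambda>n. if p \<le> n then f (n - p) else 0) sums s"
  using assms sums_iff_shift[of "\<lambda>n. if p \<le> n then f (n - p) else 0" p s] by simp

text \<open>Row \<open>p\<close> of the double series is the series of \<open>a\<close> delayed by
  \<open>p\<close> and applied to \<open>b p\<close>; its partial sums are dominated by
  \<open>norm (b p)\<close> times the sum of the norms of \<open>a\<close>.\<close>

lemma matrix_vector_Cauchy_product_sums:
  fixes a :: "nat \<Rightarrow> real^'n^'m" and b :: "nat \<Rightarrow> real^'n"
  assumes a: "summable (\<lambda>n. norm (a n))" "a sums s" and b: "summable (\<lambda>n. norm (b n))" "b sums r"
  shows "(\<lambda>n. \<Sum>p\<le>n. a (n - p) *v b p) sums (s *v r)"
proof (rule double_series)
  let ?g = "\<lambda>p n. if p \<le> n then a (n - p) *v b p else 0"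
  show "?g p sums (s *v b p)" for p
    by (rule sums_delay[OF bounded_linear.sums[OF mv.bounded_linear_left a(2)]])
  show "(\<lambda>p. ?g p n) sums (\<Sum>p\<le>n. a (n - p) *v b p)" for n
    using sums_finite[of "{..n}" "\<lambda>p. ?g p n"] by simp
  show "(\<lambda>p. s *v b p) sums (s *v r)"
    by (rule bounded_linear.sums[OF mv.bounded_linear_right b(2)])
  show "summable (\<lambda>p. (\<Sum>n. norm (a n)) * norm (b p))" by (rule summable_mult[OF b(1)])
  show "norm (\<Sum>n<k. ?g p n) \<le> (\<Sum>n. norm (a n)) * norm (b p)" for p k
  proof -
    let ?f = "\<lambda>n. if p \<le> n then norm (a (n - p)) else 0"
    have f: "?f sums (\<Sum>n. norm (a n))" by (rule sums_delay[OF summable_sums[OF a(1)]])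
    have "norm (\<Sum>n<k. ?g p n) \<le> (\<Sum>n<k. ?f n * norm (b p))"
      by (rule sum_norm_le) (simp add: norm_matrix_vector_mult_le)
    also have "\<dots> \<le> (\<Sum>n. norm (a n)) * norm (b p)"
      unfolding sum_distrib_right[symmetric] sums_unique[OF f]
      by (intro mult_right_mono sum_le_suminf sums_summable[OF f]) auto
    finally show ?thesis .
  qed
qed

lemma has_vector_derivative_series:
  fixes f :: "nat \<Rightarrow> real \<Rightarrow> 'a::banach"
  assumes S: "open S" "convex S" and f: "\<And>n x. x \<in> S \<Longrightarrow> (f n has_vector_derivative f' n x) (at x)"
    and M: "\<And>n x. x \<in> S \<Longrightarrow> norm (f' n x) \<le> M n" "summable M"
    and s: "\<And>x. x \<in> S \<Longrightarrow> (\<lambda>n. f n x) sums F x" and F': "\<And>x. x \<in> S \<Longrightarrow> (\<lambda>n. f' n x) sums F' x"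
    and x: "x \<in> S"
  shows "(F has_vector_derivative F' x) (at x)"
proof -
  have ul: "uniform_limit S (\<lambda>n x. \<Sum>i<n. f' i x) (\<lambda>x. \<Sum>i. f' i x) sequentially"
    by (rule Weierstrass_m_test[OF M])
  have "\<exists>G. \<forall>x\<in>S. (\<lambda>n. f n x) sums G x \<and> (G has_derivative (\<lambda>h. h *\<^sub>R F' x)) (at x within S)"
  proof (rule has_derivative_series[where f=f and f'="\<lambda>n x h. h *\<^sub>R f' n x" and x=x and l="F x"])
    show "(f n has_derivative (\<lambda>h. h *\<^sub>R f' n x)) (at x within S)" if "x \<in> S" for n x
      using f[OF that] unfolding has_vector_derivative_def by (rule has_derivative_at_withinI)
    show "\<forall>\<^sub>F n in sequentially. \<forall>x\<in>S. \<forall>h. norm ((\<Sum>i<n. h *\<^sub>R f' i x) - h *\<^sub>R F' x) \<le> e * norm h"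
      if "0 < e" for e
      using uniform_limitD[OF ul that]
    proof eventually_elim
      case (elim n)
      show ?case
      proof (intro ballI allI)
        fix x h assume x: "x \<in> S"
        have "norm ((\<Sum>i<n. f' i x) - F' x) \<le> e"
          using elim x sums_unique[OF F'[OF x]] by (auto simp: dist_norm less_imp_le)
        then have "\<bar>h\<bar> * norm ((\<Sum>i<n. f' i x) - F' x) \<le> \<bar>h\<bar> * e" by (intro mult_left_mono) auto
        then show "norm ((\<Sum>i<n. h *\<^sub>R f' i x) - h *\<^sub>R F' x) \<le> e * norm h"
          unfolding scaleR_sum_right[symmetric] scaleR_diff_right[symmetric] by (simp add: mult.commute)
      qed
    qed
  qed (use S x s in auto)
  then obtain G where G: "\<And>x. x \<in> S \<Longrightarrow> (\<lambda>n. f n x) sums G x"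
    "\<And>x. x \<in> S \<Longrightarrow> (G has_derivative (\<lambda>h. h *\<^sub>R F' x)) (at x within S)" by blast
  have "(G has_vector_derivative F' x) (at x)"
    unfolding has_vector_derivative_def by (rule G(2)[OF x, unfolded at_within_open[OF x S(1)]])
  then show ?thesis
    by (rule has_vector_derivative_transform_within_open[OF _ S(1) x]) (rule sums_unique2[OF G(1) s])
qed

section \<open>Stability, decay and summation of the FD-iterates\<close>

context dissipative_field
begin

lemma FD_deriv:
  assumes fd: "FD_iterates N \<phi> u0 g U" and g: "is_grid g t0" and t: "g i < t" "t < g (Suc i)"
  shows "(U j has_vector_derivative (N t (U 0 (g i)) *v U j t +
    (if j = 0 then \<phi> t else DN t (U 0 (g i)) (U j (g i)) *v U 0 t + FD_F N g U j i t))) (at t)"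
proof -
  obtain D where D: "\<forall>s\<in>{g i..g (Suc i)}. (U j has_vector_derivative D s) (at s within {g i..g (Suc i)})"
    "\<forall>s\<in>{g i..<g (Suc i)}. D s - N s (U 0 (g i)) *v U j s =
             (if j = 0 then \<phi> s
              else (\<Sum>q\<in>UNIV. U j (g i) $ q *\<^sub>R pderiv_mat (N s) (U 0 (g i)) q) *v U 0 s
                   + FD_F N g U j i s)"
    using fd[unfolded FD_iterates_def, THEN conjunct2, THEN conjunct2, THEN conjunct2, THEN spec,
        of j, THEN spec, of i] by blast
  have at: "at t within {g i..g (Suc i)} = at t" by (rule at_within_interior) (use t in auto)
  have "(U j has_vector_derivative D t) (at t within {g i..g (Suc i)})" by (rule D(1)[rule_format]) (use t in auto)
  then have "(U j has_vector_derivative D t) (at t)" unfolding at .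
  moreover have "D t = N t (U 0 (g i)) *v U j t +
    (if j = 0 then \<phi> t else DN t (U 0 (g i)) (U j (g i)) *v U 0 t + FD_F N g U j i t)"
  proof -
    have "t0 \<le> t" using grid_ge[OF g, of i] t by simp
    moreover have "t \<in> {g i..<g (Suc i)}" using t by simp
    ultimately show ?thesis using D(2) by (force simp: sum_pderiv_mat algebra_simps)
  qed
  ultimately show ?thesis by simp
qed

lemma FD_cont:
  assumes fd: "FD_iterates N \<phi> u0 g U" and g: "is_grid g t0"
  shows "continuous_on {t0..} (U j)" "continuous_on {g i..g (Suc i)} (U j)"
proof -
  show c: "continuous_on {t0..} (U j)" using fd g unfolding FD_iterates_def is_grid_def by auto
  show "continuous_on {g i..g (Suc i)} (U j)"
    by (rule continuous_on_subset[OF c]) (use grid_ge[OF g, of i] in auto)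
qed

text \<open>The cell estimates return at the right end the bound they assume at the left end, so
  induction over the nodes costs nothing and the constants do not depend on the grid. Maxima merge
  the constants for size and increment, because one scalar sequence is to majorise both.\<close>

lemma stability:
  "\<exists>E c h0. 1 \<le> E \<and> 0 < c \<and> 0 < h0 \<and> (\<forall>g U. is_grid g t0 \<and> grid_bdd g \<and> grid_step g \<le> h0 \<and> FD_iterates N \<phi> u0 g U \<longrightarrow>
     (\<forall>i. \<forall>t\<in>{g i..g (Suc i)}. norm (U 0 t) \<le> E \<and> norm (U 0 t - U 0 (g i)) \<le> grid_step g * E) \<and>
     (\<forall>j>0. \<forall>f\<ge>0. (\<forall>i. \<forall>t\<in>{g i<..<g (Suc i)}. norm (FD_F N g U j i t) \<le> f) \<longrightarrow>
        (\<forall>i. \<forall>t\<in>{g i..g (Suc i)}. norm (U j t) \<le> c * f \<and> norm (U j t - U j (g i)) \<le> grid_step g * (c * f))))"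
proof -
  define r where "r = norm u0 + (\<kappa> + 1) / \<alpha> + 1"
  have r: "1 \<le> r" "norm u0 \<le> r" "\<kappa> + 1 \<le> \<alpha> * r"
    using alpha_pos kappa_nonneg by (auto simp: r_def field_simps)
  define r2 where "r2 = 2 * r + 2 * \<kappa>"
  define c1 where "c1 = NB r * r2 + \<kappa>"
  define c where "c = 2 / \<alpha>"
  define D where "D = NB (2 * r)"
  define c2 where "c2 = NB r * (2 * c + 2 * (D * c * r + 1)) + D * c * r + 1"
  have nn: "0 \<le> NB r" "0 \<le> NB (2 * r2)" "0 \<le> D" "0 \<le> r2" "0 < c"
    using r kappa_nonneg alpha_pos by (auto simp: D_def r2_def c_def intro!: NB_nonneg)
  then have c1: "0 \<le> c1" and c2: "0 \<le> c2" using r kappa_nonneg by (auto simp: c1_def c2_def)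
  define X where "X = NB (2 * r2) * c1 * r2"
  define Y where "Y = D * c2 * r + D * c * c1"
  have X: "0 \<le> X" and Y: "0 \<le> Y" using nn c1 c2 r by (auto simp: X_def Y_def)
  \<comment> \<open>One denominator meets the four smallness conditions of the two cell estimates at
    once.\<close>
  define h0 where "h0 = 1 / (1 + 2 * NB r + X + Y)"
  have h0: "0 < h0" using nn X Y by (auto simp: h0_def intro!: add_pos_nonneg)
  let ?E = "max r c1" and ?c = "max c c2"
  have main: "(\<forall>i. \<forall>t\<in>{g i..g (Suc i)}. norm (U 0 t) \<le> ?E \<and> norm (U 0 t - U 0 (g i)) \<le> grid_step g * ?E) \<and>
     (\<forall>j>0. \<forall>f\<ge>0. (\<forall>i. \<forall>t\<in>{g i<..<g (Suc i)}. norm (FD_F N g U j i t) \<le> f) \<longrightarrow>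
        (\<forall>i. \<forall>t\<in>{g i..g (Suc i)}. norm (U j t) \<le> ?c * f \<and> norm (U j t - U j (g i)) \<le> grid_step g * (?c * f)))"
    if g: "is_grid g t0" and bdd: "grid_bdd g" and st: "grid_step g \<le> h0" and fd: "FD_iterates N \<phi> u0 g U" for g U
  proof -
    let ?h = "grid_step g"
    have h: "0 < ?h" by (rule grid_step_pos[OF g bdd])
    have "?h * (1 + 2 * NB r + X + Y) \<le> h0 * (1 + 2 * NB r + X + Y)"
      using st nn X Y by (intro mult_right_mono) auto
    also have "\<dots> = 1"
    proof -
      have "0 < 1 + 2 * NB r + X + Y" using nn X Y by linarith
      then show ?thesis by (simp add: h0_def)
    qed
    finally have "?h + 2 * (?h * NB r) + ?h * X + ?h * Y \<le> 1" by (simp add: algebra_simps)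
    moreover have "0 \<le> ?h * NB r" "0 \<le> ?h * X" "0 \<le> ?h * Y" using h nn X Y by auto
    ultimately have hs: "?h * NB r \<le> 1 / 2" "?h \<le> 1" "?h * X \<le> 1" "?h * Y \<le> 1" using h by linarith+
    have step: "g (Suc i) - g i \<le> ?h" for i by (rule grid_step_ge[OF bdd])
    have base: "norm (U 0 t) \<le> r \<and> norm (U 0 t - U 0 (g i)) \<le> c1 * ?h"
      if w: "norm (U 0 (g i)) \<le> r" and t: "g i \<le> t" "t \<le> g (Suc i)" for i t
    proof -
      have d: "(U 0 has_vector_derivative (N t (U 0 (g i)) *v U 0 t + \<phi> t)) (at t)"
        if "g i < t" "t < g (Suc i)" for t using FD_deriv[OF fd g that, of 0] by simp
      show ?thesis
        using base_step[OF grid_ge[OF g] r(1,3) w r2_def c1_def step hs(1,2) hs(3)[unfolded X_def]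
            FD_cont(2)[OF fd g] refl d t] by simp
    qed
    have w: "norm (U 0 (g i)) \<le> r" for i
    proof (induction i)
      case 0 show ?case using fd r by (simp add: FD_iterates_def)
    next
      case (Suc i) then show ?case using base[of i "g (Suc i)"] grid_less[OF g, of i] by auto
    qed
    have 0: "norm (U 0 t) \<le> ?E \<and> norm (U 0 t - U 0 (g i)) \<le> ?h * ?E" if "t \<in> {g i..g (Suc i)}" for i t
    proof -
      have "c1 * ?h \<le> ?h * ?E" using h by (simp add: mult.commute)
      then show ?thesis using base[OF w[of i], of t] that by auto
    qed
    moreover have "norm (U j t) \<le> ?c * f \<and> norm (U j t - U j (g i)) \<le> ?h * (?c * f)"
      if j: "0 < j" and f: "0 \<le> f" and F: "\<forall>i. \<forall>t\<in>{g i<..<g (Suc i)}. norm (FD_F N g U j i t) \<le> f"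
        and t: "t \<in> {g i..g (Suc i)}" for j f i t
    proof -
      have one: "norm (U j t) \<le> c * f \<and> norm (U j t - U j (g i)) \<le> c2 * ?h * f"
        if v: "norm (U j (g i)) \<le> c * f" and t: "g i \<le> t" "t \<le> g (Suc i)" for i t
      proof -
        have z: "norm (U 0 t) \<le> r" "norm (U 0 t - U 0 (g i)) \<le> c1 * ?h" if "g i < t" "t < g (Suc i)" for t
          using base[OF w[of i], of t] that by auto
        have d: "(U j has_vector_derivative (N t (U 0 (g i)) *v U j t + DN t (U 0 (g i)) (U j (g i)) *v U 0 t
            + FD_F N g U j i t)) (at t)"
          if "g i < t" "t < g (Suc i)" for t using FD_deriv[OF fd g that, of j] j by (simp add: add.assoc)
        have F': "norm (FD_F N g U j i t) \<le> f" if "g i < t" "t < g (Suc i)" for t using F that by simp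
        show ?thesis
          using correction_step[OF grid_ge[OF g] r(1) w z f F' c1 c_def D_def c2_def step hs(1,2)
              hs(4)[unfolded Y_def] FD_cont(2)[OF fd g] v d t] by simp
      qed
      have vi: "norm (U j (g i)) \<le> c * f" for i
      proof (induction i)
        case 0 show ?case using fd j f nn by (simp add: FD_iterates_def)
      next
        case (Suc i) then show ?case using one[of i "g (Suc i)"] grid_less[OF g, of i] by auto
      qed
      have "c * f \<le> ?c * f" using f by (intro mult_right_mono) auto
      moreover have "c2 * ?h * f \<le> ?h * (?c * f)"
      proof -
        have "?h * (c2 * f) \<le> ?h * (?c * f)" using h f by (intro mult_left_mono mult_right_mono) auto
        then show ?thesis by (simp add: mult_ac)
      qed
      ultimately show ?thesis using one[OF vi[of i], of t] t by auto
    qed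
    ultimately show ?thesis by blast
  qed
  show ?thesis
    by (rule exI[of _ ?E], rule exI[of _ ?c], rule exI[of _ h0])
      (use r nn h0 main in \<open>auto simp: max.coboundedI1 less_max_iff_disj\<close>)
qed

text \<open>Cutting off at \<open>j\<close> leaves Adomian polynomials of order below
  \<open>j\<close> unchanged, and at order \<open>j\<close> it is the argument 0 prescribed by the
  method. The last term of \<open>FD_F\<close> thus becomes the summand \<open>p = 0\<close> of the
  first sum.\<close>

lemma FD_F_eq:
  assumes t: "t0 \<le> t" and j: "0 < j"
  shows "FD_F N g U j i t =
      (\<Sum>p<j. cf t (\<lambda>k. if k < j then U k (g i) else 0) (j - p) *v U p t)
    + (\<Sum>p\<le>j - 1. (cf t (\<lambda>k. if k < j then U k t else 0) (j - 1 - p)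
        - cf t (\<lambda>k. if k < j then U k (g i) else 0) (j - 1 - p)) *v U p t)"
proof -
  let ?v = "\<lambda>k. if k < j then U k (g i) else 0"
  have "(\<Sum>p<j. cf t ?v (j - p) *v U p t) = cf t ?v j *v U 0 t + (\<Sum>p\<in>{1..j-1}. cf t ?v (j - p) *v U p t)"
  proof -
    have "{..<j} = insert 0 {1..j-1}" using j by auto
    then show ?thesis by simp
  qed
  moreover have "(\<Sum>p\<in>{1..j-1}. adomian (N t) (j - p) (\<lambda>k. U k (g i)) *v U p t)
      = (\<Sum>p\<in>{1..j-1}. cf t ?v (j - p) *v U p t)"
    unfolding adomian_eq_cf[OF t] by (intro sum.cong refl arg_cong2[of _ _ _ _ "(*v)"] cf_cong) auto
  moreover have "(\<Sum>p<j. (adomian (N t) (j - 1 - p) (\<lambda>k. U k t) - adomian (N t) (j - 1 - p) (\<lambda>k. U k (g i))) *v U p t)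
      = (\<Sum>p\<le>j - 1. (cf t (\<lambda>k. if k < j then U k t else 0) (j - 1 - p) - cf t ?v (j - 1 - p)) *v U p t)"
    unfolding adomian_eq_cf[OF t]
    by (intro sum.cong arg_cong2[of _ _ _ _ "(*v)"] arg_cong2[of _ _ _ _ "(-)"] cf_cong) (use j in auto)
  ultimately show ?thesis unfolding FD_F_def adomian_eq_cf[OF t, of j] by simp
qed

text \<open>Each sum is a convolution, hence bounded by one coefficient, of order \<open>j\<close>
  or \<open>j - 1\<close>, of a product of majorants. In the second sum the increments are majorised
  by \<open>fps_const h * W\<close>, which brings in the factor \<open>h\<close>, one more
  \<open>W\<close>, and the \<open>2 ^ q\<close> of the difference bound.\<close>

lemma FD_F_le:
  assumes t: "t0 \<le> t" and j: "0 < j" and A: "fmaj A A" "1 \<le> fps_nth A 0" and h: "0 \<le> h"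
    and U: "\<And>k. k < j \<Longrightarrow> norm (U k t) \<le> fps_nth A k" "\<And>k. k < j \<Longrightarrow> norm (U k (g i)) \<le> fps_nth A k"
      "\<And>k. k < j \<Longrightarrow> norm (U k t - U k (g i)) \<le> h * fps_nth A k"
    and W: "W = fps_cutoff j A"
  shows "norm (FD_F N g U j i t) \<le> (\<Sum>q. B q * fps_nth (W * W ^ q) j)
         + h * (\<Sum>q. B q * (2 ^ q * fps_nth ((W * W) * W ^ q) (j - 1)))"
proof -
  let ?v = "\<lambda>k. if k < j then U k (g i) else 0" and ?u = "\<lambda>k. if k < j then U k t else 0"
  have WW: "fmaj W W" using fmaj_nonneg[OF A(1)] by (simp add: W fmaj_def)
  have v: "vmaj ?v W" and u: "vmaj ?u W" using U by (auto simp: W vmaj_def)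
  have uv: "vmaj (\<lambda>k. ?u k - ?v k) (fps_const h * W)" using U by (auto simp: W vmaj_def)
  have W0: "1 \<le> fps_nth W 0" using A j by (simp add: W)
  have Up: "norm (U p t) \<le> fps_nth W p" if "p < j" for p using U that by (simp add: W)
  define M where "M n = (\<Sum>q. B q * fps_nth (W ^ q) n)" for n
  define M' where "M' n = (\<Sum>q. B q * 2 ^ q * fps_nth ((fps_const h * W) * W ^ q) n)" for n
  have M: "norm (cf t ?v n) \<le> M n" for n
    unfolding M_def by (rule norm_cf_le[OF t v])
  have M': "norm (cf t ?u n - cf t ?v n) \<le> M' n" for n
    unfolding M'_def using norm_cf_diff_le[OF t u v uv W0, of n] by (simp add: mult.assoc)
  have "norm (\<Sum>p<j. cf t ?v (j - p) *v U p t) \<le> (\<Sum>p<j. M (j - p) * fps_nth W p)"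
    by (rule sum_norm_le, rule order_trans[OF norm_matrix_vector_mult_le])
      (intro mult_mono M Up order_trans[OF norm_ge_zero M] norm_ge_zero; simp)
  \<comment> \<open>The added summand is zero, since \<open>W\<close> is cut off at
    \<open>j\<close>.\<close>
  also have "\<dots> = (\<Sum>p\<le>j. M (j - p) * fps_nth W p)"
    by (rule sum.mono_neutral_left) (auto simp: W)
  also have "\<dots> = (\<Sum>q. B q * fps_nth (W * W ^ q) j)"
    unfolding M_def by (rule fps_conv_suminf) (rule summable_B_power[OF WW])
  finally have 1: "norm (\<Sum>p<j. cf t ?v (j - p) *v U p t) \<le> (\<Sum>q. B q * fps_nth (W * W ^ q) j)" .
  have hW: "fmaj (fps_const h * W) (fps_const h * W)" using h by (intro fmaj_mult WW fmaj_const)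
  have "norm (\<Sum>p\<le>j - 1. (cf t ?u (j - 1 - p) - cf t ?v (j - 1 - p)) *v U p t)
      \<le> (\<Sum>p\<le>j - 1. M' (j - 1 - p) * fps_nth W p)"
    by (rule sum_norm_le, rule order_trans[OF norm_matrix_vector_mult_le])
      (use j in \<open>intro mult_mono M' Up order_trans[OF norm_ge_zero M'] norm_ge_zero; simp\<close>)
  also have "\<dots> = (\<Sum>q. B q * 2 ^ q * fps_nth (W * ((fps_const h * W) * W ^ q)) (j - 1))"
    unfolding M'_def by (rule fps_conv_suminf) (use summable_B_nth[OF WW hW, of 2] in \<open>simp add: mult.assoc\<close>)
  also have "\<dots> = (\<Sum>q. h * (B q * (2 ^ q * fps_nth ((W * W) * W ^ q) (j - 1))))"
  proof (rule suminf_cong)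
    fix q
    have e: "W * ((fps_const h * W) * W ^ q) = fps_const h * ((W * W) * W ^ q)" by (simp add: mult_ac)
    show "B q * 2 ^ q * fps_nth (W * ((fps_const h * W) * W ^ q)) (j - 1)
        = h * (B q * (2 ^ q * fps_nth ((W * W) * W ^ q) (j - 1)))"
      unfolding e fps_mult_left_const_nth by (simp only: mult_ac)
  qed
  also have "\<dots> = h * (\<Sum>q. B q * (2 ^ q * fps_nth ((W * W) * W ^ q) (j - 1)))"
    by (rule suminf_mult) (intro summable_B_nth fmaj_mult WW; simp)
  finally show ?thesis
    unfolding FD_F_eq[OF t j] using 1 by (intro norm_triangle_mono)
qed

text \<open>Strong induction on \<open>j\<close>: bounds on the earlier iterates and their
  increments bound \<open>FD_F\<close>, and the stability constant turns this into the next value of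
  \<open>majseq\<close>, for size and increment alike.\<close>

lemma FD_geometric:
  "\<exists>E K h0. 1 \<le> E \<and> 0 < K \<and> 0 < h0 \<and>
    (\<forall>g U. is_grid g t0 \<and> grid_bdd g \<and> grid_step g \<le> h0 \<and> FD_iterates N \<phi> u0 g U \<longrightarrow>
      (\<forall>j. \<forall>t\<ge>t0. norm (U j t) \<le> E * (K * grid_step g) ^ j))"
proof -
  obtain E c h0 where E: "1 \<le> E" and c: "0 < c" and h0: "0 < h0"
    and st: "\<forall>g U. is_grid g t0 \<and> grid_bdd g \<and> grid_step g \<le> h0 \<and> FD_iterates N \<phi> u0 g U \<longrightarrow>
     (\<forall>i. \<forall>t\<in>{g i..g (Suc i)}. norm (U 0 t) \<le> E \<and> norm (U 0 t - U 0 (g i)) \<le> grid_step g * E) \<and>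
     (\<forall>j>0. \<forall>f\<ge>0. (\<forall>i. \<forall>t\<in>{g i<..<g (Suc i)}. norm (FD_F N g U j i t) \<le> f) \<longrightarrow>
        (\<forall>i. \<forall>t\<in>{g i..g (Suc i)}. norm (U j t) \<le> c * f \<and> norm (U j t - U j (g i)) \<le> grid_step g * (c * f)))"
    using stability by blast
  obtain K where K: "0 < K" "\<And>h j. 0 < h \<Longrightarrow> majseq B c E h j \<le> E * (K * h) ^ j"
    using majseq_geometric[OF E c] by blast
  have "norm (U j t) \<le> E * (K * grid_step g) ^ j"
    if g: "is_grid g t0" and bdd: "grid_bdd g" and le: "grid_step g \<le> h0" and fd: "FD_iterates N \<phi> u0 g U"
      and t: "t0 \<le> t" for g U j t
  proof -
    let ?h = "grid_step g"
    let ?a = "majseq B c E ?h"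
    have h: "0 < ?h" by (rule grid_step_pos[OF g bdd])
    note an = majseq_nonneg[OF E c less_imp_le[OF h]]
    have s0: "norm (U 0 t) \<le> E \<and> norm (U 0 t - U 0 (g i)) \<le> ?h * E" if "t \<in> {g i..g (Suc i)}" for i t
      using st g bdd le fd that by blast
    have sj: "norm (U j t) \<le> c * f \<and> norm (U j t - U j (g i)) \<le> ?h * (c * f)"
      if "0 < j" "0 \<le> f" "\<forall>i. \<forall>t\<in>{g i<..<g (Suc i)}. norm (FD_F N g U j i t) \<le> f" "t \<in> {g i..g (Suc i)}" for j f i t
      using st g bdd le fd that by blast
    have main: "norm (U j t) \<le> ?a j \<and> norm (U j t - U j (g i)) \<le> ?h * ?a j" if "t \<in> {g i..g (Suc i)}" for j i t
      using that
    proof (induction j arbitrary: i t rule: less_induct)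
      case (less j)
      show ?case
      proof (cases "j = 0")
        case True then show ?thesis using s0[OF less.prems] by (simp add: majseq_0)
      next
        case False
        let ?A = "Abs_fps ?a"
        define W where "W = fps_cutoff j ?A"
        define f where "f = (\<Sum>q. B q * fps_nth (W * W ^ q) j)
         + ?h * (\<Sum>q. B q * (2 ^ q * fps_nth ((W * W) * W ^ q) (j - 1)))"
        have af: "?a j = c * f" using False by (simp add: majseq_Suc[of j] f_def W_def Let_def)
        have f: "0 \<le> f" using an[of j] c unfolding af by (simp add: zero_le_mult_iff)
        have "norm (FD_F N g U j i t) \<le> f" if t: "t \<in> {g i<..<g (Suc i)}" for i t
          unfolding f_def
        proof (rule FD_F_le[OF _ _ _ _ _ _ _ _ W_def])
          show "t0 \<le> t" using grid_ge[OF g, of i] t by simp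
          show "fmaj ?A ?A" using an by (simp add: fmaj_def)
          show "1 \<le> fps_nth ?A 0" using E by (simp add: majseq_0)
          fix k assume k: "k < j"
          show "norm (U k t) \<le> fps_nth ?A k" "norm (U k t - U k (g i)) \<le> ?h * fps_nth ?A k"
            using less.IH[OF k, of t i] t by auto
          show "norm (U k (g i)) \<le> fps_nth ?A k"
            using less.IH[OF k, of "g i" i] grid_less[OF g, of i] by auto
        qed (use False h in auto)
        then show ?thesis unfolding af using sj[OF _ f _ less.prems] False by blast
      qed
    qed
    obtain i where "g i \<le> t" "t < g (Suc i)" by (rule grid_cover[OF g t])
    then have "norm (U j t) \<le> ?a j" using main[of t i j] by auto
    also have "\<dots> \<le> E * (K * ?h) ^ j" by (rule K(2)[OF h])
    finally show ?thesis .
  qed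
  then show ?thesis using E K(1) h0 by blast
qed

text \<open>The split made for the stability estimate is undone: by \<open>cf_last\<close> the
  derivative term and the polynomial with last argument 0 recombine. What results are coefficients
  of genuine Cauchy products, which can be summed; the shift from \<open>Suc k\<close> to
  \<open>k\<close> is the factor \<tau> of the second term.\<close>

lemma FD_deriv_conv:
  assumes fd: "FD_iterates N \<phi> u0 g U" and g: "is_grid g t0" and t: "g i < t" "t < g (Suc i)"
  shows "(U j has_vector_derivative ((\<Sum>p\<le>j. cf t (\<lambda>k. U k (g i)) (j - p) *v U p t) +
    (case j of 0 \<Rightarrow> \<phi> t | Suc k \<Rightarrow>
      \<Sum>p\<le>k. (cf t (\<lambda>k. U k t) (k - p) - cf t (\<lambda>k. U k (g i)) (k - p)) *v U p t))) (at t)"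
proof (cases j)
  case 0
  have "t0 \<le> t" using grid_ge[OF g, of i] t by simp
  then show ?thesis using FD_deriv[OF fd g t, of j] 0 by (simp add: cf_0)
next
  case (Suc k)
  have t0: "t0 \<le> t" using grid_ge[OF g, of i] t by simp
  have j: "0 < j" using Suc by simp
  let ?v = "\<lambda>k. U k (g i)" and ?w = "\<lambda>k. if k < j then U k (g i) else 0"
  have split: "{..<j} = insert 0 {1..<j}" using j by auto
  have "(\<Sum>p\<le>j. cf t ?v (j - p) *v U p t) = N t (U 0 (g i)) *v U j t + (\<Sum>p<j. cf t ?v (j - p) *v U p t)"
    by (simp add: lessThan_Suc_atMost[symmetric] cf_0[OF t0])
  also have "(\<Sum>p<j. cf t ?v (j - p) *v U p t) = cf t ?v j *v U 0 t + (\<Sum>p\<in>{1..<j}. cf t ?v (j - p) *v U p t)"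
    unfolding split by simp
  also have "(\<Sum>p\<in>{1..<j}. cf t ?v (j - p) *v U p t) = (\<Sum>p\<in>{1..<j}. cf t ?w (j - p) *v U p t)"
    by (intro sum.cong refl arg_cong2[of _ _ _ _ "(*v)"] cf_cong) auto
  also have "cf t ?v j *v U 0 t = DN t (U 0 (g i)) (U j (g i)) *v U 0 t + cf t ?w j *v U 0 t"
    by (subst cf_last[OF t0 j]) (simp add: matrix_vector_mult_add_rdistrib)
  finally have 1: "(\<Sum>p\<le>j. cf t ?v (j - p) *v U p t) = N t (U 0 (g i)) *v U j t
      + (DN t (U 0 (g i)) (U j (g i)) *v U 0 t + (\<Sum>p<j. cf t ?w (j - p) *v U p t))"
    unfolding split by (simp add: add.assoc)
  have 2: "(\<Sum>p\<le>j - 1. (cf t (\<lambda>k. if k < j then U k t else 0) (j - 1 - p) - cf t ?w (j - 1 - p)) *v U p t)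
      = (\<Sum>p\<le>k. (cf t (\<lambda>k. U k t) (k - p) - cf t ?v (k - p)) *v U p t)"
    by (intro sum.cong arg_cong2[of _ _ _ _ "(*v)"] arg_cong2[of _ _ _ _ "(-)"])
      (auto simp: Suc intro!: cf_cong)
  show ?thesis
    using FD_deriv[OF fd g t, of j] j unfolding FD_F_eq[OF t0 j] 2 1 by (simp add: Suc add.assoc)
qed

text \<open>The geometric bound makes the series of derivatives converge uniformly on each open
  cell, so the sum \<open>Z\<close> can be differentiated termwise and solves the original equation
  there. Continuity at the nodes and uniqueness on each cell identify it with \<open>u\<close>, node
  by node.\<close>

lemma FD_sums_solution:
  assumes fd: "FD_iterates N \<phi> u0 g U" and g: "is_grid g t0" and sol: "is_solution N \<phi> t0 u0 u"
    and E: "1 \<le> E" and q: "0 \<le> q" "q \<le> 1 / 2"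
    and U: "\<And>j t. t0 \<le> t \<Longrightarrow> norm (U j t) \<le> E * q ^ j" and t: "t0 \<le> t"
  shows "(\<lambda>j. U j t) sums u t"
proof -
  define a where "a j = E * q ^ j" for j
  have sa: "summable a" unfolding a_def using q by (intro summable_mult summable_geometric) auto
  have a0: "0 \<le> a j" for j using E q by (simp add: a_def)
  define A where "A = Abs_fps a"
  have A: "fmaj A A" using a0 by (simp add: A_def fmaj_def)
  \<comment> \<open>A bound for the \<open>n\<close>-th Adomian polynomial at all times at once; the
    sum over \<open>n\<close> is controlled by the entire majorant at
    \<open>suminf a\<close>.\<close>
  define M where "M n = (\<Sum>p. B p * fps_nth (A ^ p) n)" for n
  have Mn: "0 \<le> B p * fps_nth (A ^ p) n" for p n
    by (intro mult_nonneg_nonneg B_nonneg fmaj_nonneg[OF fmaj_power[OF A]])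
  have M0: "0 \<le> M n" for n unfolding M_def by (intro suminf_nonneg summable_B_power A Mn)
  have sM: "summable M"
  proof (rule summableI_nonneg_bounded[OF M0])
    fix n
    have "(\<Sum>i<n. M i) = (\<Sum>p. \<Sum>i<n. B p * fps_nth (A ^ p) i)"
      unfolding M_def by (rule suminf_sum[symmetric]) (rule summable_B_power[OF A])
    also have "\<dots> \<le> (\<Sum>p. B p * (suminf a) ^ p)"
    proof (rule suminf_le[OF _ summable_sum[OF summable_B_power[OF A]] B_conv])
      fix p
      have "(\<Sum>i<n. fps_nth (A ^ p) i) \<le> wnorm 1 n (A ^ p)"
        unfolding wnorm_def using fmaj_nonneg[OF fmaj_power[OF A]] by (auto intro!: sum_mono2)
      also have "\<dots> \<le> wnorm 1 n A ^ p" by (rule wnorm_power[OF A]) simp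
      also have "\<dots> \<le> (suminf a) ^ p"
      proof (rule power_mono)
        show "wnorm 1 n A \<le> suminf a" unfolding wnorm_def A_def using sa a0 by (auto intro!: sum_le_suminf)
        show "0 \<le> wnorm 1 n A" by (rule wnorm_nonneg[OF A]) simp
      qed
      finally show "(\<Sum>i<n. B p * fps_nth (A ^ p) i) \<le> B p * (suminf a) ^ p"
        unfolding sum_distrib_left[symmetric] by (intro mult_left_mono B_nonneg)
    qed
    finally show "(\<Sum>i<n. M i) \<le> (\<Sum>p. B p * (suminf a) ^ p)" .
  qed
  have sU: "summable (\<lambda>j. norm (U j s))" if "t0 \<le> s" for s
    using U[OF that] by (intro summable_comparison_test'[OF sa, of 0]) (simp add: a_def)
  define Z where "Z s = (\<Sum>j. U j s)" for s
  have Z: "(\<lambda>j. U j s) sums Z s" if "t0 \<le> s" for s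
    unfolding Z_def by (rule summable_sums[OF summable_norm_cancel[OF sU[OF that]]])
  have cfM: "norm (cf x (\<lambda>k. U k s) n) \<le> M n" if "t0 \<le> x" "t0 \<le> s" for x s n
    unfolding M_def using U[OF that(2)] by (intro norm_cf_le[OF that(1)]) (simp add: vmaj_def A_def a_def)
  have scf: "summable (\<lambda>n. norm (cf x (\<lambda>k. U k s) n))" if "t0 \<le> x" "t0 \<le> s" for x s
    using cfM[OF that] by (intro summable_comparison_test'[OF sM, of 0]) simp
  have cfs: "cf x (\<lambda>k. U k s) sums N x (Z s)" if "t0 \<le> x" "t0 \<le> s" for x s
    unfolding Z_def by (rule cf_sums[OF that(1) sU[OF that(2)]])
  have cZ: "continuous_on {t0..} Z"
  proof -
    have "uniform_limit {t0..} (\<lambda>n s. \<Sum>i<n. U i s) (\<lambda>s. \<Sum>i. U i s) sequentially"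
      by (rule Weierstrass_m_test[OF _ sa]) (use U in \<open>auto simp: a_def\<close>)
    then show ?thesis unfolding Z_def
      by (rule uniform_limit_theorem[rotated])
        (auto intro!: always_eventually continuous_intros FD_cont(1)[OF fd g])
  qed
  have dZ: "(Z has_vector_derivative (N x (Z x) *v Z x + \<phi> x)) (at x)" if x: "g i < x" "x < g (Suc i)" for i x
  proof -
    let ?S = "{g i<..<g (Suc i)}"
    define P where "P j s = (\<Sum>p\<le>j. cf s (\<lambda>k. U k (g i)) (j - p) *v U p s)" for j s
    define Q where "Q j s = (\<Sum>p\<le>j. (cf s (\<lambda>k. U k s) (j - p) - cf s (\<lambda>k. U k (g i)) (j - p)) *v U p s)" for j s
    define b where "b j = (\<Sum>p\<le>j. a p * M (j - p))" for j
    have sb: "summable b" unfolding b_def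
      by (rule summable_Cauchy_product) (use sa sM a0 M0 in auto)
    have gi: "t0 \<le> g i" by (rule grid_ge[OF g])
    have Sge: "t0 \<le> s" if "s \<in> ?S" for s using that gi by simp
    have Pb: "norm (P j s) \<le> b j" if s: "s \<in> ?S" for j s
      unfolding P_def b_def
    proof (rule sum_norm_le)
      fix p
      have "norm (cf s (\<lambda>k. U k (g i)) (j - p) *v U p s) \<le> M (j - p) * a p"
        unfolding a_def
        by (rule order_trans[OF norm_matrix_vector_mult_le]) (intro mult_mono cfM U Sge s gi M0 norm_ge_zero)
      then show "norm (cf s (\<lambda>k. U k (g i)) (j - p) *v U p s) \<le> a p * M (j - p)" by (simp add: mult.commute)
    qed
    have Qb: "norm (Q j s) \<le> 2 * b j" if s: "s \<in> ?S" for j s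
      unfolding Q_def b_def sum_distrib_left
    proof (rule sum_norm_le)
      fix p
      have "norm (cf s (\<lambda>k. U k s) (j - p) - cf s (\<lambda>k. U k (g i)) (j - p)) \<le> M (j - p) + M (j - p)"
        by (rule order_trans[OF norm_triangle_ineq4]) (intro add_mono cfM Sge s gi)
      then have "norm ((cf s (\<lambda>k. U k s) (j - p) - cf s (\<lambda>k. U k (g i)) (j - p)) *v U p s) \<le> (M (j - p) + M (j - p)) * a p"
        unfolding a_def
        by (intro order_trans[OF norm_matrix_vector_mult_le] mult_mono U Sge s add_nonneg_nonneg M0 norm_ge_zero)
      then show "norm ((cf s (\<lambda>k. U k s) (j - p) - cf s (\<lambda>k. U k (g i)) (j - p)) *v U p s) \<le> 2 * (a p * M (j - p))"
        by (simp add: algebra_simps)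
    qed
    define R where "R j s = P j s + (case j of 0 \<Rightarrow> \<phi> s | Suc k \<Rightarrow> Q k s)" for j s
    show ?thesis
    proof (rule has_vector_derivative_series[where f=U and f'=R and S="?S" and F'="\<lambda>s. N s (Z s) *v Z s + \<phi> s"
          and M="\<lambda>j. b j + (case j of 0 \<Rightarrow> \<kappa> | Suc k \<Rightarrow> 2 * b k)"])
      show "(U n has_vector_derivative R n s) (at s)" if "s \<in> ?S" for n s
        unfolding R_def P_def Q_def using FD_deriv_conv[OF fd g, of i s n] that by simp
      show "norm (R n s) \<le> b n + (case n of 0 \<Rightarrow> \<kappa> | Suc k \<Rightarrow> 2 * b k)" if s: "s \<in> ?S" for n s
        unfolding R_def using Pb[OF s] Qb[OF s] phi_bdd[OF Sge[OF s]]
        by (intro norm_triangle_mono) (auto split: nat.split)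
      have "summable (\<lambda>j. case Suc j of 0 \<Rightarrow> \<kappa> | Suc k \<Rightarrow> 2 * b k)" using sb by (simp add: summable_mult)
      then have "summable (\<lambda>j. case j of 0 \<Rightarrow> \<kappa> | Suc k \<Rightarrow> 2 * b k)"
        using summable_Suc_iff[of "\<lambda>j. case j of 0 \<Rightarrow> \<kappa> | Suc k \<Rightarrow> 2 * b k"] by blast
      then show "summable (\<lambda>j. b j + (case j of 0 \<Rightarrow> \<kappa> | Suc k \<Rightarrow> 2 * b k))" by (rule summable_add[OF sb])
      show "(\<lambda>n. U n s) sums Z s" if "s \<in> ?S" for s by (rule Z[OF Sge[OF that]])
      show "(\<lambda>n. R n s) sums (N s (Z s) *v Z s + \<phi> s)" if "s \<in> ?S" for s
      proof -
        note s = Sge[OF that]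
        have 1: "(\<lambda>j. P j s) sums (N s (Z (g i)) *v Z s)"
          unfolding P_def by (rule matrix_vector_Cauchy_product_sums[OF scf[OF s gi] cfs[OF s gi] sU[OF s] Z[OF s]])
        have "summable (\<lambda>n. norm (cf s (\<lambda>k. U k s) n - cf s (\<lambda>k. U k (g i)) n))"
          by (rule summable_comparison_test'[OF summable_add[OF scf[OF s s] scf[OF s gi]], of 0])
            (simp add: norm_triangle_ineq4)
        then have "(\<lambda>j. Q j s) sums ((N s (Z s) - N s (Z (g i))) *v Z s)"
          unfolding Q_def
          by (rule matrix_vector_Cauchy_product_sums[OF _ sums_diff[OF cfs[OF s s] cfs[OF s gi]] sU[OF s] Z[OF s]])
        then have "(\<lambda>j. case Suc j of 0 \<Rightarrow> \<phi> s | Suc k \<Rightarrow> Q k s) sums ((N s (Z s) - N s (Z (g i))) *v Z s)"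
          by simp
        \<comment> \<open>The field frozen at the node cancels between the two sums, leaving
          \<open>N s (Z s)\<close>.\<close>
        from sums_add[OF 1 sums_Suc[OF this]] show ?thesis
          unfolding R_def by (simp add: mv.diff_left)
      qed
    qed (use x in auto)
  qed
  have agree: "Z s = u s" if "g i \<le> s" "s \<le> g (Suc i)" for i s
    using that
  proof (induction i arbitrary: s)
    case 0
    have "Z (g 0) = u (g 0)"
    proof -
      have "(\<lambda>j. U j (g 0)) sums (\<Sum>j\<in>{0}. U j (g 0))"
        by (rule sums_finite) (use fd in \<open>auto simp: FD_iterates_def\<close>)
      then have "(\<lambda>j. U j (g 0)) sums u0" using fd by (simp add: FD_iterates_def)
      then show ?thesis
        using Z[OF grid_ge[OF g, of 0]] is_solutionD(3)[OF sol] g sums_unique2 by (auto simp: is_grid_def)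
    qed
    then show ?case
      using grid_ge[OF g, of 0] "0.prems"
      by (intro solutions_agree[of "g 0" "g (Suc 0)" Z u s] continuous_on_subset[OF cZ]
          continuous_on_subset[OF is_solutionD(1)[OF sol]] dZ is_solutionD(2)[OF sol]) auto
  next
    case (Suc i)
    have "Z (g (Suc i)) = u (g (Suc i))" using Suc.IH[of "g (Suc i)"] grid_less[OF g, of i] by simp
    then show ?case
      using grid_ge[OF g, of "Suc i"] Suc.prems
      by (intro solutions_agree[of "g (Suc i)" "g (Suc (Suc i))" Z u s] continuous_on_subset[OF cZ]
          continuous_on_subset[OF is_solutionD(1)[OF sol]] dZ is_solutionD(2)[OF sol]) auto
  qed
  obtain i where "g i \<le> t" "t < g (Suc i)" by (rule grid_cover[OF g t])
  then have "Z t = u t" using agree[of i t] by simp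
  then show ?thesis using Z[OF t] by simp
qed

text \<open>Part of the geometric rate is traded for quadratic decay in \<open>j\<close>. That decay
  keeps the bound summable at \<open>h = R\<close>, where the geometric factor is 1.\<close>

lemma FD_bounds:
  "\<exists>E R. 0 < E \<and> 0 < R \<and> (\<forall>g U u. is_grid g t0 \<and> grid_bdd g \<and> grid_step g \<le> R \<and>
      FD_iterates N \<phi> u0 g U \<and> is_solution N \<phi> t0 u0 u \<longrightarrow>
      (\<forall>t\<ge>t0. (\<lambda>j. U j t) sums u t \<and> (\<forall>j. norm (U j t) \<le> E / (real j + 1)\<^sup>2 * (grid_step g / R) ^ j)))"
proof -
  obtain E K h0 where E: "1 \<le> E" and K: "0 < K" and h0: "0 < h0"
    and geo: "\<And>g U j t. is_grid g t0 \<Longrightarrow> grid_bdd g \<Longrightarrow> grid_step g \<le> h0 \<Longrightarrow> FD_iterates N \<phi> u0 g U \<Longrightarrow>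
      t0 \<le> t \<Longrightarrow> norm (U j t) \<le> E * (K * grid_step g) ^ j"
    using FD_geometric by blast
  \<comment> \<open>\<open>h0\<close> keeps the geometric estimate valid, and
    \<open>1 / (4 * K)\<close> makes \<open>K * h\<close> at most a quarter of
    \<open>h / R\<close>.\<close>
  define R where "R = min h0 (1 / (4 * K))"
  have R: "0 < R" "R \<le> h0" "K * R \<le> 1 / 4" using h0 K by (auto simp: R_def min_def field_simps)
  have main: "(\<lambda>j. U j t) sums u t \<and> norm (U j t) \<le> E / (real j + 1)\<^sup>2 * (grid_step g / R) ^ j"
    if g: "is_grid g t0" and bdd: "grid_bdd g" and le: "grid_step g \<le> R" and fd: "FD_iterates N \<phi> u0 g U"
      and sol: "is_solution N \<phi> t0 u0 u" and t: "t0 \<le> t" for g U u t j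
  proof
    let ?h = "grid_step g"
    have h: "0 < ?h" by (rule grid_step_pos[OF g bdd])
    have U: "norm (U j t) \<le> E * (K * ?h) ^ j" if "t0 \<le> t" for j t
      using geo[OF g bdd _ fd that] le R by simp
    have "K * ?h \<le> K * R" using le K by (intro mult_left_mono) auto
    then have "K * ?h \<le> 1 / 2" using R(3) by linarith
    then show "(\<lambda>j. U j t) sums u t"
      using K h by (intro FD_sums_solution[OF fd g sol E _ _ U t]) auto
    have "K * ?h \<le> (1 / 4) * (?h / R)"
    proof -
      have "K * ?h = (K * R) * (?h / R)" using R by simp
      also have "\<dots> \<le> (1 / 4) * (?h / R)" using R h by (intro mult_right_mono) auto
      finally show ?thesis .
    qed
    then have 1: "(K * ?h) ^ j \<le> (1 / 4) ^ j * (?h / R) ^ j"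
      using K h unfolding power_mult_distrib[symmetric] by (intro power_mono) auto
    have "real (Suc j) \<le> 2 ^ j" using of_nat_mono[OF Suc_leI[OF less_exp[of j]], where 'a=real] by simp
    then have "(real j + 1)\<^sup>2 \<le> (2 ^ j)\<^sup>2" by (intro power_mono) auto
    then have 2: "(1 / 4) ^ j \<le> 1 / (real j + 1)\<^sup>2"
      by (simp add: power_one_over power_mult[symmetric] mult.commute[of j] power_mult frac_le)
    have "E * (K * ?h) ^ j \<le> E * (1 / (real j + 1)\<^sup>2 * (?h / R) ^ j)"
      using order_trans[OF 1 mult_right_mono[OF 2]] E h R by (intro mult_left_mono) auto
    then show "norm (U j t) \<le> E / (real j + 1)\<^sup>2 * (?h / R) ^ j" using U[OF t, of j] by simp
  qed
  have "0 < E" using E by simp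
  then show ?thesis using R(1) main by blast
qed

end

section \<open>Tails of the series and the final estimates\<close>

lemma norm_sums_tail_le:
  fixes f :: "nat \<Rightarrow> 'a::banach"
  assumes "f sums s" "\<And>j. norm (f j) \<le> b j" "summable b"
  shows "norm (s - (\<Sum>i\<le>p. f i)) \<le> (\<Sum>j. b (j + Suc p))"
proof -
  have "(\<lambda>j. f (j + Suc p)) sums (s - (\<Sum>i<Suc p. f i))"
    by (rule sums_split_initial_segment[OF assms(1)])
  then have "s - (\<Sum>i\<le>p. f i) = (\<Sum>j. f (j + Suc p))" by (simp add: sums_iff lessThan_Suc_atMost)
  also have "norm \<dots> \<le> (\<Sum>j. b (j + Suc p))"
    using assms by (intro norm_suminf_le summable_ignore_initial_segment) auto
  finally show ?thesis .
qed

lemma summable_inverse_squares: "summable (\<lambda>j. 1 / (real j + 1)\<^sup>2)"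
  using inverse_power_summable[of 2, where 'a=real]
    summable_Suc_iff[of "\<lambda>n. inverse (of_nat n ^ 2 :: real)"]
  by (simp add: inverse_eq_divide add.commute)

theorem theorem2:
  fixes N :: "real \<Rightarrow> real^'m \<Rightarrow> real^'m^'m"
    and Nc :: "('m \<Rightarrow> nat) \<Rightarrow> real \<Rightarrow> real^'m^'m"
    and B :: "nat \<Rightarrow> real"
    and \<phi> :: "real \<Rightarrow> real^'m"
    and t0 \<kappa> \<alpha> :: real
    and u0 :: "real^'m"
  assumes N_series: "\<forall>t\<ge>t0. \<forall>u. (\<lambda>p. \<Sum>a\<in>{a. sum a UNIV = p}.
                         (\<Prod>k\<in>UNIV. (u $ k) ^ a k) *\<^sub>R Nc a t) sums N t u"
    and Nc_cont: "\<forall>a. continuous_on {t0..} (Nc a)"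
    and Nc_bdd: "\<forall>a. bdd_above ((\<lambda>t. matnorm (Nc a t)) ` {t0..})"
    and B_nonneg: "\<forall>p. B p \<ge> 0"
    and B_bound: "\<forall>p. (\<Sum>a\<in>{a. sum a UNIV = p}. (SUP t\<in>{t0..}. matnorm (Nc a t))) \<le> B p"
    and B_conv: "\<forall>x::real. summable (\<lambda>p. B p * x ^ p)"
    and phi_cont: "continuous_on {t0..} \<phi>"
    and phi_bdd: "\<forall>t\<ge>t0. norm (\<phi> t) \<le> \<kappa>"
    and alpha_pos: "\<alpha> > 0"
    and dissip: "\<forall>t\<ge>t0. \<forall>u v. v \<bullet> (jac N t u *v v) \<le> - \<alpha> * (v \<bullet> v)"
  shows "\<exists>u. is_solution N \<phi> t0 u0 u
           \<and> (\<forall>v. is_solution N \<phi> t0 u0 v \<longrightarrow> (\<forall>t\<ge>t0. v t = u t))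
           \<and> (\<exists>hbar>0. \<forall>g U. is_grid g t0 \<and> grid_bdd g \<and> grid_step g \<le> hbar
                 \<and> FD_iterates N \<phi> u0 g U \<longrightarrow>
                 (\<exists>S. uniform_limit {t0..} (\<lambda>n t. \<Sum>i<n. norm (U i t)) S sequentially)
                 \<and> uniform_limit {t0..} (\<lambda>n t. \<Sum>i<n. U i t) u sequentially)
           \<and> (\<exists>C R \<epsilon>. C > 0 \<and> R > 0 \<and> \<epsilon> > 0 \<and>
                (\<forall>g U p. is_grid g t0 \<and> grid_bdd g \<and> FD_iterates N \<phi> u0 g U \<longrightarrow>
                   (grid_step g < R \<longrightarrow> (\<forall>t\<ge>t0. norm (u t - (\<Sum>i\<le>p. U i t))
                      \<le> C / (real p + 1) powr (1 + \<epsilon>) * ((grid_step g / R) ^ (p + 1)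
                          / (1 - grid_step g / R))))
                 \<and> (grid_step g = R \<longrightarrow> (\<forall>t\<ge>t0. norm (u t - (\<Sum>i\<le>p. U i t))
                      \<le> C * (\<Sum>j. 1 / (real (j + p + 1) + 1) powr (1 + \<epsilon>))))))"
proof -
  let ?m = "real CARD('m) ^ 2"
  \<comment> \<open>The factor \<open>?m\<close> passes from the operator norm of the hypotheses to
    the Frobenius norm of the locale.\<close>
  interpret dissipative_field N Nc "\<lambda>p. ?m * B p" t0 \<phi> \<kappa> \<alpha> u0
  proof
    fix t :: real and u v :: "real^'m" and p :: nat and x :: real and a :: "'m \<Rightarrow> nat"
    show "continuous_on {t0..} (Nc a)" using Nc_cont by blast
    show "0 \<le> ?m * B p" using B_nonneg by simp
    show "summable (\<lambda>p. ?m * B p * x ^ p)" unfolding mult.assoc by (intro summable_mult B_conv[rule_format])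
    show "continuous_on {t0..} \<phi>" by fact
    show "0 < \<alpha>" by fact
    assume t: "t0 \<le> t"
    show "(\<lambda>p. \<Sum>a\<in>{a. sum a UNIV = p}. mpow (\<lambda>k. u $ k) a *\<^sub>R Nc a t) sums N t u"
      using N_series t unfolding mpow_def by blast
    have "(\<Sum>a\<in>{a. sum a UNIV = p}. norm (Nc a t)) \<le>
        (\<Sum>a\<in>{a. sum a UNIV = p}. ?m * (SUP t\<in>{t0..}. matnorm (Nc a t)))"
    proof (rule sum_mono)
      fix a
      have "matnorm (Nc a t) \<le> (SUP t\<in>{t0..}. matnorm (Nc a t))"
        by (rule cSUP_upper) (use Nc_bdd t in auto)
      then have "?m * matnorm (Nc a t) \<le> ?m * (SUP t\<in>{t0..}. matnorm (Nc a t))"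
        by (rule mult_left_mono) simp
      with norm_le_matnorm show "norm (Nc a t) \<le> ?m * (SUP t\<in>{t0..}. matnorm (Nc a t))"
        by (rule order_trans)
    qed
    also have "\<dots> \<le> ?m * B p"
      unfolding sum_distrib_left[symmetric] using B_bound by (intro mult_left_mono) auto
    finally show "(\<Sum>a\<in>{a. sum a UNIV = p}. norm (Nc a t)) \<le> ?m * B p" .
    show "norm (\<phi> t) \<le> \<kappa>" using phi_bdd t by blast
    show "v \<bullet> (jac N t u *v v) \<le> - \<alpha> * (v \<bullet> v)" using dissip t by blast
  qed
  obtain u where u: "is_solution N \<phi> t0 u0 u" using solution_exists by blast
  obtain E R where E: "0 < E" and R: "0 < R"
    and FD: "\<And>g U t. is_grid g t0 \<Longrightarrow> grid_bdd g \<Longrightarrow> grid_step g \<le> R \<Longrightarrow> FD_iterates N \<phi> u0 g U \<Longrightarrow>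
      t0 \<le> t \<Longrightarrow> (\<lambda>j. U j t) sums u t \<and> (\<forall>j. norm (U j t) \<le> E / (real j + 1)\<^sup>2 * (grid_step g / R) ^ j)"
    using FD_bounds u by blast
  have sq: "summable (\<lambda>j. E * (1 / (real j + 1)\<^sup>2))" by (intro summable_mult summable_inverse_squares)
  \<comment> \<open>Dropping the powers of \<open>h / R\<close> leaves a bound that serves both the
    uniform convergence and the case \<open>h = R\<close>.\<close>
  have coarse: "norm (U j t) \<le> E * (1 / (real j + 1)\<^sup>2)"
    if "is_grid g t0" "grid_bdd g" "grid_step g \<le> R" "FD_iterates N \<phi> u0 g U" "t0 \<le> t" for g U t j
  proof -
    have "(grid_step g / R) ^ j \<le> 1"
      using that(3) R grid_step_pos[OF that(1,2)] by (intro power_le_one) auto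
    then have "E / (real j + 1)\<^sup>2 * (grid_step g / R) ^ j \<le> E / (real j + 1)\<^sup>2 * 1"
      using E by (intro mult_left_mono) auto
    with FD[OF that, THEN conjunct2, THEN spec, of j] show ?thesis
      unfolding mult_1_right times_divide_eq_right by (rule order_trans)
  qed
  show ?thesis
  proof (rule exI[of _ u], intro conjI)
    show "is_solution N \<phi> t0 u0 u" by (rule u)
    show "\<forall>v. is_solution N \<phi> t0 u0 v \<longrightarrow> (\<forall>t\<ge>t0. v t = u t)" using solution_unique[OF u] by blast
    show "\<exists>hbar>0. \<forall>g U. is_grid g t0 \<and> grid_bdd g \<and> grid_step g \<le> hbar
                 \<and> FD_iterates N \<phi> u0 g U \<longrightarrow>
                 (\<exists>S. uniform_limit {t0..} (\<lambda>n t. \<Sum>i<n. norm (U i t)) S sequentially)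
                 \<and> uniform_limit {t0..} (\<lambda>n t. \<Sum>i<n. U i t) u sequentially"
    proof (intro exI[of _ R] conjI allI impI R; elim conjE)
      fix g U assume gU: "is_grid g t0" "grid_bdd g" "grid_step g \<le> R" "FD_iterates N \<phi> u0 g U"
      show "\<exists>S. uniform_limit {t0..} (\<lambda>n t. \<Sum>i<n. norm (U i t)) S sequentially"
        by (rule exI, rule Weierstrass_m_test[OF _ sq]) (use coarse[OF gU] in auto)
      have "uniform_limit {t0..} (\<lambda>n t. \<Sum>i<n. U i t) (\<lambda>t. \<Sum>i. U i t) sequentially"
        by (rule Weierstrass_m_test[OF _ sq]) (use coarse[OF gU] in auto)
      then show "uniform_limit {t0..} (\<lambda>n t. \<Sum>i<n. U i t) u sequentially"
        by (rule uniform_limit_cong'[THEN iffD1, rotated -1]) (use FD[OF gU] in \<open>auto simp: sums_iff\<close>)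
    qed
    have pw: "(real j + 1) powr (1 + 1) = (real j + 1)\<^sup>2" for j
      using powr_realpow[of "real j + 1" 2] by simp
    show "\<exists>C R \<epsilon>. C > 0 \<and> R > 0 \<and> \<epsilon> > 0 \<and>
                (\<forall>g U p. is_grid g t0 \<and> grid_bdd g \<and> FD_iterates N \<phi> u0 g U \<longrightarrow>
                   (grid_step g < R \<longrightarrow> (\<forall>t\<ge>t0. norm (u t - (\<Sum>i\<le>p. U i t))
                      \<le> C / (real p + 1) powr (1 + \<epsilon>) * ((grid_step g / R) ^ (p + 1)
                          / (1 - grid_step g / R))))
                 \<and> (grid_step g = R \<longrightarrow> (\<forall>t\<ge>t0. norm (u t - (\<Sum>i\<le>p. U i t))
                      \<le> C * (\<Sum>j. 1 / (real (j + p + 1) + 1) powr (1 + \<epsilon>)))))"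
    proof (rule exI[of _ E], rule exI[of _ R], rule exI[of _ 1], intro conjI allI impI E R; (elim conjE)?)
      fix g U p t assume g: "is_grid g t0" and bdd: "grid_bdd g" and fd: "FD_iterates N \<phi> u0 g U"
        and lt: "grid_step g < R" and t: "t0 \<le> t"
      define q where "q = grid_step g / R"
      have q: "0 \<le> q" "q < 1" using R lt grid_step_pos[OF g bdd] by (auto simp: q_def)
      have U: "(\<lambda>j. U j t) sums u t" "norm (U j t) \<le> E / (real j + 1)\<^sup>2 * q ^ j" for j
        using FD[OF g bdd _ fd t] lt by (auto simp: q_def)
      \<comment> \<open>Only the tail counts: for \<open>j \<le> p\<close> the norm itself is a
        placeholder, and for later \<open>j\<close> the quadratic factor is replaced by its value at
        \<open>p\<close>, which leaves a geometric series.\<close>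
      let ?b = "\<lambda>j. if j \<le> p then norm (U j t) else E / (real p + 1)\<^sup>2 * q ^ j"
      have "summable (\<lambda>j. E / (real p + 1)\<^sup>2 * q ^ j)"
        using q by (intro summable_mult summable_geometric) auto
      then have sb: "summable ?b"
        by (rule summable_cong[THEN iffD1, rotated])
          (auto simp: eventually_sequentially intro!: exI[of _ "Suc p"])
      have "norm (U j t) \<le> ?b j" for j
      proof (cases "j \<le> p")
        case False
        then have "E / (real j + 1)\<^sup>2 * q ^ j \<le> E / (real p + 1)\<^sup>2 * q ^ j"
          using E q by (intro mult_right_mono divide_left_mono power_mono) auto
        then show ?thesis using U(2)[of j] False by simp
      qed simp
      from norm_sums_tail_le[OF U(1) this sb, of p]
      have "norm (u t - (\<Sum>i\<le>p. U i t)) \<le> (\<Sum>j. E / (real p + 1)\<^sup>2 * q ^ Suc p * q ^ j)"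
        by (simp add: power_add mult_ac)
      also have "\<dots> = E / (real p + 1)\<^sup>2 * q ^ Suc p * (1 / (1 - q))"
        using q by (subst suminf_mult[OF summable_geometric]) (auto simp: suminf_geometric)
      finally show "norm (u t - (\<Sum>i\<le>p. U i t)) \<le> E / (real p + 1) powr (1 + 1) * ((grid_step g / R) ^ (p + 1)
                          / (1 - grid_step g / R))"
        unfolding pw q_def[symmetric] by simp
    next
      fix g U p t assume g: "is_grid g t0" and bdd: "grid_bdd g" and fd: "FD_iterates N \<phi> u0 g U"
        and eq: "grid_step g = R" and t: "t0 \<le> t"
      have le: "grid_step g \<le> R" using eq by simp
      have "norm (u t - (\<Sum>i\<le>p. U i t)) \<le> (\<Sum>j. E * (1 / (real (j + Suc p) + 1)\<^sup>2))"
        using FD[OF g bdd le fd t] coarse[OF g bdd le fd t] by (intro norm_sums_tail_le sq) auto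
      also have "\<dots> = E * (\<Sum>j. 1 / (real (j + Suc p) + 1)\<^sup>2)"
        by (rule suminf_mult) (rule summable_ignore_initial_segment[OF summable_inverse_squares])
      finally show "norm (u t - (\<Sum>i\<le>p. U i t)) \<le> E * (\<Sum>j. 1 / (real (j + p + 1) + 1) powr (1 + 1))"
        unfolding pw by simp
    qed simp
  qed
qed

end
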